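(* Let $(M,\omega)$ be a compact prequantizable symplectic manifold with a smooth family of compatible Kähler structures parametrized by a complex manifold $\mathcal{T}$ with trivial first cohomology group, i.e. $H^1(\mathcal{T},\mathbb{R})=0$. If there exists a formal Hitchin connection $D$ in the bundle $\mathcal{T}\times C^\infty(M)[[h]]$ over $\mathcal{T}$, then it is unique up to gauge equivalence.
   Context: Functions are complex valued; $\mathcal{D}_h(M)=\mathcal{D}(M)[[h]]$, where $\mathcal{D}(M)$ is the space of differential operators on $M$. A star product on $(M,\omega)$ is a $\mathbb{C}[[h]]$-bilinear product $f\star g=\sum_{k\ge 0}c^k(f,g)h^k$ on $C^\infty(M)[[h]]$ which is associative, has $1$ as unit, and satisfies $c^0(f,g)=fg$ and $c^1(f,g)-c^1(g,f)=i\{f,g\}$. Berezin-Toeplitz star product. $(M,\omega)$ is prequantizable if there is a Hermitian line bundle $\mathcal{L}$ with compatible connection of curvature $-i\omega$. For $\sigma\in\mathcal{T}$, $M_\sigma$ is $M$ with the corresponding Kähler structure. For $f\in C^\infty(M)$ the Toeplitz operator $T^{(k)}_{f,\sigma}$ maps a section $s$ of $\mathcal{L}^k$ to $\pi^{(k)}_\sigma(fs)$, where $\pi^{(k)}_\sigma$ is the orthogonal projection onto $H^0(M_\sigma;\mathcal{L}^k)$. The Berezin-Toeplitz star product is the unique star product $f\star^{BT}_\sigma g=\sum_l c^{(l)}_\sigma(f,g)h^l$ such that for all $f,g\in C^\infty(M)$ and every positive integer $L$, in operator norm on $H^0(M_\sigma;\mathcal{L}^k)$, $\bigl\|T^{(k)}_{f,\sigma}T^{(k)}_{g,\sigma}-\sum_{l=0}^LT^{(k)}_{c^{(l)}_\sigma(f,g),\sigma}k^{-l}\bigr\|=O(k^{-(L+1)})$.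 It is natural: $c^{(l)}_\sigma$ is a bidifferential operator of order at most $l$ in each argument. A formal connection is a connection on $\mathcal{T}\times C^\infty(M)[[h]]\to\mathcal{T}$ of the form $D_Vf=V[f]+A(V)(f)$, where $V$ is a vector field on $\mathcal{T}$, $V[f]$ is the derivative of the smooth section $f$ along $V$, and $A=\sum_{k\ge1}A^kh^k$ is a smooth $1$-form on $\mathcal{T}$ with values in $\mathcal{D}_h(M)$, with $A=0\bmod h$. It is compatible with a family $\{\star_\sigma\}$ if $D_V(f\star_\sigma g)=D_V(f)\star_\sigma g+f\star_\sigma D_V(g)$ for all $\sigma,V$ and all smooth sections $f,g$; for natural star products one also requires $A^k(V)$ to be of order at most $k$. A formal Hitchin connection is a formal connection that is compatible with $\{\star^{BT}_\sigma\}_{\sigma\in\mathcal{T}}$ and flat ($D_VD_W-D_WD_V-D_{[V,W]}=0$). Two formal connections $D,D'$ are gauge equivalent if $D'_V=P^{-1}D_VP$ for all vector fields $V$ on $\mathcal{T}$, for some $P\in C^\infty(\mathcal{T},\mathcal{D}_h(M))$ with $P=\mathrm{id}\bmod h$ and $P_\sigma(f\star^{BT}_\sigma g)=P_\sigma(f)\star^{BT}_\sigma P_\sigma(g)$ for all $\sigma\in\mathcal{T}$, $f,g\in C^\infty(M)$. *)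

theory Defs
  imports
    "HOL-Analysis.Analysis"
    "HOL-Library.Function_Algebras"
    "HOL-Library.Landau_Symbols"
    "HOL-Computational_Algebra.Formal_Power_Series"
begin

section \<open>Smooth manifolds\<close>

primrec Ck_on :: "nat \<Rightarrow> 'a::real_normed_vector set \<Rightarrow> ('a \<Rightarrow> 'b::real_normed_vector) \<Rightarrow> bool"
where
  "Ck_on 0 S f \<longleftrightarrow> continuous_on S f"
| "Ck_on (Suc k) S f \<longleftrightarrow> (\<forall>x\<in>S. f differentiable (at x)) \<and>
     (\<forall>v. Ck_on k S (\<lambda>x. frechet_derivative f (at x) v))"

text \<open>Only used for open sets \<open>S\<close>.\<close>

definition smooth_on :: "'a::real_normed_vector set \<Rightarrow> ('a \<Rightarrow> 'b::real_normed_vector) \<Rightarrow> bool"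
where "smooth_on S f \<longleftrightarrow> (\<forall>k. Ck_on k S f)"

text \<open>A chart is a pair of a domain and a coordinate map.  A manifold is a whole type \<open>'p\<close> with
  its (Hausdorff, second countable) topology, together with an atlas.\<close>

type_synonym ('p, 'e) chart = "'p set \<times> ('p \<Rightarrow> 'e)"

definition chart_inv :: "('p, 'e) chart \<Rightarrow> 'e \<Rightarrow> 'p"
where "chart_inv c = inv_into (fst c) (snd c)"

definition smooth_manifold ::
  "('p::{second_countable_topology, t2_space}, 'e::euclidean_space) chart set \<Rightarrow> bool"
where
  "smooth_manifold A \<longleftrightarrow>
     (\<forall>c\<in>A. open (fst c) \<and> open (snd c ` fst c) \<and>
        homeomorphism (fst c) (snd c ` fst c) (snd c) (chart_inv c)) \<and>
     (\<Union>c\<in>A. fst c) = UNIV \<and>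
     (\<forall>c\<in>A. \<forall>d\<in>A. smooth_on (snd c ` (fst c \<inter> fst d)) (snd d \<circ> chart_inv c))"

text \<open>Complex manifolds: the derivatives of the transition maps are complex linear.\<close>

definition complex_manifold ::
  "('t::{second_countable_topology, t2_space}, complex ^ 'd::finite) chart set \<Rightarrow> bool"
where
  "complex_manifold A \<longleftrightarrow> smooth_manifold A \<and>
     (\<forall>c\<in>A. \<forall>d\<in>A. \<forall>y \<in> snd c ` (fst c \<inter> fst d). \<forall>z w.
        frechet_derivative (snd d \<circ> chart_inv c) (at y) (z *s w) =
        z *s frechet_derivative (snd d \<circ> chart_inv c) (at y) w)"

definition prod_atlas :: "('p, 'e) chart set \<Rightarrow> ('q, 'f) chart set \<Rightarrow> ('p \<times> 'q, 'e \<times> 'f) chart set"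
where
  "prod_atlas A B = {(fst c \<times> fst d, \<lambda>(p, q). (snd c p, snd d q)) | c d. c \<in> A \<and> d \<in> B}"

definition smooth_fun ::
  "('p::topological_space, 'e::euclidean_space) chart set \<Rightarrow> 'p set \<Rightarrow>
    ('p \<Rightarrow> 'b::real_normed_vector) \<Rightarrow> bool"
where
  "smooth_fun A U f \<longleftrightarrow> open U \<and> (\<forall>c\<in>A. smooth_on (snd c ` (fst c \<inter> U)) (f \<circ> chart_inv c))"

text \<open>The tangent space at every point \<open>p\<close> is the model space \<open>'e\<close>, via a preferred chart
  \<open>chart_at A p\<close> chosen at \<open>p\<close>.  All tangent vectors below are expressed in this way, and
  \<open>mderiv A f p\<close> is the differential of \<open>f\<close> at \<open>p\<close> as a map on this tangent space.  The
  preferred chart may jump with \<open>p\<close>, so smoothness of tensors is always tested on the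
  components with respect to the coordinate fields \<open>coord_vec\<close> of one chart.\<close>

definition chart_at :: "('p, 'e) chart set \<Rightarrow> 'p \<Rightarrow> ('p, 'e) chart"
where "chart_at A p = (SOME c. c \<in> A \<and> p \<in> fst c)"

definition mderiv ::
  "('p, 'e::euclidean_space) chart set \<Rightarrow> ('p \<Rightarrow> 'b::real_normed_vector) \<Rightarrow> 'p \<Rightarrow> 'e \<Rightarrow> 'b"
where
  "mderiv A f p v =
     frechet_derivative (f \<circ> chart_inv (chart_at A p)) (at (snd (chart_at A p) p)) v"

text \<open>The tangent vector at \<open>p\<close> whose components in the chart \<open>c\<close> are \<open>w\<close>; for fixed \<open>w\<close> this is a
  constant-coefficient combination of the coordinate vector fields of \<open>c\<close>.\<close>

definition coord_vec ::
  "('p, 'e::euclidean_space) chart set \<Rightarrow> ('p, 'e) chart \<Rightarrow> 'p \<Rightarrow> 'e \<Rightarrow> 'e"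
where
  "coord_vec A c p w = frechet_derivative (snd (chart_at A p) \<circ> chart_inv c) (at (snd c p)) w"

definition vector_fields ::
  "('p::topological_space, 'e::euclidean_space) chart set \<Rightarrow> ('p \<Rightarrow> 'e) set"
where
  "vector_fields A = {V. \<forall>c\<in>A. smooth_fun A (fst c) (\<lambda>p. mderiv A (snd c) p (V p))}"

definition lie_bracket ::
  "('p, 'e::euclidean_space) chart set \<Rightarrow> ('p \<Rightarrow> 'e) \<Rightarrow> ('p \<Rightarrow> 'e) \<Rightarrow> 'p \<Rightarrow> 'e"
where
  "lie_bracket A V W p =
     (let comp = (\<lambda>X q. mderiv A (snd (chart_at A p)) q (X q))
      in mderiv A (comp W) p (V p) - mderiv A (comp V) p (W p))"

definition one_form_on ::
  "('p::topological_space, 'e::euclidean_space) chart set \<Rightarrow> 'p set \<Rightarrow> ('p \<Rightarrow> 'e \<Rightarrow> real) \<Rightarrow> bool"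
where
  "one_form_on A U \<alpha> \<longleftrightarrow> open U \<and> (\<forall>p\<in>U. linear (\<alpha> p)) \<and>
     (\<forall>c\<in>A. \<forall>w. smooth_fun A (fst c \<inter> U) (\<lambda>p. \<alpha> p (coord_vec A c p w)))"

text \<open>The exterior derivative of a 1-form, evaluated on two coordinate fields of the chart \<open>c\<close>.\<close>

definition ext_deriv1 ::
  "('p, 'e::euclidean_space) chart set \<Rightarrow> ('p \<Rightarrow> 'e \<Rightarrow> real) \<Rightarrow> ('p, 'e) chart \<Rightarrow> 'p \<Rightarrow> 'e \<Rightarrow> 'e \<Rightarrow> real"
where
  "ext_deriv1 A \<alpha> c p v w =
     mderiv A (\<lambda>q. \<alpha> q (coord_vec A c q w)) p (coord_vec A c p v) -
     mderiv A (\<lambda>q. \<alpha> q (coord_vec A c q v)) p (coord_vec A c p w)"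

definition closed_one_form ::
  "('p::topological_space, 'e::euclidean_space) chart set \<Rightarrow> ('p \<Rightarrow> 'e \<Rightarrow> real) \<Rightarrow> bool"
where
  "closed_one_form A \<alpha> \<longleftrightarrow> one_form_on A UNIV \<alpha> \<and>
     (\<forall>c\<in>A. \<forall>p\<in>fst c. \<forall>v w. ext_deriv1 A \<alpha> c p v w = 0)"

definition exact_one_form ::
  "('p::topological_space, 'e::euclidean_space) chart set \<Rightarrow> ('p \<Rightarrow> 'e \<Rightarrow> real) \<Rightarrow> bool"
where
  "exact_one_form A \<alpha> \<longleftrightarrow>
     (\<exists>u::'p \<Rightarrow> real. smooth_fun A UNIV u \<and> (\<forall>p v. \<alpha> p v = mderiv A u p v))"

text \<open>Vanishing of the first real cohomology group, in its de Rham model.\<close>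

definition trivial_H1 :: "('p::topological_space, 'e::euclidean_space) chart set \<Rightarrow> bool"
where "trivial_H1 A \<longleftrightarrow> (\<forall>\<alpha>. closed_one_form A \<alpha> \<longrightarrow> exact_one_form A \<alpha>)"


section \<open>Symplectic and Kaehler structures\<close>

definition symplectic_form ::
  "('p::topological_space, 'e::euclidean_space) chart set \<Rightarrow> ('p \<Rightarrow> 'e \<Rightarrow> 'e \<Rightarrow> real) \<Rightarrow> bool"
where
  "symplectic_form A \<omega> \<longleftrightarrow>
     (\<forall>p. bilinear (\<omega> p)) \<and>
     (\<forall>p v. \<omega> p v v = 0) \<and>
     (\<forall>p v. v \<noteq> 0 \<longrightarrow> (\<exists>w. \<omega> p v w \<noteq> 0)) \<and>
     (\<forall>c\<in>A. \<forall>v w. smooth_fun A (fst c) (\<lambda>p. \<omega> p (coord_vec A c p v) (coord_vec A c p w))) \<and>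
     (\<forall>c\<in>A. \<forall>p\<in>fst c. \<forall>u v w.
        (let comp = (\<lambda>v w q. \<omega> q (coord_vec A c q v) (coord_vec A c q w))
         in mderiv A (comp v w) p (coord_vec A c p u) +
            mderiv A (comp w u) p (coord_vec A c p v) +
            mderiv A (comp u v) p (coord_vec A c p w) = 0))"

definition smooth_functions ::
  "('p::topological_space, 'e::euclidean_space) chart set \<Rightarrow> ('p \<Rightarrow> complex) set"
where "smooth_functions A = {f. smooth_fun A UNIV f}"

text \<open>The Hamiltonian field of a real function is normalized by \<open>\<omega>(X\<^sub>u, \<sqdot>) = du\<close> and the Poisson
  bracket by \<open>{f, g} = X\<^sub>f[g]\<close>, extended complex bilinearly.  With \<open>\<omega> = dx \<and> dy\<close> this
  means \<open>{x, y} = -1\<close>.  For Kaehler metrics \<open>\<omega>(\<sqdot>, J\<sqdot>)\<close> and prequantum curvature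
  \<open>-i\<omega>\<close>, this sign is the one for which \<open>[T\<^sub>f, T\<^sub>g]\<close> is \<open>(i/k) T\<^sub>h\<close> with \<open>h = {f, g}\<close> to
  leading order, as the axiom on \<open>c\<^sup>1\<close> below demands of the Berezin-Toeplitz product.\<close>

definition hamiltonian_vec ::
  "('p, 'e::euclidean_space) chart set \<Rightarrow> ('p \<Rightarrow> 'e \<Rightarrow> 'e \<Rightarrow> real) \<Rightarrow> ('p \<Rightarrow> real) \<Rightarrow> 'p \<Rightarrow> 'e"
where "hamiltonian_vec A \<omega> u p = (THE v. \<forall>w. \<omega> p v w = mderiv A u p w)"

definition poisson ::
  "('p, 'e::euclidean_space) chart set \<Rightarrow> ('p \<Rightarrow> 'e \<Rightarrow> 'e \<Rightarrow> real) \<Rightarrow>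
    ('p \<Rightarrow> complex) \<Rightarrow> ('p \<Rightarrow> complex) \<Rightarrow> 'p \<Rightarrow> complex"
where
  "poisson A \<omega> f g p =
     mderiv A g p (hamiltonian_vec A \<omega> (\<lambda>q. Re (f q)) p) +
     \<i> * mderiv A g p (hamiltonian_vec A \<omega> (\<lambda>q. Im (f q)) p)"

text \<open>Integrability of an almost complex structure: around every point there is a smooth chart in
  which it has constant coefficients, i.e. holomorphic coordinates.\<close>

definition integrable ::
  "('p::{second_countable_topology, t2_space}, 'e::euclidean_space) chart set \<Rightarrow>
    ('p \<Rightarrow> 'e \<Rightarrow> 'e) \<Rightarrow> bool"
where
  "integrable A J \<longleftrightarrow>
     (\<forall>p. \<exists>U z J0. p \<in> U \<and> smooth_manifold (insert (U, z) A) \<and>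
        linear J0 \<and> (\<forall>v. J0 (J0 v) = - v) \<and>
        (\<forall>q\<in>U. \<forall>v. mderiv A z q (J q v) = J0 (mderiv A z q v)))"

definition kaehler_structure ::
  "('p::{second_countable_topology, t2_space}, 'e::euclidean_space) chart set \<Rightarrow>
    ('p \<Rightarrow> 'e \<Rightarrow> 'e \<Rightarrow> real) \<Rightarrow> ('p \<Rightarrow> 'e \<Rightarrow> 'e) \<Rightarrow> bool"
where
  "kaehler_structure A \<omega> J \<longleftrightarrow>
     (\<forall>p. linear (J p) \<and> (\<forall>v. J p (J p v) = - v)) \<and>
     (\<forall>c\<in>A. \<forall>w. smooth_fun A (fst c) (\<lambda>p. mderiv A (snd c) p (J p (coord_vec A c p w)))) \<and>
     integrable A J \<and>
     (\<forall>p v w. \<omega> p (J p v) (J p w) = \<omega> p v w) \<and>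
     (\<forall>p v. v \<noteq> 0 \<longrightarrow> \<omega> p v (J p v) > 0)"

definition kaehler_family ::
  "('t::{second_countable_topology, t2_space}, 'b::euclidean_space) chart set \<Rightarrow>
    ('p::{second_countable_topology, t2_space}, 'e::euclidean_space) chart set \<Rightarrow>
    ('p \<Rightarrow> 'e \<Rightarrow> 'e \<Rightarrow> real) \<Rightarrow> ('t \<Rightarrow> 'p \<Rightarrow> 'e \<Rightarrow> 'e) \<Rightarrow> bool"
where
  "kaehler_family T M \<omega> J \<longleftrightarrow>
     (\<forall>\<sigma>. kaehler_structure M \<omega> (J \<sigma>)) \<and>
     (\<forall>c\<in>M. \<forall>w. smooth_fun (prod_atlas T M) (UNIV \<times> fst c)
        (\<lambda>(\<sigma>, p). mderiv M (snd c) p (J \<sigma> p (coord_vec M c p w))))"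


section \<open>Prequantum line bundle and Toeplitz operators\<close>

text \<open>A Hermitian line bundle \<open>L\<close> with compatible connection, given by unitary frames \<open>e\<^sub>i\<close> over
  an open cover \<open>U\<^sub>i\<close>: a section \<open>s\<close> is represented by \<open>s = s\<^sub>i e\<^sub>i\<close>, where \<open>s\<^sub>i = g\<^sub>i\<^sub>j s\<^sub>j\<close> with
  unitary transition functions \<open>g\<^sub>i\<^sub>j\<close>, and the connection is \<open>d - i a\<^sub>i\<close> in the frame \<open>e\<^sub>i\<close>, with real
  1-forms \<open>a\<^sub>i\<close>.  Then \<open>L\<^sup>k\<close> has transition functions \<open>g\<^sub>i\<^sub>j\<^sup>k\<close> and connection
  forms \<open>-i k a\<^sub>i\<close>, and the curvature of \<open>L\<close> is \<open>-i da\<^sub>i\<close>.\<close>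

record ('i, 'p, 'e) line_bundle =
  lb_cover :: "'i \<Rightarrow> 'p set"
  lb_trans :: "'i \<Rightarrow> 'i \<Rightarrow> 'p \<Rightarrow> complex"
  lb_pot :: "'i \<Rightarrow> 'p \<Rightarrow> 'e \<Rightarrow> real"

definition hermitian_line_bundle ::
  "('p::topological_space, 'e::euclidean_space) chart set \<Rightarrow> ('i, 'p, 'e) line_bundle \<Rightarrow> bool"
where
  "hermitian_line_bundle A L \<longleftrightarrow>
     (\<forall>i. open (lb_cover L i)) \<and> (\<Union>i. lb_cover L i) = UNIV \<and>
     (\<forall>i j. smooth_fun A (lb_cover L i \<inter> lb_cover L j) (lb_trans L i j)) \<and>
     (\<forall>i j. \<forall>p \<in> lb_cover L i \<inter> lb_cover L j. cmod (lb_trans L i j p) = 1) \<and>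
     (\<forall>i j k. \<forall>p \<in> lb_cover L i \<inter> lb_cover L j \<inter> lb_cover L k.
        lb_trans L i j p * lb_trans L j k p = lb_trans L i k p) \<and>
     (\<forall>i. one_form_on A (lb_cover L i) (lb_pot L i)) \<and>
     (\<forall>i j. \<forall>p \<in> lb_cover L i \<inter> lb_cover L j. \<forall>v.
        mderiv A (lb_trans L i j) p v =
        \<i> * of_real (lb_pot L i p v - lb_pot L j p v) * lb_trans L i j p)"

definition prequantum_bundle ::
  "('p::topological_space, 'e::euclidean_space) chart set \<Rightarrow> ('p \<Rightarrow> 'e \<Rightarrow> 'e \<Rightarrow> real) \<Rightarrow>
    ('i, 'p, 'e) line_bundle \<Rightarrow> bool"
where
  "prequantum_bundle A \<omega> L \<longleftrightarrow> hermitian_line_bundle A L \<and>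
     (\<forall>i. \<forall>c\<in>A. \<forall>p \<in> fst c \<inter> lb_cover L i. \<forall>v w.
        ext_deriv1 A (lb_pot L i) c p v w = \<omega> p (coord_vec A c p v) (coord_vec A c p w))"

text \<open>Smooth sections of \<open>L\<^sup>k\<close>; the representatives are set to \<open>0\<close> outside the cover sets in order
  that a section has a unique representation.\<close>

definition sections ::
  "('p::topological_space, 'e::euclidean_space) chart set \<Rightarrow> ('i, 'p, 'e) line_bundle \<Rightarrow> nat \<Rightarrow>
    ('i \<Rightarrow> 'p \<Rightarrow> complex) set"
where
  "sections A L k =
     {s. (\<forall>i. smooth_fun A (lb_cover L i) (s i)) \<and>
         (\<forall>i p. p \<notin> lb_cover L i \<longrightarrow> s i p = 0) \<and>
         (\<forall>i j. \<forall>p \<in> lb_cover L i \<inter> lb_cover L j. s i p = lb_trans L i j p ^ k * s j p)}"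

definition cov_deriv ::
  "('p, 'e::euclidean_space) chart set \<Rightarrow> ('i, 'p, 'e) line_bundle \<Rightarrow> nat \<Rightarrow>
    ('i \<Rightarrow> 'p \<Rightarrow> complex) \<Rightarrow> 'i \<Rightarrow> 'p \<Rightarrow> 'e \<Rightarrow> complex"
where
  "cov_deriv A L k s i p v = mderiv A (s i) p v - \<i> * of_nat k * of_real (lb_pot L i p v) * s i p"

text \<open>Holomorphic sections: \<open>\<nabla>\<close> vanishes on vectors \<open>v + i J v\<close> of type (0,1).\<close>

definition hol_sections ::
  "('p::topological_space, 'e::euclidean_space) chart set \<Rightarrow> ('i, 'p, 'e) line_bundle \<Rightarrow>
    ('p \<Rightarrow> 'e \<Rightarrow> 'e) \<Rightarrow> nat \<Rightarrow> ('i \<Rightarrow> 'p \<Rightarrow> complex) set"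
where
  "hol_sections A L J k =
     {s \<in> sections A L k. \<forall>i. \<forall>p \<in> lb_cover L i. \<forall>v.
        cov_deriv A L k s i p v + \<i> * cov_deriv A L k s i p (J p v) = 0}"

text \<open>The measure of the volume form \<open>\<omega>\<^sup>n/n!\<close>, whose density in a chart is the Pfaffian of the
  matrix of \<open>\<omega>\<close>, up to the orientation sign.\<close>

definition liouville_measure ::
  "('p::topological_space, real ^ 'm::finite) chart set \<Rightarrow>
    ('p \<Rightarrow> real ^ 'm \<Rightarrow> real ^ 'm \<Rightarrow> real) \<Rightarrow> 'p measure"
where
  "liouville_measure A \<omega> =
     (THE \<mu>. sets \<mu> = sets borel \<and>
       (\<forall>c\<in>A. \<forall>B \<in> sets borel. B \<subseteq> fst c \<longrightarrow>
          emeasure \<mu> B =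
          (\<integral>\<^sup>+ y. ennreal (sqrt (det (\<chi> i j. \<omega> (chart_inv c y)
                        (coord_vec A c (chart_inv c y) (axis i 1))
                        (coord_vec A c (chart_inv c y) (axis j 1)))))
                * indicator (snd c ` B) y \<partial>lborel)))"

text \<open>The Hermitian metric of \<open>L\<^sup>k\<close>; any frame containing the point may be used, since the
  transition functions are unitary.\<close>

definition herm_metric ::
  "('i, 'p, 'e) line_bundle \<Rightarrow> ('i \<Rightarrow> 'p \<Rightarrow> complex) \<Rightarrow> ('i \<Rightarrow> 'p \<Rightarrow> complex) \<Rightarrow> 'p \<Rightarrow> complex"
where
  "herm_metric L s t p = (let i = (SOME i. p \<in> lb_cover L i) in s i p * cnj (t i p))"

definition l2_inner ::
  "('p::topological_space, real ^ 'm::finite) chart set \<Rightarrow>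
    ('p \<Rightarrow> real ^ 'm \<Rightarrow> real ^ 'm \<Rightarrow> real) \<Rightarrow> ('i, 'p, real ^ 'm) line_bundle \<Rightarrow>
    ('i \<Rightarrow> 'p \<Rightarrow> complex) \<Rightarrow> ('i \<Rightarrow> 'p \<Rightarrow> complex) \<Rightarrow> complex"
where
  "l2_inner A \<omega> L s t = integral\<^sup>L (liouville_measure A \<omega>) (herm_metric L s t)"

definition l2_norm ::
  "('p::topological_space, real ^ 'm::finite) chart set \<Rightarrow>
    ('p \<Rightarrow> real ^ 'm \<Rightarrow> real ^ 'm \<Rightarrow> real) \<Rightarrow> ('i, 'p, real ^ 'm) line_bundle \<Rightarrow>
    ('i \<Rightarrow> 'p \<Rightarrow> complex) \<Rightarrow> real"
where "l2_norm A \<omega> L s = sqrt (Re (l2_inner A \<omega> L s s))"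

definition hol_projection ::
  "('p::topological_space, real ^ 'm::finite) chart set \<Rightarrow>
    ('p \<Rightarrow> real ^ 'm \<Rightarrow> real ^ 'm \<Rightarrow> real) \<Rightarrow> ('i, 'p, real ^ 'm) line_bundle \<Rightarrow>
    ('p \<Rightarrow> real ^ 'm \<Rightarrow> real ^ 'm) \<Rightarrow> nat \<Rightarrow> ('i \<Rightarrow> 'p \<Rightarrow> complex) \<Rightarrow> 'i \<Rightarrow> 'p \<Rightarrow> complex"
where
  "hol_projection A \<omega> L J k s =
     (THE u. u \<in> hol_sections A L J k \<and>
        (\<forall>v \<in> hol_sections A L J k. l2_inner A \<omega> L (s - u) v = 0))"

definition toeplitz ::
  "('p::topological_space, real ^ 'm::finite) chart set \<Rightarrow>
    ('p \<Rightarrow> real ^ 'm \<Rightarrow> real ^ 'm \<Rightarrow> real) \<Rightarrow> ('i, 'p, real ^ 'm) line_bundle \<Rightarrow>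
    ('p \<Rightarrow> real ^ 'm \<Rightarrow> real ^ 'm) \<Rightarrow> nat \<Rightarrow> ('p \<Rightarrow> complex) \<Rightarrow>
    ('i \<Rightarrow> 'p \<Rightarrow> complex) \<Rightarrow> 'i \<Rightarrow> 'p \<Rightarrow> complex"
where "toeplitz A \<omega> L J k f s = hol_projection A \<omega> L J k (\<lambda>i p. f p * s i p)"

definition hol_op_norm ::
  "('p::topological_space, real ^ 'm::finite) chart set \<Rightarrow>
    ('p \<Rightarrow> real ^ 'm \<Rightarrow> real ^ 'm \<Rightarrow> real) \<Rightarrow> ('i, 'p, real ^ 'm) line_bundle \<Rightarrow>
    ('p \<Rightarrow> real ^ 'm \<Rightarrow> real ^ 'm) \<Rightarrow> nat \<Rightarrow>
    (('i \<Rightarrow> 'p \<Rightarrow> complex) \<Rightarrow> 'i \<Rightarrow> 'p \<Rightarrow> complex) \<Rightarrow> real"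
where
  "hol_op_norm A \<omega> L J k F =
     Sup {l2_norm A \<omega> L (F s) | s. s \<in> hol_sections A L J k \<and> l2_norm A \<omega> L s \<le> 1}"


section \<open>Star products\<close>

type_synonym 'p formal = "('p \<Rightarrow> complex) fps"

definition formal_functions ::
  "('p::topological_space, 'e::euclidean_space) chart set \<Rightarrow> 'p formal set"
where "formal_functions A = {f. \<forall>n. fps_nth f n \<in> smooth_functions A}"

text \<open>A \<open>\<complex>[[h]]\<close>-bilinear product on formal functions is determined by its coefficients
  \<open>c\<^sup>k\<close> on \<open>C\<^sup>\<infinity>(M)\<close>; the extension to formal functions is as follows.\<close>

definition star ::
  "(nat \<Rightarrow> ('p \<Rightarrow> complex) \<Rightarrow> ('p \<Rightarrow> complex) \<Rightarrow> ('p \<Rightarrow> complex)) \<Rightarrow>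
    'p formal \<Rightarrow> 'p formal \<Rightarrow> 'p formal"
where
  "star c f g =
     Abs_fps (\<lambda>n. \<Sum>i\<le>n. \<Sum>j\<le>n - i. c (n - i - j) (fps_nth f i) (fps_nth g j))"

definition linear_op ::
  "('p::topological_space, 'e::euclidean_space) chart set \<Rightarrow>
    (('p \<Rightarrow> complex) \<Rightarrow> ('p \<Rightarrow> complex)) \<Rightarrow> bool"
where
  "linear_op A F \<longleftrightarrow>
     (\<forall>f \<in> smooth_functions A. F f \<in> smooth_functions A) \<and>
     (\<forall>f \<in> smooth_functions A. \<forall>g \<in> smooth_functions A. F (f + g) = F f + F g) \<and>
     (\<forall>f \<in> smooth_functions A. \<forall>z. F (\<lambda>x. z * f x) = (\<lambda>x. z * F f x))"

definition star_product ::
  "('p::topological_space, 'e::euclidean_space) chart set \<Rightarrow> ('p \<Rightarrow> 'e \<Rightarrow> 'e \<Rightarrow> real) \<Rightarrow>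
    (nat \<Rightarrow> ('p \<Rightarrow> complex) \<Rightarrow> ('p \<Rightarrow> complex) \<Rightarrow> ('p \<Rightarrow> complex)) \<Rightarrow> bool"
where
  "star_product A \<omega> c \<longleftrightarrow>
     (\<forall>k. \<forall>g \<in> smooth_functions A. linear_op A (c k g) \<and> linear_op A (\<lambda>f. c k f g)) \<and>
     (\<forall>f \<in> formal_functions A. \<forall>g \<in> formal_functions A. \<forall>h \<in> formal_functions A.
        star c (star c f g) h = star c f (star c g h)) \<and>
     (\<forall>f \<in> formal_functions A. star c 1 f = f \<and> star c f 1 = f) \<and>
     (\<forall>f \<in> smooth_functions A. \<forall>g \<in> smooth_functions A.
        c 0 f g = f * g \<and> (\<forall>p. c 1 f g p - c 1 g f p = \<i> * poisson A \<omega> f g p))"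

definition berezin_toeplitz ::
  "('p::topological_space, real ^ 'm::finite) chart set \<Rightarrow>
    ('p \<Rightarrow> real ^ 'm \<Rightarrow> real ^ 'm \<Rightarrow> real) \<Rightarrow> ('i, 'p, real ^ 'm) line_bundle \<Rightarrow>
    ('p \<Rightarrow> real ^ 'm \<Rightarrow> real ^ 'm) \<Rightarrow>
    (nat \<Rightarrow> ('p \<Rightarrow> complex) \<Rightarrow> ('p \<Rightarrow> complex) \<Rightarrow> ('p \<Rightarrow> complex)) \<Rightarrow> bool"
where
  "berezin_toeplitz A \<omega> L J c \<longleftrightarrow> star_product A \<omega> c \<and>
     (\<forall>f \<in> smooth_functions A. \<forall>g \<in> smooth_functions A. \<forall>N\<ge>1.
        (\<lambda>k. hol_op_norm A \<omega> L J k
           (\<lambda>s i p. toeplitz A \<omega> L J k f (toeplitz A \<omega> L J k g s) i p -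
              (\<Sum>l\<le>N. toeplitz A \<omega> L J k (c l f g) s i p / of_nat k ^ l)))
        \<in> O(\<lambda>k. 1 / real k ^ (N + 1)))"


section \<open>Differential operators and formal connections\<close>

text \<open>Differential operators of order at most \<open>n\<close> on \<open>C\<^sup>\<infinity>(M)\<close>, in Grothendieck's form: order \<open>0\<close>
  means linear over \<open>C\<^sup>\<infinity>(M)\<close>, and order at most \<open>n + 1\<close> means that all commutators with
  multiplication operators have order at most \<open>n\<close>.\<close>

primrec diff_ops ::
  "('p::topological_space, 'e::euclidean_space) chart set \<Rightarrow> nat \<Rightarrow>
    (('p \<Rightarrow> complex) \<Rightarrow> ('p \<Rightarrow> complex)) set"
where
  "diff_ops A 0 = {F. linear_op A F \<and>
     (\<forall>f \<in> smooth_functions A. \<forall>g \<in> smooth_functions A. F (f * g) = f * F g)}"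
| "diff_ops A (Suc n) = {F. linear_op A F \<and>
     (\<forall>f \<in> smooth_functions A. (\<lambda>g. F (f * g) - f * F g) \<in> diff_ops A n)}"

text \<open>Smooth maps from an open subset \<open>U\<close> of \<open>T\<close> to the differential operators on \<open>M\<close>: the order is
  locally bounded and the coefficients are smooth on \<open>U \<times> M\<close>; the latter is tested by
  applying the operators to smooth functions.\<close>

definition smooth_diff_ops ::
  "('t::topological_space, 'b::euclidean_space) chart set \<Rightarrow>
    ('p::topological_space, 'e::euclidean_space) chart set \<Rightarrow> 't set \<Rightarrow>
    ('t \<Rightarrow> ('p \<Rightarrow> complex) \<Rightarrow> ('p \<Rightarrow> complex)) \<Rightarrow> bool"
where
  "smooth_diff_ops T M U F \<longleftrightarrow>
     (\<forall>\<sigma>\<in>U. \<exists>W n. open W \<and> \<sigma> \<in> W \<and> (\<forall>\<tau> \<in> W \<inter> U. F \<tau> \<in> diff_ops M n)) \<and>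
     (\<forall>f \<in> smooth_functions M. smooth_fun (prod_atlas T M) (U \<times> UNIV) (\<lambda>(\<sigma>, x). F \<sigma> f x))"

definition diff_op_one_form ::
  "('t::topological_space, 'b::euclidean_space) chart set \<Rightarrow>
    ('p::topological_space, 'e::euclidean_space) chart set \<Rightarrow>
    ('t \<Rightarrow> 'b \<Rightarrow> ('p \<Rightarrow> complex) \<Rightarrow> ('p \<Rightarrow> complex)) \<Rightarrow> bool"
where
  "diff_op_one_form T M B \<longleftrightarrow>
     (\<forall>\<sigma>. \<forall>f \<in> smooth_functions M. \<forall>x. linear (\<lambda>v. B \<sigma> v f x)) \<and>
     (\<forall>c\<in>T. \<forall>w. smooth_diff_ops T M (fst c) (\<lambda>\<sigma>. B \<sigma> (coord_vec T c \<sigma> w)))"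

text \<open>The action of \<open>\<Sum>\<^sub>k B\<^sub>k h\<^sup>k\<close> on formal functions.\<close>

definition formal_op ::
  "(nat \<Rightarrow> ('p \<Rightarrow> complex) \<Rightarrow> ('p \<Rightarrow> complex)) \<Rightarrow> 'p formal \<Rightarrow> 'p formal"
where "formal_op B f = Abs_fps (\<lambda>n. \<Sum>k\<le>n. B k (fps_nth f (n - k)))"

definition smooth_sections ::
  "('t::topological_space, 'b::euclidean_space) chart set \<Rightarrow>
    ('p::topological_space, 'e::euclidean_space) chart set \<Rightarrow> ('t \<Rightarrow> 'p formal) set"
where
  "smooth_sections T M =
     {s. \<forall>n. smooth_fun (prod_atlas T M) UNIV (\<lambda>(\<sigma>, x). fps_nth (s \<sigma>) n x)}"

definition section_deriv ::
  "('t, 'b::euclidean_space) chart set \<Rightarrow> ('t \<Rightarrow> 'b) \<Rightarrow> ('t \<Rightarrow> 'p formal) \<Rightarrow> 't \<Rightarrow> 'p formal"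
where
  "section_deriv T V s \<sigma> = Abs_fps (\<lambda>n x. mderiv T (\<lambda>\<tau>. fps_nth (s \<tau>) n x) \<sigma> (V \<sigma>))"

text \<open>A connection is given by its covariant derivatives \<open>D V s\<close>, which are meaningful only for
  smooth vector fields \<open>V\<close> on \<open>T\<close> and smooth sections \<open>s\<close>.  The order condition on \<open>B k\<close> is the
  one imposed for families of natural star products.\<close>

definition formal_connection ::
  "('t::topological_space, 'b::euclidean_space) chart set \<Rightarrow>
    ('p::topological_space, 'e::euclidean_space) chart set \<Rightarrow>
    (('t \<Rightarrow> 'b) \<Rightarrow> ('t \<Rightarrow> 'p formal) \<Rightarrow> 't \<Rightarrow> 'p formal) \<Rightarrow> bool"
where
  "formal_connection T M D \<longleftrightarrow>
     (\<exists>B. (\<forall>k. diff_op_one_form T M (B k)) \<and>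
          (\<forall>\<sigma> v. \<forall>f \<in> smooth_functions M. B 0 \<sigma> v f = 0) \<and>
          (\<forall>k \<sigma> v. B k \<sigma> v \<in> diff_ops M k) \<and>
          (\<forall>V \<in> vector_fields T. \<forall>s \<in> smooth_sections T M. \<forall>\<sigma>.
             D V s \<sigma> = section_deriv T V s \<sigma> + formal_op (\<lambda>k. B k \<sigma> (V \<sigma>)) (s \<sigma>)))"

text \<open>The derivative of a product of sections only makes sense if the product is again a
  smooth section, i.e. if the family of star products is smooth.\<close>

definition compatible_connection ::
  "('t::topological_space, 'b::euclidean_space) chart set \<Rightarrow>
    ('p::topological_space, 'e::euclidean_space) chart set \<Rightarrow>
    ('t \<Rightarrow> nat \<Rightarrow> ('p \<Rightarrow> complex) \<Rightarrow> ('p \<Rightarrow> complex) \<Rightarrow> ('p \<Rightarrow> complex)) \<Rightarrow>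
    (('t \<Rightarrow> 'b) \<Rightarrow> ('t \<Rightarrow> 'p formal) \<Rightarrow> 't \<Rightarrow> 'p formal) \<Rightarrow> bool"
where
  "compatible_connection T M c D \<longleftrightarrow>
     (\<forall>f \<in> smooth_sections T M. \<forall>g \<in> smooth_sections T M.
        (\<lambda>\<sigma>. star (c \<sigma>) (f \<sigma>) (g \<sigma>)) \<in> smooth_sections T M \<and>
        (\<forall>V \<in> vector_fields T. \<forall>\<sigma>.
           D V (\<lambda>\<tau>. star (c \<tau>) (f \<tau>) (g \<tau>)) \<sigma> =
           star (c \<sigma>) (D V f \<sigma>) (g \<sigma>) + star (c \<sigma>) (f \<sigma>) (D V g \<sigma>)))"

definition flat_connection ::
  "('t::topological_space, 'b::euclidean_space) chart set \<Rightarrow>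
    ('p::topological_space, 'e::euclidean_space) chart set \<Rightarrow>
    (('t \<Rightarrow> 'b) \<Rightarrow> ('t \<Rightarrow> 'p formal) \<Rightarrow> 't \<Rightarrow> 'p formal) \<Rightarrow> bool"
where
  "flat_connection T M D \<longleftrightarrow>
     (\<forall>V \<in> vector_fields T. \<forall>W \<in> vector_fields T. \<forall>s \<in> smooth_sections T M. \<forall>\<sigma>.
        D V (D W s) \<sigma> - D W (D V s) \<sigma> - D (lie_bracket T V W) s \<sigma> = 0)"

definition formal_hitchin_connection ::
  "('t::topological_space, 'b::euclidean_space) chart set \<Rightarrow>
    ('p::topological_space, 'e::euclidean_space) chart set \<Rightarrow>
    ('t \<Rightarrow> nat \<Rightarrow> ('p \<Rightarrow> complex) \<Rightarrow> ('p \<Rightarrow> complex) \<Rightarrow> ('p \<Rightarrow> complex)) \<Rightarrow>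
    (('t \<Rightarrow> 'b) \<Rightarrow> ('t \<Rightarrow> 'p formal) \<Rightarrow> 't \<Rightarrow> 'p formal) \<Rightarrow> bool"
where
  "formal_hitchin_connection T M c D \<longleftrightarrow>
     formal_connection T M D \<and> compatible_connection T M c D \<and> flat_connection T M D"

text \<open>Here \<open>P k \<sigma>\<close> is the coefficient of \<open>h\<^sup>k\<close> in \<open>P\<^sub>\<sigma>\<close>.\<close>

definition gauge_equivalent ::
  "('t::topological_space, 'b::euclidean_space) chart set \<Rightarrow>
    ('p::topological_space, 'e::euclidean_space) chart set \<Rightarrow>
    ('t \<Rightarrow> nat \<Rightarrow> ('p \<Rightarrow> complex) \<Rightarrow> ('p \<Rightarrow> complex) \<Rightarrow> ('p \<Rightarrow> complex)) \<Rightarrow>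
    (('t \<Rightarrow> 'b) \<Rightarrow> ('t \<Rightarrow> 'p formal) \<Rightarrow> 't \<Rightarrow> 'p formal) \<Rightarrow>
    (('t \<Rightarrow> 'b) \<Rightarrow> ('t \<Rightarrow> 'p formal) \<Rightarrow> 't \<Rightarrow> 'p formal) \<Rightarrow> bool"
where
  "gauge_equivalent T M c D D' \<longleftrightarrow>
     (\<exists>P. (\<forall>k. smooth_diff_ops T M UNIV (P k)) \<and>
          (\<forall>\<sigma>. \<forall>f \<in> smooth_functions M. P 0 \<sigma> f = f) \<and>
          (\<forall>\<sigma>. \<forall>f \<in> smooth_functions M. \<forall>g \<in> smooth_functions M.
             formal_op (\<lambda>k. P k \<sigma>) (star (c \<sigma>) (fps_const f) (fps_const g)) =
             star (c \<sigma>) (formal_op (\<lambda>k. P k \<sigma>) (fps_const f)) (formal_op (\<lambda>k. P k \<sigma>) (fps_const g))) \<and>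
          (\<forall>V \<in> vector_fields T. \<forall>s \<in> smooth_sections T M. \<forall>\<sigma>.
             D' V s \<sigma> =
             inv_into (formal_functions M) (formal_op (\<lambda>k. P k \<sigma>))
               (D V (\<lambda>\<tau>. formal_op (\<lambda>k. P k \<tau>) (s \<tau>)) \<sigma>)))"

end

(*
  Write D = d + A and D' = d + A'.  A gauge transformation P from D to D' is a solution of
  dP = P A' - A P with P = id mod h and P = id at a base point of every component of T.  Since A
  and A' vanish mod h, the coefficient of h^k in this equation has the form dP_k = alpha_k, where
  alpha_k only involves P_j with j < k; flatness of both connections makes alpha_k closed, so
  H^1(T) = 0, applied to sigma |-> (alpha_k f)(x) for every function f and point x, gives P_k.
  A function on T is determined by its derivative and its values at the base points.  Applied to
  iterated commutators of P_k with functions this shows that P_k is a differential operator of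
  order at most k, and applied to the coefficients of P(f * g) - P f * P g, whose derivative
  vanishes by induction because D and D' are derivations, it shows that P is multiplicative.
*)
theory Submission
  imports Defs
begin

section \<open>Calculus of smooth maps between normed spaces\<close>

text \<open>The data come in weak forms, and this shapes the proof. Cohomology is applied for each f
  and x separately, so the primitives come without regularity in x, linearity in f or a bound on the
  order. All three are recovered afterwards, which is possible because the primitives are normalized
  at the base points. Smoothness of a family of operators is likewise tested on fixed functions
  only, whereas the recursion composes operators and differentiates F(s) with both F and s varying.
  Hadamard's lemma reduces this to fixed functions, by locality of differential operators and
  induction on their order, so that no topology on function spaces enters. Finally, connections act
  on global vector fields, while closedness of a form is a statement about coordinate fields.
  Cutoffs extend coordinate fields to global ones whose bracket vanishes at a given point, and
  flatness becomes a symmetry in the two fields there.\<close>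

lemma frechet_derivative_eqI: "(f has_derivative f') (at x) \<Longrightarrow> frechet_derivative f (at x) = f'"
  by (rule frechet_derivative_at[symmetric])

lemma Ck_on_subset: "Ck_on k S f \<Longrightarrow> T \<subseteq> S \<Longrightarrow> Ck_on k T f"
  by (induction k arbitrary: f) (auto intro: continuous_on_subset)

lemma frechet_derivative_cong_open:
  assumes "open S" "x \<in> S" "\<And>y. y \<in> S \<Longrightarrow> f y = g y"
  shows "frechet_derivative f (at x) = frechet_derivative g (at x)"
proof -
  have "(f has_derivative f') (at x) \<longleftrightarrow> (g has_derivative f') (at x)" for f'
    using has_derivative_transform_within_open[of _ _ _ UNIV S] assms by metis
  then show ?thesis by (simp add: frechet_derivative_def)
qed

lemma differentiable_cong_open:
  assumes "open S" "x \<in> S" "\<And>y. y \<in> S \<Longrightarrow> f y = g y"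
  shows "f differentiable (at x) \<longleftrightarrow> g differentiable (at x)"
  using has_derivative_transform_within_open[of _ _ _ UNIV S] assms
  unfolding differentiable_def by metis

lemma Ck_on_cong:
  assumes "open S" "\<And>x. x \<in> S \<Longrightarrow> f x = g x"
  shows "Ck_on k S f \<longleftrightarrow> Ck_on k S g"
  using assms(2)
proof (induction k arbitrary: f g)
  case 0
  then show ?case by (simp cong: continuous_on_cong)
next
  case (Suc k)
  have 1: "frechet_derivative f (at x) v = frechet_derivative g (at x) v" if "x \<in> S" for x v
    using frechet_derivative_cong_open[OF assms(1) that Suc.prems] by simp
  have 2: "f differentiable (at x) \<longleftrightarrow> g differentiable (at x)" if "x \<in> S" for x
    using differentiable_cong_open[OF assms(1) that Suc.prems] by simp
  show ?case
    using Suc.IH[OF 1] 2 by simp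
qed

lemma Ck_on_local:
  "(\<And>x. x \<in> S \<Longrightarrow> \<exists>U. open U \<and> x \<in> U \<and> Ck_on k U f) \<Longrightarrow> Ck_on k S f"
proof (induction k arbitrary: f)
  case 0
  show ?case
    unfolding Ck_on.simps
    using 0 by (intro continuous_at_imp_continuous_on ballI)
      (metis Ck_on.simps(1) continuous_on_eq_continuous_at)
next
  case (Suc k)
  have "Ck_on k S (\<lambda>x. frechet_derivative f (at x) v)" for v
    by (rule Suc.IH) (use Suc.prems in fastforce)
  then show ?case using Suc.prems by fastforce
qed

lemma Ck_on_SucD: "Ck_on (Suc k) S f \<Longrightarrow> Ck_on k S f"
proof (induction k arbitrary: f)
  case 0
  then show ?case
    by (auto intro!: continuous_at_imp_continuous_on differentiable_imp_continuous_within)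
next
  case (Suc k)
  then show ?case by (metis Ck_on.simps(2))
qed

lemma Ck_on_const [simp]: "Ck_on k S (\<lambda>x. a)"
  by (induction k arbitrary: a) auto

lemma Ck_on_bounded_linear:
  assumes L: "bounded_linear L" and "open S" "Ck_on k S f"
  shows "Ck_on k S (\<lambda>x. L (f x))"
  using assms(3)
proof (induction k arbitrary: f)
  case 0
  then show ?case using bounded_linear.continuous_on[OF L] by simp
next
  case (Suc k)
  have d: "((\<lambda>x. L (f x)) has_derivative (\<lambda>v. L (frechet_derivative f (at x) v))) (at x)" if "x \<in> S" for x
    using Suc.prems that by (intro bounded_linear.has_derivative[OF L]) (auto simp: frechet_derivative_works)
  have "Ck_on k S (\<lambda>x. frechet_derivative (\<lambda>x. L (f x)) (at x) v)" for v
    by (subst Ck_on_cong[OF \<open>open S\<close>, where g="\<lambda>x. L (frechet_derivative f (at x) v)"])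
      (use Suc in \<open>auto simp: frechet_derivative_eqI[OF d]\<close>)
  then show ?case using d by (auto simp: differentiable_def)
qed

lemma Ck_on_linear: "bounded_linear L \<Longrightarrow> Ck_on k S L"
  by (cases k) (auto simp: linear_continuous_on bounded_linear_imp_differentiable
      frechet_derivative_eqI[OF bounded_linear_imp_has_derivative])

lemma Ck_on_add:
  assumes "open S" "Ck_on k S f" "Ck_on k S g"
  shows "Ck_on k S (\<lambda>x. f x + g x)"
  using assms(2,3)
proof (induction k arbitrary: f g)
  case 0
  then show ?case by (auto intro: continuous_on_add)
next
  case (Suc k)
  have d: "((\<lambda>x. f x + g x) has_derivative (\<lambda>v. frechet_derivative f (at x) v + frechet_derivative g (at x) v)) (at x)"
    if "x \<in> S" for x
    using Suc.prems that by (intro has_derivative_add) (auto simp: frechet_derivative_works)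
  have "Ck_on k S (\<lambda>x. frechet_derivative (\<lambda>x. f x + g x) (at x) v)" for v
    by (subst Ck_on_cong[OF \<open>open S\<close>, where g="\<lambda>x. frechet_derivative f (at x) v + frechet_derivative g (at x) v"])
      (use Suc in \<open>auto simp: frechet_derivative_eqI[OF d]\<close>)
  then show ?case using d by (auto simp: differentiable_def)
qed

lemma Ck_on_bilinear:
  assumes B: "bounded_bilinear B" and "open S" "Ck_on k S f" "Ck_on k S g"
  shows "Ck_on k S (\<lambda>x. B (f x) (g x))"
  using assms(3,4)
proof (induction k arbitrary: f g)
  case 0
  then show ?case by (auto intro: bounded_bilinear.continuous_on[OF B])
next
  case (Suc k)
  have d: "((\<lambda>x. B (f x) (g x)) has_derivative
      (\<lambda>v. B (f x) (frechet_derivative g (at x) v) + B (frechet_derivative f (at x) v) (g x))) (at x)"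
    if "x \<in> S" for x
    using Suc.prems that by (intro bounded_bilinear.FDERIV[OF B]) (auto simp: frechet_derivative_works)
  have "Ck_on k S (\<lambda>x. frechet_derivative (\<lambda>x. B (f x) (g x)) (at x) v)" for v
    by (subst Ck_on_cong[OF \<open>open S\<close>, where g="\<lambda>x. B (f x) (frechet_derivative g (at x) v) + B (frechet_derivative f (at x) v) (g x)"])
      (use Suc Ck_on_SucD[OF Suc.prems(1)] Ck_on_SucD[OF Suc.prems(2)] \<open>open S\<close> in
        \<open>auto simp: frechet_derivative_eqI[OF d] intro!: Ck_on_add simp del: split_paired_All\<close>)
  then show ?case using d by (auto simp: differentiable_def)
qed

lemma Ck_on_sum:
  assumes "open S" "\<And>i. i \<in> I \<Longrightarrow> Ck_on k S (f i)"
  shows "Ck_on k S (\<lambda>x. \<Sum>i\<in>I. f i x)"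
  using assms(2)
  by (induction I rule: infinite_finite_induct) (auto intro: Ck_on_add[OF assms(1)])

text \<open>\<open>Ck_on\<close> differentiates in fixed directions only. Wherever a derivative is
  evaluated in a direction that moves with the point, this expansion replaces it by finitely many
  fixed directions with scalar coefficients.\<close>

lemma linear_euclidean_expand:
  fixes f :: "'a::euclidean_space \<Rightarrow> 'b::real_vector"
  assumes "linear f"
  shows "f w = (\<Sum>b\<in>Basis. (w \<bullet> b) *\<^sub>R f b)"
proof -
  have "f w = f (\<Sum>b\<in>Basis. (w \<bullet> b) *\<^sub>R b)" by (simp only: euclidean_representation)
  also have "\<dots> = (\<Sum>b\<in>Basis. (w \<bullet> b) *\<^sub>R f b)"
    by (simp only: linear_sum[OF assms] linear_cmul[OF assms])
  finally show ?thesis .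
qed

lemma Ck_on_compose:
  fixes f :: "'b::euclidean_space \<Rightarrow> 'c::real_normed_vector" and g :: "'a::real_normed_vector \<Rightarrow> 'b"
  assumes "open S" "open U" "g ` S \<subseteq> U" "Ck_on k S g" "Ck_on k U f"
  shows "Ck_on k S (\<lambda>x. f (g x))"
  using assms(4,5)
proof (induction k arbitrary: f)
  case 0
  then show ?case using assms(3) by (auto intro: continuous_on_compose2)
next
  case (Suc k)
  define D where "D = (\<lambda>x v. \<Sum>b\<in>Basis. (frechet_derivative g (at x) v \<bullet> b) *\<^sub>R frechet_derivative f (at (g x)) b)"
  have d: "((\<lambda>x. f (g x)) has_derivative D x) (at x)" if "x \<in> S" for x
  proof -
    have f: "(f has_derivative frechet_derivative f (at (g x))) (at (g x))"
      using Suc.prems assms(3) that by (auto simp: frechet_derivative_works)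
    have g: "(g has_derivative frechet_derivative g (at x)) (at x)"
      using Suc.prems that by (auto simp: frechet_derivative_works)
    have "linear (frechet_derivative f (at (g x)))"
      using f has_derivative_linear by blast
    then have "D x = (\<lambda>v. frechet_derivative f (at (g x)) (frechet_derivative g (at x) v))"
      unfolding D_def by (intro ext linear_euclidean_expand[symmetric])
    then show ?thesis using has_derivative_compose[OF g f] by simp
  qed
  have "Ck_on k S (\<lambda>x. D x v)" for v
    unfolding D_def
  proof (intro Ck_on_sum \<open>open S\<close> Ck_on_bilinear[OF bounded_bilinear_scaleR])
    fix b :: 'b assume "b \<in> Basis"
    show "Ck_on k S (\<lambda>x. frechet_derivative g (at x) v \<bullet> b)"
      using Suc.prems(1) by (intro Ck_on_bounded_linear[OF bounded_linear_inner_left] \<open>open S\<close>) auto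
    \<comment> \<open>The induction hypothesis is used for the derivative of f in direction b, with
      g kept and its regularity lowered by one.\<close>
    show "Ck_on k S (\<lambda>x. frechet_derivative f (at (g x)) b)"
      using Suc.prems Ck_on_SucD[OF Suc.prems(1)] by (intro Suc.IH) auto
  qed
  then have "Ck_on k S (\<lambda>x. frechet_derivative (\<lambda>x. f (g x)) (at x) v)" for v
    by (subst Ck_on_cong[OF \<open>open S\<close>, where g="\<lambda>x. D x v"]) (auto simp: frechet_derivative_eqI[OF d])
  then show ?case using d by (auto simp: differentiable_def)
qed

section \<open>Closure properties of smooth maps\<close>

named_theorems smooth_intros

lemma smooth_on_subset: "smooth_on S f \<Longrightarrow> T \<subseteq> S \<Longrightarrow> smooth_on T f"
  unfolding smooth_on_def using Ck_on_subset by blast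

lemma smooth_on_cong:
  "open S \<Longrightarrow> (\<And>x. x \<in> S \<Longrightarrow> f x = g x) \<Longrightarrow> smooth_on S f \<longleftrightarrow> smooth_on S g"
  unfolding smooth_on_def using Ck_on_cong by blast

lemma smooth_on_local:
  "(\<And>x. x \<in> S \<Longrightarrow> \<exists>U. open U \<and> x \<in> U \<and> smooth_on U f) \<Longrightarrow> smooth_on S f"
  unfolding smooth_on_def by (metis Ck_on_local)

lemma smooth_on_localI:
  assumes "\<And>x. x \<in> S \<Longrightarrow> \<exists>U g. open U \<and> x \<in> U \<and> smooth_on U g \<and> (\<forall>y\<in>U. f y = g y)"
  shows "smooth_on S f"
  by (rule smooth_on_local) (metis assms smooth_on_cong)

lemma smooth_on_const [smooth_intros, simp]: "smooth_on S (\<lambda>x. a)"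
  by (simp add: smooth_on_def)

lemma smooth_on_linear: "bounded_linear L \<Longrightarrow> smooth_on S L"
  by (simp add: smooth_on_def Ck_on_linear)

lemma smooth_on_id [smooth_intros, simp]: "smooth_on S (\<lambda>x. x)"
  by (intro smooth_on_linear bounded_linear_ident)

lemma smooth_on_bounded_linear:
  "bounded_linear L \<Longrightarrow> open S \<Longrightarrow> smooth_on S f \<Longrightarrow> smooth_on S (\<lambda>x. L (f x))"
  by (simp add: smooth_on_def Ck_on_bounded_linear)

lemmas smooth_on_fst [smooth_intros] = smooth_on_bounded_linear[OF bounded_linear_fst]
  and smooth_on_snd [smooth_intros] = smooth_on_bounded_linear[OF bounded_linear_snd]
  and smooth_on_inner_left [smooth_intros] = smooth_on_bounded_linear[OF bounded_linear_inner_left]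
  and smooth_on_uminus [smooth_intros] = smooth_on_bounded_linear[OF bounded_linear_minus[OF bounded_linear_ident]]
  and smooth_on_of_real [smooth_intros] = smooth_on_bounded_linear[OF bounded_linear_of_real]
  and smooth_on_Re [smooth_intros] = smooth_on_bounded_linear[OF bounded_linear_Re]
  and smooth_on_Im [smooth_intros] = smooth_on_bounded_linear[OF bounded_linear_Im]

lemma smooth_on_add [smooth_intros]:
  "open S \<Longrightarrow> smooth_on S f \<Longrightarrow> smooth_on S g \<Longrightarrow> smooth_on S (\<lambda>x. f x + g x)"
  by (simp add: smooth_on_def Ck_on_add)

lemma smooth_on_diff [smooth_intros]:
  "open S \<Longrightarrow> smooth_on S f \<Longrightarrow> smooth_on S g \<Longrightarrow> smooth_on S (\<lambda>x. f x - g x)"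
  using smooth_on_add[of S f "\<lambda>x. - g x"] smooth_on_uminus[of S g] by simp

lemma smooth_on_sum [smooth_intros]:
  "open S \<Longrightarrow> (\<And>i. i \<in> I \<Longrightarrow> smooth_on S (f i)) \<Longrightarrow> smooth_on S (\<lambda>x. \<Sum>i\<in>I. f i x)"
  by (simp add: smooth_on_def Ck_on_sum)

lemma smooth_on_bilinear:
  "bounded_bilinear B \<Longrightarrow> open S \<Longrightarrow> smooth_on S f \<Longrightarrow> smooth_on S g \<Longrightarrow> smooth_on S (\<lambda>x. B (f x) (g x))"
  by (simp add: smooth_on_def Ck_on_bilinear)

lemmas smooth_on_mult [smooth_intros] = smooth_on_bilinear[OF bounded_bilinear_mult]
  and smooth_on_scaleR [smooth_intros] = smooth_on_bilinear[OF bounded_bilinear_scaleR]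
  and smooth_on_inner [smooth_intros] = smooth_on_bilinear[OF bounded_bilinear_inner]

lemma smooth_on_Pair [smooth_intros]:
  assumes "open S" "smooth_on S f" "smooth_on S g"
  shows "smooth_on S (\<lambda>x. (f x, g x))"
proof -
  have "bounded_linear (\<lambda>a. (a, 0))" "bounded_linear (\<lambda>b. (0, b))"
    by (intro bounded_linear_Pair bounded_linear_ident bounded_linear_zero)+
  from smooth_on_add[OF assms(1) smooth_on_bounded_linear[OF this(1) assms(1,2)]
      smooth_on_bounded_linear[OF this(2) assms(1,3)]]
  show ?thesis by simp
qed

lemma smooth_on_compose:
  fixes f :: "'b::euclidean_space \<Rightarrow> 'c::real_normed_vector"
  assumes "smooth_on U f" "open U" "open S" "smooth_on S g" "\<And>x. x \<in> S \<Longrightarrow> g x \<in> U"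
  shows "smooth_on S (\<lambda>x. f (g x))"
  using Ck_on_compose[of S U g] assms unfolding smooth_on_def by blast

lemma smooth_on_differentiable: "smooth_on S f \<Longrightarrow> x \<in> S \<Longrightarrow> f differentiable (at x)"
  unfolding smooth_on_def by (metis Ck_on.simps(2))

lemma smooth_on_has_derivative:
  "smooth_on S f \<Longrightarrow> x \<in> S \<Longrightarrow> (f has_derivative frechet_derivative f (at x)) (at x)"
  using smooth_on_differentiable frechet_derivative_works by blast

lemma smooth_on_continuous_on: "smooth_on S f \<Longrightarrow> continuous_on S f"
  unfolding smooth_on_def by (metis Ck_on.simps(1))

lemma smooth_on_frechet_derivative: "smooth_on S f \<Longrightarrow> smooth_on S (\<lambda>x. frechet_derivative f (at x) v)"
  unfolding smooth_on_def by (metis Ck_on.simps(2))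

lemma smooth_on_frechet_derivative_apply:
  fixes f :: "'a::euclidean_space \<Rightarrow> 'c::real_normed_vector"
  assumes "open U" "smooth_on U f" "open S" "smooth_on S g" "smooth_on S v" "\<And>x. x \<in> S \<Longrightarrow> g x \<in> U"
  shows "smooth_on S (\<lambda>x. frechet_derivative f (at (g x)) (v x))"
proof -
  have "smooth_on S (\<lambda>x. \<Sum>b\<in>Basis. (v x \<bullet> b) *\<^sub>R frechet_derivative f (at (g x)) b)"
    using assms by (intro smooth_intros smooth_on_compose[OF smooth_on_frechet_derivative[OF assms(2)] assms(1)])
  moreover have "frechet_derivative f (at (g x)) (v x) = (\<Sum>b\<in>Basis. (v x \<bullet> b) *\<^sub>R frechet_derivative f (at (g x)) b)"
    if "x \<in> S" for x
    using assms that by (intro linear_euclidean_expand linear_frechet_derivative smooth_on_differentiable)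
  ultimately show ?thesis by (subst smooth_on_cong[OF \<open>open S\<close>]) auto
qed

section \<open>Flat functions and smooth cutoffs\<close>

text \<open>Powers of 1/x and the flat functions below differentiate into other members of their
  family, so the order of differentiability must grow for all members at once. The last assumption
  says that the derivatives inherit whatever regularity the whole family has.\<close>

lemma smooth_on_real_deriv_family:
  fixes f :: "'i \<Rightarrow> real \<Rightarrow> real"
  assumes "open S"
    and "\<And>i x. x \<in> S \<Longrightarrow> (f i has_real_derivative f' i x) (at x)"
    and "\<And>k. (\<And>i. Ck_on k S (f i)) \<Longrightarrow> (\<And>i. Ck_on k S (f' i))"
  shows "smooth_on S (f i)"
  unfolding smooth_on_def
proof
  fix k
  show "Ck_on k S (f i)"
  proof (induction k arbitrary: i)
    case 0
    then show ?case using assms(2)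
      by (auto intro!: continuous_at_imp_continuous_on DERIV_isCont)
  next
    case (Suc k)
    have d: "(f i has_derivative (\<lambda>v. f' i x * v)) (at x)" if "x \<in> S" for x
      using assms(2)[OF that] by (simp add: has_field_derivative_def)
    have "Ck_on k S (\<lambda>x. frechet_derivative (f i) (at x) v)" for v
      by (subst Ck_on_cong[OF \<open>open S\<close>, where g="\<lambda>x. f' i x * v"])
        (auto simp: frechet_derivative_eqI[OF d] intro!: Ck_on_bilinear[OF bounded_bilinear_mult] assms(1,3) Suc)
    then show ?case using d by (auto simp: differentiable_def)
  qed
qed

lemma smooth_on_inverse_real: "smooth_on {0<..} (\<lambda>x::real. inverse x)"
proof -
  define f where "f = (\<lambda>(n::nat) (x::real). inverse x ^ n)"
  have "smooth_on {0<..} (f 1)"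
  proof (rule smooth_on_real_deriv_family[where f' = "\<lambda>n x. - (real n * f (Suc n) x)"])
    fix n and x :: real assume "x \<in> {0<..}"
    then show "(f n has_real_derivative - (real n * f (Suc n) x)) (at x)"
      unfolding f_def
      by (auto intro!: derivative_eq_intros simp: power2_eq_square power_Suc[symmetric] simp del: power_Suc)
        (cases n; simp add: field_simps)
  next
    fix k n assume "\<And>n. Ck_on k {0<..} (f n)"
    then show "Ck_on k {0<..} (\<lambda>x. - (real n * f (Suc n) x))"
      using Ck_on_bounded_linear[OF bounded_linear_mult_right[of "- real n"], of "{0<..}" k "f (Suc n)"]
      by simp
  qed simp
  then show ?thesis by (simp add: f_def)
qed

lemma smooth_on_inverse [smooth_intros]:
  fixes f :: "'a::real_normed_vector \<Rightarrow> real"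
  assumes "open S" "smooth_on S f" "\<And>x. x \<in> S \<Longrightarrow> f x > 0"
  shows "smooth_on S (\<lambda>x. inverse (f x))"
  using smooth_on_compose[OF smooth_on_inverse_real, of S f] assms by auto

text \<open>Member 0 is the classical exp(-1/x) continued by 0. The powers of 1/x are there because
  differentiation produces them: the derivative of member n is a combination of members n + 1 and n
  + 2.\<close>

definition flat_fun :: "nat \<Rightarrow> real \<Rightarrow> real"
  where "flat_fun n x = (if x > 0 then inverse x ^ n * exp (- inverse x) else 0)"

lemma flat_fun_tendsto: "((\<lambda>h. flat_fun n h) \<longlongrightarrow> 0) (at 0)"
proof -
  have "((\<lambda>x::real. x ^ n / exp x) \<longlongrightarrow> 0) at_top"
    by (rule tendsto_power_div_exp_0)
  from filterlim_compose[OF this filterlim_inverse_at_top_right]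
  have "((\<lambda>h. inverse h ^ n / exp (inverse h)) \<longlongrightarrow> 0) (at_right (0::real))" .
  then have "((\<lambda>h. flat_fun n h) \<longlongrightarrow> 0) (at_right 0)"
    by (rule Lim_transform_eventually) (auto simp: flat_fun_def eventually_at_filter exp_minus field_simps)
  moreover have "((\<lambda>h. flat_fun n h) \<longlongrightarrow> 0) (at_left 0)"
    by (rule Lim_transform_eventually[OF tendsto_const]) (auto simp: flat_fun_def eventually_at_filter)
  ultimately show ?thesis by (simp add: filterlim_split_at)
qed

lemma flat_fun_deriv:
  "(flat_fun n has_real_derivative (flat_fun (n+2) x - real n * flat_fun (n+1) x)) (at x)"
proof (cases x "0::real" rule: linorder_cases)
  case less
  have "((\<lambda>x. 0) has_real_derivative 0) (at x)" by simp
  then have "(flat_fun n has_real_derivative 0) (at x)"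
    by (rule has_field_derivative_transform_within_open[where S="{..<0}"]) (use less in \<open>auto simp: flat_fun_def\<close>)
  then show ?thesis using less by (simp add: flat_fun_def)
next
  case greater
  have "((\<lambda>x. inverse x ^ n * exp (- inverse x)) has_real_derivative
      (flat_fun (n+2) x - real n * flat_fun (n+1) x)) (at x)"
    using greater by (auto intro!: derivative_eq_intros simp: flat_fun_def)
      (cases n; simp add: field_simps power2_eq_square)
  then show ?thesis
    by (rule has_field_derivative_transform_within_open[where S="{0<..}"])
      (use greater in \<open>auto simp: flat_fun_def\<close>)
next
  case equal
  \<comment> \<open>Dividing by h turns member n into member n + 1, so the difference quotient at 0
    is covered by the limit above.\<close>
  have "((\<lambda>h. (flat_fun n (0 + h) - flat_fun n 0) / h) \<longlongrightarrow> 0) (at 0)"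
    by (rule Lim_transform_eventually[OF flat_fun_tendsto[of "Suc n"]])
      (auto simp: flat_fun_def eventually_at_filter field_simps)
  then have "(flat_fun n has_real_derivative 0) (at 0)" by (simp add: DERIV_def)
  then show ?thesis using equal by (simp add: flat_fun_def)
qed

lemma smooth_on_flat_fun: "smooth_on UNIV (flat_fun n)"
proof (rule smooth_on_real_deriv_family[where f' = "\<lambda>n x. flat_fun (n + 2) x - real n * flat_fun (n + 1) x"])
  fix k n assume *: "\<And>n. Ck_on k UNIV (flat_fun n)"
  show "Ck_on k UNIV (\<lambda>x. flat_fun (n + 2) x - real n * flat_fun (n + 1) x)"
    using Ck_on_add[OF _ * Ck_on_bounded_linear[OF bounded_linear_mult_right[of "- real n"] _ *], of "n+2" "n+1"]
    by simp
qed (use flat_fun_deriv in \<open>auto simp del: add_2_eq_Suc'\<close>)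

lemma flat_fun_pos: "x > 0 \<Longrightarrow> flat_fun n x > 0" and flat_fun_nonneg: "flat_fun n x \<ge> 0"
  by (simp_all add: flat_fun_def)

lemma flat_fun_eq_0: "x \<le> 0 \<Longrightarrow> flat_fun n x = 0"
  by (simp add: flat_fun_def)

text \<open>The quotient u / (u + w), where u is positive exactly inside radius R and w exactly
  outside radius r. As r < R the denominator never vanishes, and squared distances keep everything
  smooth at the centre.\<close>

lemma smooth_bump:
  fixes a :: "'a::euclidean_space"
  assumes "0 < r" "r < R"
  obtains \<eta> :: "'a \<Rightarrow> real" where "smooth_on UNIV \<eta>"
    "\<And>y. y \<in> ball a r \<Longrightarrow> \<eta> y = 1" "\<And>y. y \<notin> ball a R \<Longrightarrow> \<eta> y = 0"
proof -
  define s where "s = (\<lambda>y. (y - a) \<bullet> (y - a))"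
  define u where "u = (\<lambda>y. flat_fun 0 (R\<^sup>2 - s y))"
  define w where "w = (\<lambda>y. flat_fun 0 (s y - r\<^sup>2))"
  have s: "s y = (dist a y)\<^sup>2" for y
    by (metis s_def dist_commute dist_norm power2_norm_eq_inner)
  have rR: "r\<^sup>2 < R\<^sup>2" using assms by (simp add: power_strict_mono)
  have sm: "smooth_on UNIV s" unfolding s_def by (intro smooth_intros) auto
  have su: "smooth_on UNIV u" "smooth_on UNIV w"
    unfolding u_def w_def using sm
    by (auto intro!: smooth_on_compose[OF smooth_on_flat_fun] smooth_intros)
  have pos: "u y + w y > 0" for y
  proof (cases "s y < R\<^sup>2")
    case True
    then show ?thesis unfolding u_def w_def
      by (intro add_pos_nonneg flat_fun_pos flat_fun_nonneg) auto
  next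
    case False
    then show ?thesis using rR unfolding u_def w_def
      by (intro add_nonneg_pos flat_fun_pos flat_fun_nonneg) auto
  qed
  show ?thesis
  proof
    show "smooth_on UNIV (\<lambda>y. u y * inverse (u y + w y))"
      using su pos by (intro smooth_intros) auto
    fix y
    show "u y * inverse (u y + w y) = 1" if "y \<in> ball a r"
    proof -
      have "s y \<le> r\<^sup>2" using that unfolding s by (simp add: power_mono)
      then have "w y = 0" by (simp add: w_def flat_fun_eq_0)
      then show ?thesis using pos[of y] by simp
    qed
    show "u y * inverse (u y + w y) = 0" if "y \<notin> ball a R"
    proof -
      have "R\<^sup>2 \<le> s y" using that assms unfolding s by (auto intro!: power_mono)
      then show ?thesis by (simp add: u_def flat_fun_eq_0)
    qed
  qed
qed

section \<open>Integrals depending on a parameter and Hadamard's lemma\<close>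

lemma has_derivative_slice_snd:
  "(G has_derivative G') (at (s, x)) \<Longrightarrow> ((\<lambda>y. G (s, y)) has_derivative (\<lambda>h. G' (0, h))) (at x)"
  by (rule has_derivative_compose[where f="\<lambda>y. (s, y)"]) (auto intro!: derivative_eq_intros)

lemma has_derivative_slice_fst:
  "(G has_derivative G') (at (s, x)) \<Longrightarrow> ((\<lambda>s. G (s, x)) has_derivative (\<lambda>h. G' (h, 0))) (at s)"
  by (rule has_derivative_compose[where f="\<lambda>s. (s, x)"]) (auto intro!: derivative_eq_intros)

text \<open>The integrands needed later are evaluated along segments, so their natural domain W is
  an open neighbourhood of [0,1] x S rather than a product. The proof passes to a ball because
  \<open>leibniz_rule\<close> works on a convex set.\<close>

lemma has_derivative_integral_parameter:
  fixes F :: "real \<times> 'a::euclidean_space \<Rightarrow> 'b::euclidean_space"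
  assumes W: "open W" "smooth_on W F" and S: "open S" "\<And>t y. t \<in> {0..1} \<Longrightarrow> y \<in> S \<Longrightarrow> (t, y) \<in> W"
    and "y0 \<in> S"
  shows "((\<lambda>y. integral {0..1} (\<lambda>t. F (t, y))) has_derivative
    (\<lambda>v. integral {0..1} (\<lambda>t. frechet_derivative F (at (t, y0)) (0, v)))) (at y0)"
proof -
  obtain r where r: "r > 0" "ball y0 r \<subseteq> S" using S(1) \<open>y0 \<in> S\<close> openE by blast
  define fx where "fx = (\<lambda>y t. Blinfun (\<lambda>v. frechet_derivative F (at (t, y)) (0, v)))"
  have d: "(F has_derivative frechet_derivative F (at (t, y))) (at (t, y))" if "t \<in> {0..1}" "y \<in> S" for t y
    using smooth_on_has_derivative[OF W(2)] S(2) that by auto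
  have bl: "bounded_linear (\<lambda>v. frechet_derivative F (at (t, y)) (0, v))" if "t \<in> {0..1}" "y \<in> S" for t y
    using bounded_linear_compose[OF has_derivative_bounded_linear[OF d[OF that]], of "\<lambda>v. (0, v)"]
    by (simp add: bounded_linear_Pair bounded_linear_zero bounded_linear_ident)
  have fx: "blinfun_apply (fx y t) = (\<lambda>v. frechet_derivative F (at (t, y)) (0, v))"
    if "t \<in> {0..1}" "y \<in> S" for t y
    unfolding fx_def using bounded_linear_Blinfun_apply[OF bl[OF that]] .
  have contv: "continuous_on (ball y0 r \<times> {0..1}) (\<lambda>(y, t). frechet_derivative F (at (t, y)) u)" for u
    unfolding split_beta
    by (rule continuous_on_compose2[OF smooth_on_continuous_on[OF smooth_on_frechet_derivative[OF W(2)], of u],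
        of _ "\<lambda>p. (snd p, fst p)"])
      (use r(2) S(2) in \<open>auto intro!: continuous_intros\<close>)
  \<comment> \<open>\<open>leibniz_rule\<close> asks for a derivative that is continuous as a map
    into bounded linear functions; in finite dimension continuity in each direction
    suffices.\<close>
  have cont: "continuous_on (ball y0 r \<times> cbox 0 1) (\<lambda>(y, t). fx y t)"
  proof (rule continuous_on_blinfun_componentwise)
    fix i :: 'a
    have "continuous_on (ball y0 r \<times> {0..1}) (\<lambda>x. blinfun_apply (case x of (y, t) \<Rightarrow> fx y t) i)"
      by (rule continuous_on_eq[OF contv[of "(0, i)"]]) (use r(2) in \<open>auto simp: fx\<close>)
    then show "continuous_on (ball y0 r \<times> cbox 0 1) (\<lambda>x. blinfun_apply (case x of (y, t) \<Rightarrow> fx y t) i)"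
      by simp
  qed
  have "((\<lambda>y. integral (cbox 0 1) (\<lambda>t. F (t, y))) has_derivative blinfun_apply (integral (cbox 0 1) (fx y0)))
      (at y0 within ball y0 r)"
  proof (rule leibniz_rule[OF _ _ cont])
    fix y and t :: real assume y: "y \<in> ball y0 r" and t: "t \<in> cbox 0 1"
    have "((\<lambda>y. F (t, y)) has_derivative (\<lambda>v. frechet_derivative F (at (t, y)) (0, v))) (at y)"
      by (rule has_derivative_slice_snd[OF d]) (use y t r in auto)
    then show "((\<lambda>y. F (t, y)) has_derivative blinfun_apply (fx y t)) (at y within ball y0 r)"
      using fx[of t y] y t r(2) by (metis box_real(2) has_derivative_at_withinI subsetD)
  next
    fix y assume y: "y \<in> ball y0 r"
    show "(\<lambda>t. F (t, y)) integrable_on cbox 0 1"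
      by (intro integrable_continuous continuous_on_compose2[OF smooth_on_continuous_on[OF W(2)], of _ "\<lambda>t. (t, y)"])
        (use y S r in \<open>auto intro!: continuous_intros\<close>)
  qed (use r in auto)
  then have "((\<lambda>y. integral {0..1} (\<lambda>t. F (t, y))) has_derivative blinfun_apply (integral {0..1} (fx y0))) (at y0)"
    using r by (simp add: at_within_open[of y0 "ball y0 r"])
  moreover have "blinfun_apply (integral {0..1} (fx y0)) v =
      integral {0..1} (\<lambda>t. frechet_derivative F (at (t, y0)) (0, v))" for v
  proof -
    have "continuous_on {0..1} (\<lambda>t. fx y0 t)"
      by (rule continuous_on_compose2[OF cont, of _ "\<lambda>t. (y0, t)", simplified]) (use r in \<open>auto intro!: continuous_intros\<close>)
    then have "fx y0 integrable_on {0..1}" by (rule integrable_continuous_interval)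
    from integral_linear[OF this blinfun.bounded_linear_left[of v]]
    have "blinfun_apply (integral {0..1} (fx y0)) v = integral {0..1} (\<lambda>t. blinfun_apply (fx y0 t) v)"
      by (simp add: o_def)
    then show ?thesis using fx[OF _ \<open>y0 \<in> S\<close>] by (auto intro: integral_cong)
  qed
  ultimately show ?thesis by (auto intro: has_derivative_eq_rhs)
qed

lemma smooth_on_integral:
  fixes F :: "real \<times> 'a::euclidean_space \<Rightarrow> 'b::euclidean_space"
  assumes W: "open W" "smooth_on W F" and S: "open S" "\<And>t y. t \<in> {0..1} \<Longrightarrow> y \<in> S \<Longrightarrow> (t, y) \<in> W"
  shows "smooth_on S (\<lambda>y. integral {0..1} (\<lambda>t. F (t, y)))"
  unfolding smooth_on_def
proof
  fix k
  show "Ck_on k S (\<lambda>y. integral {0..1} (\<lambda>t. F (t, y)))"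
    using W(2)
  proof (induction k arbitrary: F)
    case 0
    have "isCont (\<lambda>y. integral {0..1} (\<lambda>t. F (t, y))) y" if "y \<in> S" for y
      using has_derivative_continuous[OF has_derivative_integral_parameter[OF W(1) 0 S that]] .
    then show ?case by (simp add: continuous_at_imp_continuous_on)
  next
    case (Suc k)
    have d: "((\<lambda>y. integral {0..1} (\<lambda>t. F (t, y))) has_derivative
        (\<lambda>v. integral {0..1} (\<lambda>t. frechet_derivative F (at (t, x)) (0, v)))) (at x)" if "x \<in> S" for x
      by (rule has_derivative_integral_parameter[OF W(1) Suc.prems S that])
    have "Ck_on k S (\<lambda>x. frechet_derivative (\<lambda>y. integral {0..1} (\<lambda>t. F (t, y))) (at x) v)" for v
      using Suc.IH[OF smooth_on_frechet_derivative[OF Suc.prems], of "(0, v)"]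
      by (subst Ck_on_cong[OF S(1), where g="\<lambda>x. integral {0..1} (\<lambda>t. frechet_derivative F (at (t, x)) (0, v))"])
        (auto simp: frechet_derivative_eqI[OF d])
    then show ?case using d by (auto simp: differentiable_def)
  qed
qed

lemma Hadamard_segment:
  fixes f :: "'a::euclidean_space \<Rightarrow> 'b::euclidean_space"
  assumes "open U" "smooth_on U f" and seg: "\<And>t. t \<in> {0..1} \<Longrightarrow> x + t *\<^sub>R u \<in> U"
  shows "f (x + u) - f x = integral {0..1} (\<lambda>t. frechet_derivative f (at (x + t *\<^sub>R u)) u)"
proof -
  have "((\<lambda>t. frechet_derivative f (at (x + t *\<^sub>R u)) u) has_integral f (x + 1 *\<^sub>R u) - f (x + 0 *\<^sub>R u)) {0..1}"
  proof (rule fundamental_theorem_of_calculus)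
    fix t :: real assume "t \<in> {0..1}"
    then have d: "(f has_derivative frechet_derivative f (at (x + t *\<^sub>R u))) (at (x + t *\<^sub>R u))"
      using smooth_on_has_derivative[OF assms(2)] seg by blast
    have "((\<lambda>t. x + t *\<^sub>R u) has_derivative (\<lambda>s. s *\<^sub>R u)) (at t)"
      by (auto intro!: derivative_eq_intros)
    from has_derivative_compose[OF this d]
    have "((\<lambda>t. f (x + t *\<^sub>R u)) has_derivative (\<lambda>s. s *\<^sub>R frechet_derivative f (at (x + t *\<^sub>R u)) u)) (at t)"
      using linear_cmul[OF has_derivative_linear[OF d]] by simp
    then show "((\<lambda>t. f (x + t *\<^sub>R u)) has_vector_derivative frechet_derivative f (at (x + t *\<^sub>R u)) u) (at t within {0..1})"
      by (simp add: has_vector_derivative_def has_derivative_at_withinI)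
  qed simp
  then show ?thesis by (simp add: integral_unique)
qed

text \<open>Hadamard's lemma: the increment is split into coordinate factors, which vanish at u = 0,
  and remainders given by integrals that \<open>smooth_on_integral\<close> can treat. When the
  factors are constants, linear operators pass on to the remainders; when they are coordinate
  functions, commutators appear.\<close>

lemma Hadamard_segment_Basis:
  fixes f :: "'a::euclidean_space \<Rightarrow> 'b::euclidean_space"
  assumes "open U" "smooth_on U f" and seg: "\<And>t. t \<in> {0..1} \<Longrightarrow> x + t *\<^sub>R u \<in> U"
  shows "f (x + u) - f x =
    (\<Sum>b\<in>Basis. (u \<bullet> b) *\<^sub>R integral {0..1} (\<lambda>t. frechet_derivative f (at (x + t *\<^sub>R u)) b))"
proof -
  have int: "(\<lambda>t. frechet_derivative f (at (x + t *\<^sub>R u)) b) integrable_on {0..1}" for b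
    by (intro integrable_continuous_interval continuous_on_compose2[OF smooth_on_continuous_on[OF
            smooth_on_frechet_derivative[OF assms(2)]], of _ "\<lambda>t. x + t *\<^sub>R u"])
      (use seg in \<open>auto intro!: continuous_intros\<close>)
  have "integral {0..1} (\<lambda>t. frechet_derivative f (at (x + t *\<^sub>R u)) u) =
    integral {0..1} (\<lambda>t. \<Sum>b\<in>Basis. (u \<bullet> b) *\<^sub>R frechet_derivative f (at (x + t *\<^sub>R u)) b)"
    using seg by (intro integral_cong linear_euclidean_expand linear_frechet_derivative
        smooth_on_differentiable[OF assms(2)])
  also have "\<dots> = (\<Sum>b\<in>Basis. (u \<bullet> b) *\<^sub>R integral {0..1} (\<lambda>t. frechet_derivative f (at (x + t *\<^sub>R u)) b))"
    using int by (subst integral_sum) (auto simp: integral_cmul intro: integrable_cmul)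
  finally show ?thesis using Hadamard_segment[OF assms] by simp
qed

text \<open>Write f(y + s v) - f(y) = s G(s, y) with G smooth and G(0, y) = D_v f(y).
  Differentiating in y along w gives D_w f(x + s v) - D_w f(x) = s D_w G(s, x), and the derivative
  of this at s = 0 is D_w G(0, x) = D_w D_v f(x).\<close>

lemma symmetric_second_frechet_derivative:
  fixes f :: "'a::euclidean_space \<Rightarrow> 'b::euclidean_space"
  assumes U: "open U" "smooth_on U f" and "x \<in> U"
  shows "frechet_derivative (\<lambda>y. frechet_derivative f (at y) v) (at x) w =
    frechet_derivative (\<lambda>y. frechet_derivative f (at y) w) (at x) v"
proof -
  obtain r where r: "r > 0" "ball x r \<subseteq> U" using U(1) \<open>x \<in> U\<close> openE by blast
  \<comment> \<open>Half the radius for the base point and half for the displacement, so that all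
    segments stay in U.\<close>
  define S where "S = {s. \<bar>s\<bar> * norm v < r / 2} \<times> ball x (r / 2)"
  define F where "F = (\<lambda>p. frechet_derivative f (at (snd (snd p) + (fst p * fst (snd p)) *\<^sub>R v)) v)"
  define G where "G = (\<lambda>p. integral {0..1} (\<lambda>t. F (t, p)))"
  define W where "W = (\<lambda>p. snd (snd p) + (fst p * fst (snd p)) *\<^sub>R v) -` U"
  have "open {s. \<bar>s\<bar> * norm v < r / 2}"
    by (intro open_Collect_less continuous_intros)
  then have S: "open S" unfolding S_def by (intro open_Times) auto
  have segU: "y + (t * s) *\<^sub>R v \<in> U" if "(s, y) \<in> S" "t \<in> {0..1}" for s t y
  proof -
    have "\<bar>t * s\<bar> * norm v \<le> \<bar>s\<bar> * norm v"
      using that(2) by (intro mult_right_mono) (auto simp: abs_mult mult_left_le_one_le)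
    then have "norm ((t * s) *\<^sub>R v) < r / 2" using that(1) by (auto simp: S_def)
    moreover have "dist x y < r / 2" using that(1) by (auto simp: S_def)
    moreover have "dist x (y + (t * s) *\<^sub>R v) \<le> dist x y + norm ((t * s) *\<^sub>R v)"
      using dist_triangle[of x "y + (t * s) *\<^sub>R v" y] by (simp add: dist_norm)
    ultimately show ?thesis using r(2) by auto
  qed
  have W: "open W" unfolding W_def by (intro open_vimage U continuous_intros)
  have F: "smooth_on W F" unfolding F_def using W
    by (intro smooth_on_compose[OF smooth_on_frechet_derivative[OF U(2)] U(1)] smooth_intros) (auto simp: W_def)
  have G: "smooth_on S G" unfolding G_def
    by (rule smooth_on_integral[OF W F S]) (use segU in \<open>auto simp: W_def\<close>)
  have G0: "G (0, y) = frechet_derivative f (at y) v" for y by (simp add: G_def F_def)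
  have inS: "(s, x) \<in> S" if "\<bar>s\<bar> * norm v < r / 2" for s using that r by (simp add: S_def)
  have fG: "f (y + s *\<^sub>R v) - f y = s *\<^sub>R G (s, y)" if sy: "(s, y) \<in> S" for s y
  proof -
    have "f (y + s *\<^sub>R v) - f y = integral {0..1} (\<lambda>t. frechet_derivative f (at (y + t *\<^sub>R s *\<^sub>R v)) (s *\<^sub>R v))"
      by (rule Hadamard_segment[OF U]) (use segU[OF sy] in simp)
    also have "\<dots> = integral {0..1} (\<lambda>t. s *\<^sub>R F (t, s, y))"
      using segU[OF sy] by (intro integral_cong)
        (simp add: F_def linear_cmul[OF linear_frechet_derivative[OF smooth_on_differentiable[OF U(2)]]])
    also have "\<dots> = s *\<^sub>R G (s, y)" by (simp add: G_def)
    finally show ?thesis .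
  qed
  have dfG: "frechet_derivative f (at (x + s *\<^sub>R v)) w - frechet_derivative f (at x) w =
      s *\<^sub>R frechet_derivative G (at (s, x)) (0, w)" if s: "\<bar>s\<bar> * norm v < r / 2" for s
  proof -
    have "x + s *\<^sub>R v \<in> U" using segU[OF inS[OF s], of 1] by simp
    then have d1: "(f has_derivative frechet_derivative f (at (x + s *\<^sub>R v))) (at (x + s *\<^sub>R v))"
      using smooth_on_has_derivative[OF U(2)] by simp
    have "((\<lambda>y. y + s *\<^sub>R v) has_derivative (\<lambda>h. h)) (at x)" by (auto intro!: derivative_eq_intros)
    from has_derivative_compose[OF this d1]
    have L: "((\<lambda>y. f (y + s *\<^sub>R v) - f y) has_derivative
        (\<lambda>h. frechet_derivative f (at (x + s *\<^sub>R v)) h - frechet_derivative f (at x) h)) (at x)"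
      by (intro has_derivative_diff smooth_on_has_derivative[OF U(2)] \<open>x \<in> U\<close>)
    have "((\<lambda>y. G (s, y)) has_derivative (\<lambda>h. frechet_derivative G (at (s, x)) (0, h))) (at x)"
      by (rule has_derivative_slice_snd[OF smooth_on_has_derivative[OF G inS[OF s]]])
    then have "((\<lambda>y. s *\<^sub>R G (s, y)) has_derivative (\<lambda>h. s *\<^sub>R frechet_derivative G (at (s, x)) (0, h))) (at x)"
      by (rule has_derivative_scaleR_right)
    then have "((\<lambda>y. f (y + s *\<^sub>R v) - f y) has_derivative
        (\<lambda>h. s *\<^sub>R frechet_derivative G (at (s, x)) (0, h))) (at x)"
    proof (rule has_derivative_transform_within_open[where s="ball x (r / 2)"])
      show "s *\<^sub>R G (s, y) = f (y + s *\<^sub>R v) - f y" if "y \<in> ball x (r / 2)" for y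
        using fG[of s y] s that by (simp add: S_def)
    qed (use r in auto)
    from fun_cong[OF has_derivative_unique[OF L this], of w] show ?thesis .
  qed
  define H where "H = (\<lambda>s. frechet_derivative G (at (s, x)) (0, w))"
  have "(0, x) \<in> S" using r by (auto simp: S_def)
  have dH: "(H has_derivative (\<lambda>s. frechet_derivative (\<lambda>p. frechet_derivative G (at p) (0, w)) (at (0, x)) (s, 0))) (at 0)"
    unfolding H_def
    by (rule has_derivative_slice_fst[OF smooth_on_has_derivative[OF smooth_on_frechet_derivative[OF G] \<open>(0, x) \<in> S\<close>]])
  \<comment> \<open>Product rule at 0: the factor s removes the term with the derivative of
    H.\<close>
  have "((\<lambda>s. s *\<^sub>R H s) has_derivative (\<lambda>s. s *\<^sub>R H 0)) (at 0)"
    using has_derivative_scaleR[OF has_derivative_ident dH] by simp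
  then have R: "((\<lambda>s. frechet_derivative f (at (x + s *\<^sub>R v)) w - frechet_derivative f (at x) w) has_derivative
      (\<lambda>s. s *\<^sub>R H 0)) (at 0)"
  proof (rule has_derivative_transform_within_open[where s="{s. \<bar>s\<bar> * norm v < r / 2}"])
    show "s *\<^sub>R H s = frechet_derivative f (at (x + s *\<^sub>R v)) w - frechet_derivative f (at x) w"
      if "s \<in> {s. \<bar>s\<bar> * norm v < r / 2}" for s
      using dfG[of s] that by (simp add: H_def)
  qed (use r \<open>open {s. \<bar>s\<bar> * norm v < r / 2}\<close> in auto)
  define g where "g = (\<lambda>y. frechet_derivative f (at y) w)"
  have g: "(g has_derivative frechet_derivative g (at x)) (at (x + 0 *\<^sub>R v))"
    unfolding g_def
    using smooth_on_has_derivative[OF smooth_on_frechet_derivative[OF U(2)] \<open>x \<in> U\<close>] by simp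
  have "((\<lambda>s. x + s *\<^sub>R v) has_derivative (\<lambda>s. s *\<^sub>R v)) (at 0)"
    by (auto intro!: derivative_eq_intros)
  from has_derivative_diff[OF has_derivative_compose[OF this g] has_derivative_const]
  have "((\<lambda>s. g (x + s *\<^sub>R v) - g x) has_derivative (\<lambda>s. frechet_derivative g (at x) (s *\<^sub>R v) - 0)) (at 0)" .
  from fun_cong[OF has_derivative_unique[OF this R[folded fun_cong[OF g_def]]], of 1]
  have "frechet_derivative (\<lambda>y. frechet_derivative f (at y) w) (at x) v = H 0"
    by (simp add: g_def)
  also have "H 0 = frechet_derivative (\<lambda>y. frechet_derivative f (at y) v) (at x) w"
  proof -
    have "((\<lambda>y. G (0, y)) has_derivative (\<lambda>h. frechet_derivative G (at (0, x)) (0, h))) (at x)"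
      by (rule has_derivative_slice_snd[OF smooth_on_has_derivative[OF G \<open>(0, x) \<in> S\<close>]])
    then show ?thesis by (simp add: G0 H_def frechet_derivative_eqI)
  qed
  finally show ?thesis by simp
qed

section \<open>Charts, derivatives and vector fields\<close>

text \<open>Product rule for a derivative applied to a moving vector. With a transition map for f,
  it shows how the components of a vector field differentiate under a change of chart.\<close>

lemma has_derivative_frechet_apply:
  fixes f :: "'a::euclidean_space \<Rightarrow> 'b::real_normed_vector"
  assumes "open U" "smooth_on U f" "x \<in> U" and g: "(g has_derivative g') (at x)"
  shows "((\<lambda>z. frechet_derivative f (at z) (g z)) has_derivative
    (\<lambda>u. frechet_derivative f (at x) (g' u) +
      frechet_derivative (\<lambda>z. frechet_derivative f (at z) (g x)) (at x) u)) (at x)"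
proof -
  let ?D = "\<lambda>z. frechet_derivative f (at z)" and ?S = "\<lambda>w u. frechet_derivative (\<lambda>z. frechet_derivative f (at z) w) (at x) u"
  have lin: "linear (?D z)" if "z \<in> U" for z
    using smooth_on_differentiable[OF assms(2) that] by (rule linear_frechet_derivative)
  have d: "((\<lambda>z. ?D z b) has_derivative ?S b) (at x)" for b
    by (rule smooth_on_has_derivative[OF smooth_on_frechet_derivative[OF assms(2)] assms(3)])
  have exp: "?D z w = (\<Sum>b\<in>Basis. (w \<bullet> b) *\<^sub>R ?D z b)" if "z \<in> U" for z w
    by (rule linear_euclidean_expand[OF lin[OF that]])
  have "((\<lambda>z. \<Sum>b\<in>Basis. (g x \<bullet> b) *\<^sub>R ?D z b) has_derivative (\<lambda>u. \<Sum>b\<in>Basis. (g x \<bullet> b) *\<^sub>R ?S b u)) (at x)"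
    by (intro has_derivative_sum has_derivative_scaleR_right d)
  then have "((\<lambda>z. ?D z (g x)) has_derivative (\<lambda>u. \<Sum>b\<in>Basis. (g x \<bullet> b) *\<^sub>R ?S b u)) (at x)"
    by (rule has_derivative_transform_within_open[OF _ assms(1,3)]) (simp only: exp[symmetric])
  then have S: "?S (g x) u = (\<Sum>b\<in>Basis. (g x \<bullet> b) *\<^sub>R ?S b u)" for u
    using fun_cong[OF frechet_derivative_eqI] by blast
  have "((\<lambda>z. \<Sum>b\<in>Basis. (g z \<bullet> b) *\<^sub>R ?D z b) has_derivative
      (\<lambda>u. \<Sum>b\<in>Basis. (g x \<bullet> b) *\<^sub>R ?S b u + (g' u \<bullet> b) *\<^sub>R ?D x b)) (at x)"
    by (intro has_derivative_sum has_derivative_scaleR d has_derivative_inner_left g)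
  then have "((\<lambda>z. ?D z (g z)) has_derivative
      (\<lambda>u. \<Sum>b\<in>Basis. (g x \<bullet> b) *\<^sub>R ?S b u + (g' u \<bullet> b) *\<^sub>R ?D x b)) (at x)"
    by (rule has_derivative_transform_within_open[OF _ assms(1,3)]) (simp only: exp[symmetric])
  then show ?thesis
    by (rule has_derivative_eq_rhs) (simp add: sum.distrib S[symmetric] exp[OF assms(3), symmetric] add.commute)
qed

lemma clopen_connected_component:
  assumes "open S" "open (- S)" "p \<in> S" "connected_component UNIV p q"
  shows "q \<in> S"
proof -
  obtain T where T: "connected T" "p \<in> T" "q \<in> T"
    using assms(4) unfolding connected_component_def by blast
  show ?thesis using connectedD[OF T(1) assms(1,2)] T assms(3) by blast
qed

section \<open>Smooth functions on a manifold\<close>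

locale smooth_mfd =
  fixes A :: "('p::{second_countable_topology, t2_space}, 'e::euclidean_space) chart set"
  assumes mfd: "smooth_manifold A"
begin

lemma open_dom: "c \<in> A \<Longrightarrow> open (fst c)"
  and open_img: "c \<in> A \<Longrightarrow> open (snd c ` fst c)"
  and homeo: "c \<in> A \<Longrightarrow> homeomorphism (fst c) (snd c ` fst c) (snd c) (chart_inv c)"
  and smooth_transition: "c \<in> A \<Longrightarrow> d \<in> A \<Longrightarrow> smooth_on (snd c ` (fst c \<inter> fst d)) (snd d \<circ> chart_inv c)"
  and cover: "\<exists>c\<in>A. p \<in> fst c"
  using mfd unfolding smooth_manifold_def by auto

lemma inv_chart [simp]: "c \<in> A \<Longrightarrow> p \<in> fst c \<Longrightarrow> chart_inv c (snd c p) = p"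
  using homeo by (auto simp: homeomorphism_def)

lemma chart_inv_mem [simp]: "c \<in> A \<Longrightarrow> y \<in> snd c ` fst c \<Longrightarrow> chart_inv c y \<in> fst c"
  by auto

lemma chart_inv_right [simp]: "c \<in> A \<Longrightarrow> y \<in> snd c ` fst c \<Longrightarrow> snd c (chart_inv c y) = y"
  by auto

lemma image_chart_eq: "c \<in> A \<Longrightarrow> snd c ` (fst c \<inter> U) = {y \<in> snd c ` fst c. chart_inv c y \<in> U}"
  by auto

lemma continuous_chart: "c \<in> A \<Longrightarrow> continuous_on (fst c) (snd c)"
  and continuous_chart_inv: "c \<in> A \<Longrightarrow> continuous_on (snd c ` fst c) (chart_inv c)"
  using homeo by (auto simp: homeomorphism_def)

lemma open_image_chart: "c \<in> A \<Longrightarrow> open U \<Longrightarrow> open (snd c ` (fst c \<inter> U))"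
  unfolding image_chart_eq
  using continuous_open_preimage[OF continuous_chart_inv open_img, of c U]
  by (simp add: vimage_def Int_def)

lemma open_image_chart_subset: "c \<in> A \<Longrightarrow> open U \<Longrightarrow> U \<subseteq> fst c \<Longrightarrow> open (snd c ` U)"
  using open_image_chart[of c U] by (simp add: inf.absorb2)

lemma open_chart_preimage: "c \<in> A \<Longrightarrow> open Z \<Longrightarrow> open {p \<in> fst c. snd c p \<in> Z}"
  using continuous_open_preimage[OF continuous_chart open_dom, of c Z]
  by (simp add: vimage_def Int_def)

lemma closed_chart_compact:
  assumes "c \<in> A" "compact K" "K \<subseteq> snd c ` fst c"
  shows "closed (chart_inv c ` K)"
  by (intro compact_imp_closed compact_continuous_image[OF continuous_on_subset[OF continuous_chart_inv]] assms)

lemma smooth_fun_subset: "smooth_fun A U f \<Longrightarrow> open V \<Longrightarrow> V \<subseteq> U \<Longrightarrow> smooth_fun A V f"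
  unfolding smooth_fun_def by (blast intro: smooth_on_subset)

lemma smooth_fun_cong:
  assumes "\<And>p. p \<in> U \<Longrightarrow> f p = g p"
  shows "smooth_fun A U f \<longleftrightarrow> smooth_fun A U g"
proof (cases "open U")
  case True
  then have "smooth_on (snd c ` (fst c \<inter> U)) (f \<circ> chart_inv c) \<longleftrightarrow> smooth_on (snd c ` (fst c \<inter> U)) (g \<circ> chart_inv c)"
    if "c \<in> A" for c
    by (intro smooth_on_cong open_image_chart that) (use assms that in auto)
  then show ?thesis by (simp add: smooth_fun_def)
qed (simp add: smooth_fun_def)

lemma smooth_fun_local:
  assumes "\<And>p. p \<in> U \<Longrightarrow> \<exists>V. p \<in> V \<and> smooth_fun A V f" and "open U"
  shows "smooth_fun A U f"
  unfolding smooth_fun_def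
proof (intro conjI ballI assms(2))
  fix c assume c: "c \<in> A"
  show "smooth_on (snd c ` (fst c \<inter> U)) (f \<circ> chart_inv c)"
  proof (rule smooth_on_local)
    fix y assume "y \<in> snd c ` (fst c \<inter> U)"
    then obtain p where p: "y = snd c p" "p \<in> fst c" "p \<in> U" by blast
    from assms(1)[OF p(3)] obtain V where "p \<in> V" "smooth_fun A V f" by blast
    then show "\<exists>W. open W \<and> y \<in> W \<and> smooth_on W (f \<circ> chart_inv c)"
      using c p by (intro exI[of _ "snd c ` (fst c \<inter> V)"]) (auto simp: smooth_fun_def open_image_chart)
  qed
qed

lemma smooth_fun_chart:
  assumes c: "c \<in> A" and V: "open V" "V \<subseteq> fst c" and f: "smooth_on (snd c ` V) (f \<circ> chart_inv c)"
  shows "smooth_fun A V f"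
  unfolding smooth_fun_def
proof (intro conjI ballI V)
  fix d assume d: "d \<in> A"
  have "smooth_on (snd d ` (fst d \<inter> V)) (\<lambda>y. (f \<circ> chart_inv c) ((snd c \<circ> chart_inv d) y))"
    by (rule smooth_on_compose[OF f open_image_chart_subset[OF c V] open_image_chart[OF d V(1)]
          smooth_on_subset[OF smooth_transition[OF d c]]])
      (use V d in auto)
  then show "smooth_on (snd d ` (fst d \<inter> V)) (f \<circ> chart_inv d)"
    by (subst smooth_on_cong[OF open_image_chart[OF d V(1)]])
      (use c d V in \<open>auto simp: subset_iff\<close>)
qed

lemma smooth_fun_chart_coord: "c \<in> A \<Longrightarrow> smooth_fun A (fst c) (snd c)"
  using smooth_transition open_dom by (auto simp: smooth_fun_def Int_commute)

lemma smooth_fun_const [simp]: "open U \<Longrightarrow> smooth_fun A U (\<lambda>p. a)"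
  by (simp add: smooth_fun_def o_def)

lemma smooth_fun_bounded_linear: "bounded_linear L \<Longrightarrow> smooth_fun A U f \<Longrightarrow> smooth_fun A U (\<lambda>p. L (f p))"
  unfolding smooth_fun_def o_def by (intro conjI ballI smooth_on_bounded_linear[of L] open_image_chart; blast)

lemma smooth_fun_add: "smooth_fun A U f \<Longrightarrow> smooth_fun A U g \<Longrightarrow> smooth_fun A U (\<lambda>p. f p + g p)"
  unfolding smooth_fun_def o_def by (intro conjI ballI smooth_on_add open_image_chart; blast)

lemma smooth_fun_diff: "smooth_fun A U f \<Longrightarrow> smooth_fun A U g \<Longrightarrow> smooth_fun A U (\<lambda>p. f p - g p)"
  unfolding smooth_fun_def o_def by (intro conjI ballI smooth_on_diff open_image_chart; blast)

lemma smooth_fun_mult: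
  fixes f g :: "'p \<Rightarrow> 'b::real_normed_algebra"
  shows "smooth_fun A U f \<Longrightarrow> smooth_fun A U g \<Longrightarrow> smooth_fun A U (\<lambda>p. f p * g p)"
  unfolding smooth_fun_def o_def by (intro conjI ballI smooth_on_mult open_image_chart; blast)

text \<open>The set where f may be nonzero corresponds to a compact subset of a Hausdorff space,
  hence to a closed one. Its complement is a neighbourhood of every point outside the chart, and the
  extension is 0 on it.\<close>

lemma smooth_fun_extend:
  fixes f :: "'e \<Rightarrow> 'b::real_normed_vector"
  assumes c: "c \<in> A" and K: "compact K" "K \<subseteq> snd c ` fst c"
    and f: "smooth_on (snd c ` fst c) f" "\<And>y. y \<notin> K \<Longrightarrow> f y = 0"
  shows "smooth_fun A UNIV (\<lambda>p. if p \<in> fst c then f (snd c p) else 0)" (is "smooth_fun A UNIV ?g")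
proof (rule smooth_fun_local)
  fix p
  show "\<exists>V. p \<in> V \<and> smooth_fun A V ?g"
  proof (cases "p \<in> fst c")
    case True
    have "smooth_fun A (fst c) ?g"
      by (rule smooth_fun_chart[OF c open_dom[OF c] order_refl])
        (subst smooth_on_cong[OF open_img[OF c], of _ f], use c f in auto)
    then show ?thesis using True by blast
  next
    case False
    then have "p \<in> - chart_inv c ` K" using K c by auto
    moreover have "smooth_fun A (- chart_inv c ` K) ?g"
    proof (subst smooth_fun_cong)
      show "?g q = 0" if "q \<in> - chart_inv c ` K" for q
        using that f(2)[of "snd c q"] c by (force simp: image_iff)
      show "smooth_fun A (- chart_inv c ` K) (\<lambda>p. 0 :: 'b)"
        using closed_chart_compact[OF c K] by (intro smooth_fun_const) (simp only: open_Compl)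
    qed
    ultimately show ?thesis by blast
  qed
qed simp

section \<open>Differentials in arbitrary charts\<close>

lemma chart_at: "chart_at A p \<in> A" "p \<in> fst (chart_at A p)"
  using someI_ex[of "\<lambda>c. c \<in> A \<and> p \<in> fst c"] cover[of p] unfolding chart_at_def Bex_def by blast+

lemma transition_has_derivative:
  assumes "c \<in> A" "d \<in> A" "p \<in> fst c" "p \<in> fst d"
  shows "(snd d \<circ> chart_inv c has_derivative frechet_derivative (snd d \<circ> chart_inv c) (at (snd c p))) (at (snd c p))"
  using smooth_on_has_derivative[OF smooth_transition[OF assms(1,2)]] assms by blast

lemma has_derivative_change_chart:
  assumes c: "c \<in> A" "p \<in> fst c" and d: "d \<in> A" "p \<in> fst d"
    and f: "(f \<circ> chart_inv c has_derivative D) (at (snd c p))"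
  shows "(f \<circ> chart_inv d has_derivative (\<lambda>v. D (frechet_derivative (snd c \<circ> chart_inv d) (at (snd d p)) v))) (at (snd d p))"
proof -
  have "(f \<circ> chart_inv c has_derivative D) (at ((snd c \<circ> chart_inv d) (snd d p)))"
    using f c d by simp
  from has_derivative_compose[OF transition_has_derivative[OF d(1) c(1) d(2) c(2)] this]
  show ?thesis
    by (rule has_derivative_transform_within_open[OF _ open_image_chart[OF d(1) open_dom[OF c(1)]]])
      (use c d in auto)
qed

text \<open>\<open>mderiv\<close> is computed in the preferred chart, which jumps with p. Any other
  chart around p may be used if the tangent vector is converted to it by
  \<open>mderiv A (snd c) p\<close>, the differential of the transition map.\<close>

lemma mderiv_chart:
  assumes "c \<in> A" "p \<in> fst c" "(f \<circ> chart_inv c has_derivative D) (at (snd c p))"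
  shows "mderiv A f p v = D (mderiv A (snd c) p v)"
  using frechet_derivative_eqI[OF has_derivative_change_chart[OF assms(1,2) chart_at assms(3)]]
  by (simp add: mderiv_def)

lemma transition_derivative_compose:
  assumes "c \<in> A" "d \<in> A" "e \<in> A" "p \<in> fst c" "p \<in> fst d" "p \<in> fst e"
  shows "frechet_derivative (snd e \<circ> chart_inv d) (at (snd d p)) (frechet_derivative (snd d \<circ> chart_inv c) (at (snd c p)) w)
    = frechet_derivative (snd e \<circ> chart_inv c) (at (snd c p)) w"
  using frechet_derivative_eqI[OF has_derivative_change_chart[OF assms(2,5,1,4) transition_has_derivative[OF assms(2,3,5,6)]]]
  by simp

lemma transition_derivative_self:
  assumes "c \<in> A" "p \<in> fst c"
  shows "frechet_derivative (snd c \<circ> chart_inv c) (at (snd c p)) w = w"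
proof -
  have "((\<lambda>y. y) has_derivative (\<lambda>w. w)) (at (snd c p))" by simp
  then have "(snd c \<circ> chart_inv c has_derivative (\<lambda>w. w)) (at (snd c p))"
    by (rule has_derivative_transform_within_open[OF _ open_img[OF assms(1)]]) (use assms in auto)
  then show ?thesis by (simp add: frechet_derivative_eqI)
qed

lemma mderiv_coord_vec_chart:
  assumes "c \<in> A" "d \<in> A" "p \<in> fst c" "p \<in> fst d"
  shows "mderiv A (snd d) p (coord_vec A c p w) = frechet_derivative (snd d \<circ> chart_inv c) (at (snd c p)) w"
  unfolding mderiv_def coord_vec_def
  using transition_derivative_compose[OF assms(1) chart_at(1) assms(2,3) chart_at(2) assms(4)] by simp

lemma mderiv_coord_vec_self [simp]:
  "c \<in> A \<Longrightarrow> p \<in> fst c \<Longrightarrow> mderiv A (snd c) p (coord_vec A c p w) = w"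
  by (simp add: mderiv_coord_vec_chart transition_derivative_self)

lemma coord_vec_mderiv [simp]:
  assumes "c \<in> A" "p \<in> fst c"
  shows "coord_vec A c p (mderiv A (snd c) p v) = v"
  unfolding mderiv_def coord_vec_def
  using transition_derivative_compose[OF chart_at(1) assms(1) chart_at(1,2) assms(2) chart_at(2)]
  by (simp add: transition_derivative_self chart_at)

lemma mderiv_coord_vec:
  assumes "c \<in> A" "p \<in> fst c" "(f \<circ> chart_inv c) differentiable (at (snd c p))"
  shows "mderiv A f p (coord_vec A c p w) = frechet_derivative (f \<circ> chart_inv c) (at (snd c p)) w"
  using mderiv_chart[OF assms(1,2) frechet_derivative_works[THEN iffD1, OF assms(3)]] assms by simp

lemma linear_coord_vec: "c \<in> A \<Longrightarrow> p \<in> fst c \<Longrightarrow> linear (coord_vec A c p)"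
  using has_derivative_linear[OF transition_has_derivative[OF _ chart_at(1) _ chart_at(2)]]
  unfolding coord_vec_def by blast

lemma smooth_fun_differentiable:
  "smooth_fun A U f \<Longrightarrow> p \<in> U \<Longrightarrow> c \<in> A \<Longrightarrow> p \<in> fst c \<Longrightarrow> (f \<circ> chart_inv c) differentiable (at (snd c p))"
  by (force simp: smooth_fun_def intro: smooth_on_differentiable)

lemma linear_mderiv: "smooth_fun A U f \<Longrightarrow> p \<in> U \<Longrightarrow> linear (mderiv A f p)"
  unfolding mderiv_def
  by (intro linear_frechet_derivative smooth_fun_differentiable chart_at)

lemma mderiv_cong_open:
  assumes "open U" "p \<in> U" "\<And>q. q \<in> U \<Longrightarrow> f q = g q"
  shows "mderiv A f p v = mderiv A g p v"
  unfolding mderiv_def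
  by (subst frechet_derivative_cong_open[OF open_image_chart[OF chart_at(1) assms(1)], where g="g \<circ> chart_inv (chart_at A p)"])
    (use assms chart_at[of p] in auto)

lemma mderiv_has_derivative:
  assumes "smooth_fun A U f" "p \<in> U"
  shows "(f \<circ> chart_inv (chart_at A p) has_derivative mderiv A f p) (at (snd (chart_at A p) p))"
  using smooth_fun_differentiable[OF assms chart_at] unfolding mderiv_def
  by (simp add: frechet_derivative_works)

lemma mderivI:
  "(f \<circ> chart_inv (chart_at A p) has_derivative D) (at (snd (chart_at A p) p)) \<Longrightarrow> mderiv A f p v = D v"
  unfolding mderiv_def by (simp add: frechet_derivative_eqI)

lemma mderiv_const [simp]: "mderiv A (\<lambda>q. a) p v = 0"
  by (rule mderivI) (simp add: o_def)

lemma mderiv_bounded_linear: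
  assumes "bounded_linear L" "smooth_fun A U f" "p \<in> U"
  shows "mderiv A (\<lambda>q. L (f q)) p v = L (mderiv A f p v)"
  using bounded_linear.has_derivative[OF assms(1) mderiv_has_derivative[OF assms(2,3)]]
  by (intro mderivI) (simp add: o_def)

lemma mderiv_add:
  assumes "smooth_fun A U f" "smooth_fun A U g" "p \<in> U"
  shows "mderiv A (\<lambda>q. f q + g q) p v = mderiv A f p v + mderiv A g p v"
  using has_derivative_add[OF mderiv_has_derivative[OF assms(1,3)] mderiv_has_derivative[OF assms(2,3)]]
  by (intro mderivI) (simp add: o_def)

lemma mderiv_diff:
  assumes "smooth_fun A U f" "smooth_fun A U g" "p \<in> U"
  shows "mderiv A (\<lambda>q. f q - g q) p v = mderiv A f p v - mderiv A g p v"
  using has_derivative_diff[OF mderiv_has_derivative[OF assms(1,3)] mderiv_has_derivative[OF assms(2,3)]]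
  by (intro mderivI) (simp add: o_def)

lemma mderiv_sum:
  assumes "\<And>i. i \<in> I \<Longrightarrow> smooth_fun A U (f i)" "p \<in> U"
  shows "mderiv A (\<lambda>q. \<Sum>i\<in>I. f i q) p v = (\<Sum>i\<in>I. mderiv A (f i) p v)"
  using has_derivative_sum[of I "\<lambda>i. f i \<circ> chart_inv (chart_at A p)", OF mderiv_has_derivative[OF assms(1) assms(2)]]
  by (intro mderivI) (simp add: o_def)

section \<open>Functions with zero differential and base points of components\<close>

lemma mderiv_zero_locally_const:
  fixes f :: "'p \<Rightarrow> 'b::real_normed_vector"
  assumes f: "smooth_fun A UNIV f" and 0: "\<And>q v. mderiv A f q v = 0"
  shows "\<exists>U. open U \<and> p \<in> U \<and> (\<forall>q\<in>U. f q = f p)"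
proof -
  obtain c where c: "c \<in> A" "p \<in> fst c" using cover by blast
  obtain r where r: "r > 0" "ball (snd c p) r \<subseteq> snd c ` fst c"
    using open_img[OF c(1)] c openE by blast
  let ?f = "f \<circ> chart_inv c"
  have "(?f has_derivative (\<lambda>v. 0)) (at z within ball (snd c p) r)" if "z \<in> ball (snd c p) r" for z
  proof -
    have "z \<in> snd c ` fst c" using r(2) \<open>z \<in> ball (snd c p) r\<close> by blast
    then obtain q where q: "q \<in> fst c" "z = snd c q" by blast
    have "frechet_derivative ?f (at z) v = 0" for v
      using mderiv_coord_vec[OF c(1) q(1) smooth_fun_differentiable[OF f _ c(1) q(1)]] 0 q by simp
    then have "frechet_derivative ?f (at z) = (\<lambda>v. 0)" by auto
    then show ?thesis
      using smooth_fun_differentiable[OF f _ c(1) q(1)] q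
      by (metis UNIV_I frechet_derivative_works has_derivative_at_withinI)
  qed
  then obtain k where k: "\<And>z. z \<in> ball (snd c p) r \<Longrightarrow> ?f z = k"
    using has_derivative_zero_constant[OF convex_ball, of "snd c p" r ?f] by blast
  define U where "U = {q \<in> fst c. snd c q \<in> ball (snd c p) r}"
  have "f q = k" if "q \<in> U" for q
    using k[of "snd c q"] that c by (simp add: U_def)
  moreover have "open U" "p \<in> U"
    using c r by (auto simp: U_def open_chart_preimage simp del: mem_ball)
  ultimately show ?thesis by blast
qed

text \<open>One point per component: connected points have the same component predicate, so
  \<open>SOME\<close> picks the same point for them.\<close>

definition base :: "'p \<Rightarrow> 'p"
  where "base p = (SOME q. connected_component UNIV p q)"

lemma base_component: "connected_component UNIV (base p) p"
proof -
  have "connected_component UNIV p (base p)" unfolding base_def by (rule someI_ex) (auto intro!: exI[of _ p])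
  then show ?thesis using connected_component_sym by blast
qed

lemma base_eq: "connected_component UNIV p q \<Longrightarrow> base p = base q"
proof -
  assume "connected_component UNIV p q"
  then have "connected_component UNIV p = connected_component UNIV q"
    by (intro ext) (metis connected_component_sym connected_component_trans)
  then show ?thesis by (simp add: base_def)
qed

lemma base_base [simp]: "base (base p) = base p"
  by (rule base_eq) (rule base_component)

text \<open>Coordinate balls are connected. Because of this, subtracting the value at the base point
  is a locally constant correction and does not change a derivative.\<close>

lemma base_locally_const: "\<exists>U. open U \<and> p \<in> U \<and> (\<forall>q\<in>U. base q = base p)"
proof -
  obtain c where c: "c \<in> A" "p \<in> fst c" using cover by blast
  obtain r where r: "r > 0" "ball (snd c p) r \<subseteq> snd c ` fst c"
    using open_img[OF c(1)] c openE by blast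
  let ?U = "chart_inv c ` ball (snd c p) r"
  have U: "?U = {q \<in> fst c. snd c q \<in> ball (snd c p) r}"
  proof
    show "?U \<subseteq> {q \<in> fst c. snd c q \<in> ball (snd c p) r}" using r c by auto
    show "{q \<in> fst c. snd c q \<in> ball (snd c p) r} \<subseteq> ?U" using c by (force simp: image_iff)
  qed
  have p: "p \<in> ?U" unfolding U using c r by simp
  have conn: "connected ?U"
    by (intro connected_continuous_image continuous_on_subset[OF continuous_chart_inv[OF c(1)] r(2)])
      (simp add: convex_connected)
  have "base q = base p" if "q \<in> ?U" for q
    using conn p that by (intro base_eq) (auto simp: connected_component_def)
  moreover have "open ?U" unfolding U by (rule open_chart_preimage[OF c(1)]) simp
  ultimately show ?thesis using p by blast
qed

text \<open>The zero set and its complement are both unions of neighbourhoods of constancy, hence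
  clopen. Each component lies in one of them, and its base point decides in which.\<close>

lemma eq_zero_of_mderiv:
  fixes f :: "'p \<Rightarrow> 'b::real_normed_vector"
  assumes f: "smooth_fun A UNIV f" "\<And>q v. mderiv A f q v = 0" and 0: "\<And>q. f (base q) = 0"
  shows "f p = 0"
proof -
  have "\<forall>p. \<exists>U. open U \<and> p \<in> U \<and> (\<forall>q\<in>U. f q = f p)"
    using mderiv_zero_locally_const[OF f] by blast
  then obtain U where U: "\<And>p. open (U p)" "\<And>p. p \<in> U p" "\<And>p q. q \<in> U p \<Longrightarrow> f q = f p"
    by (auto dest!: choice)
  have "{q. f q = 0} = (\<Union>q\<in>{q. f q = 0}. U q)" "- {q. f q = 0} = (\<Union>q\<in>- {q. f q = 0}. U q)"
    using U(2,3) by auto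
  then have "open {q. f q = 0}" "open (- {q. f q = 0})"
    using U(1) by (metis open_UN)+
  from clopen_connected_component[OF this _ base_component[of p]] show ?thesis using 0 by simp
qed

section \<open>Vector fields and Lie brackets\<close>

abbreviation vf_comp :: "('p, 'e) chart \<Rightarrow> ('p \<Rightarrow> 'e) \<Rightarrow> 'e \<Rightarrow> 'e"
  where "vf_comp c V \<equiv> \<lambda>z. mderiv A (snd c) (chart_inv c z) (V (chart_inv c z))"

lemma vector_fields_iff: "V \<in> vector_fields A \<longleftrightarrow> (\<forall>c\<in>A. smooth_on (snd c ` fst c) (vf_comp c V))"
proof
  show "\<forall>c\<in>A. smooth_on (snd c ` fst c) (vf_comp c V)" if "V \<in> vector_fields A"
    using that unfolding vector_fields_def smooth_fun_def o_def by fastforce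
next
  assume *: "\<forall>c\<in>A. smooth_on (snd c ` fst c) (vf_comp c V)"
  show "V \<in> vector_fields A"
    unfolding vector_fields_def
    by (clarify, rule smooth_fun_chart) (use * open_dom in \<open>auto simp: o_def\<close>)
qed

lemma vf_comp_change:
  assumes "c \<in> A" "d \<in> A" "z \<in> snd c ` (fst c \<inter> fst d)"
  shows "mderiv A (snd d) (chart_inv c z) (V (chart_inv c z)) =
    frechet_derivative (snd d \<circ> chart_inv c) (at z) (vf_comp c V z)"
proof -
  obtain q where q: "q \<in> fst c" "q \<in> fst d" "z = snd c q" using assms(3) by blast
  have "mderiv A (snd d) q (V q) = mderiv A (snd d) q (coord_vec A c q (mderiv A (snd c) q (V q)))"
    using q assms by simp
  then show ?thesis using q assms by (simp add: mderiv_coord_vec_chart del: coord_vec_mderiv)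
qed

text \<open>Connections speak about global vector fields only, whereas closed forms are tested on
  coordinate fields. A cutoff at p extends the latter. The region N where the cutoff is 1 serves all
  directions w, so that two such fields can be compared on it.\<close>

lemma local_coordinate_field:
  assumes c: "c \<in> A" "p \<in> fst c"
  shows "\<exists>N. open N \<and> p \<in> N \<and> N \<subseteq> fst c \<and>
    (\<forall>w. \<exists>V\<in>vector_fields A. \<forall>q\<in>N. V q = coord_vec A c q w)"
proof -
  obtain r where r: "r > 0" "cball (snd c p) r \<subseteq> snd c ` fst c"
    using open_img[OF c(1)] c open_contains_cball by blast
  obtain \<eta> :: "'e \<Rightarrow> real" where \<eta>: "smooth_on UNIV \<eta>" "\<And>y. y \<in> ball (snd c p) (r / 2) \<Longrightarrow> \<eta> y = 1"
    "\<And>y. y \<notin> ball (snd c p) r \<Longrightarrow> \<eta> y = 0"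
    using smooth_bump[of "r / 2" r "snd c p"] r by auto
  define N where "N = {q \<in> fst c. snd c q \<in> ball (snd c p) (r / 2)}"
  define V where "V = (\<lambda>w q. if q \<in> fst c then \<eta> (snd c q) *\<^sub>R coord_vec A c q w else 0)"
  have V: "V w \<in> vector_fields A" for w
    unfolding vector_fields_def
  proof (clarify, rule smooth_fun_local)
    fix a b assume d: "(a, b) \<in> A"
    then show "open (fst (a, b))" by (rule open_dom)
    fix q assume q: "q \<in> fst (a, b)"
    let ?d = "(a, b)" and ?g = "\<lambda>q. mderiv A (snd (a, b)) q (V w q)"
    show "\<exists>U. q \<in> U \<and> smooth_fun A U ?g"
    proof (cases "q \<in> fst c")
      case True
      let ?U = "fst c \<inter> fst ?d"
      have U: "open ?U" using c d open_dom by blast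
      have lin: "linear (mderiv A (snd ?d) q)" if "q \<in> fst ?d" for q
        using linear_mderiv[OF smooth_fun_chart_coord[OF d] that] .
      have "smooth_on (snd c ` ?U) (\<lambda>z. \<eta> z *\<^sub>R frechet_derivative (snd ?d \<circ> chart_inv c) (at z) w)"
        using open_image_chart[OF c(1) open_dom[OF d]]
        by (intro smooth_intros smooth_on_frechet_derivative smooth_transition c d smooth_on_subset[OF \<eta>(1)]) auto
      then have "smooth_fun A ?U ?g"
        by (intro smooth_fun_chart[OF c(1) U], simp)
          (subst smooth_on_cong[OF open_image_chart[OF c(1) open_dom[OF d]]];
            use c d lin mderiv_coord_vec_chart[OF c(1) d] in \<open>auto simp: V_def linear_cmul\<close>)
      then show ?thesis using True q by blast
    next
      case False
      \<comment> \<open>Around a point outside the chart c the field is 0: the closed set that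
        carries the cutoff is removed.\<close>
      let ?U = "fst ?d - chart_inv c ` cball (snd c p) r"
      have U: "open ?U" using open_dom[OF d] closed_chart_compact[OF c(1) compact_cball r(2)] by blast
      have "q \<in> ?U" using q False c r by (auto simp: subset_iff)
      moreover have "smooth_fun A ?U ?g"
      proof (subst smooth_fun_cong)
        fix q' assume q': "q' \<in> ?U"
        have "V w q' = 0"
        proof (cases "q' \<in> fst c")
          case True
          then have "snd c q' \<notin> cball (snd c p) r" using q' c by (force simp: image_iff)
          then show ?thesis using \<eta>(3) by (simp add: V_def)
        qed (simp add: V_def)
        then show "?g q' = 0"
          using linear_0[OF linear_mderiv[OF smooth_fun_chart_coord[OF d]]] q' by simp
      qed (rule smooth_fun_const[OF U])
      ultimately show ?thesis by blast
    qed
  qed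
  have "open N" "p \<in> N" "N \<subseteq> fst c"
    using c r by (auto simp: N_def open_chart_preimage simp del: mem_ball)
  moreover have "V w q = coord_vec A c q w" if "q \<in> N" for q w
    using that \<eta>(2) by (simp add: N_def V_def)
  ultimately show ?thesis using V by blast
qed

lemma vector_field_through:
  "\<exists>V\<in>vector_fields A. V p = v"
proof -
  obtain c where c: "c \<in> A" "p \<in> fst c" using cover by blast
  from local_coordinate_field[OF c] obtain V where "V \<in> vector_fields A" "V p = coord_vec A c p (mderiv A (snd c) p v)"
    by blast
  then show ?thesis using c by auto
qed

text \<open>The last term contains the second derivative of the transition map. It is the reason why
  derivatives of components are not tensorial; being symmetric in its two directions, it cancels in
  the bracket.\<close>

lemma mderiv_vf_comp:
  assumes VW: "W \<in> vector_fields A" and c: "c \<in> A" "p \<in> fst c" and d: "d \<in> A" "p \<in> fst d"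
  defines "z \<equiv> snd c p" and "\<tau> \<equiv> snd d \<circ> chart_inv c"
  shows "mderiv A (\<lambda>q. mderiv A (snd d) q (W q)) p v =
    frechet_derivative \<tau> (at z) (frechet_derivative (vf_comp c W) (at z) (mderiv A (snd c) p v)) +
    frechet_derivative (\<lambda>y. frechet_derivative \<tau> (at y) (vf_comp c W z)) (at z) (mderiv A (snd c) p v)"
proof (rule mderiv_chart[OF c])
  let ?U = "snd c ` (fst c \<inter> fst d)"
  have U: "open ?U" by (rule open_image_chart[OF c(1) open_dom[OF d(1)]])
  have z: "z \<in> ?U" using c d by (simp add: z_def)
  have \<tau>: "smooth_on ?U \<tau>" unfolding \<tau>_def by (rule smooth_transition[OF c(1) d(1)])
  have "(vf_comp c W has_derivative frechet_derivative (vf_comp c W) (at z)) (at z)"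
    using VW c unfolding vector_fields_iff z_def by (blast intro: smooth_on_has_derivative)
  from has_derivative_frechet_apply[OF U \<tau> z this]
  show "((\<lambda>q. mderiv A (snd d) q (W q)) \<circ> chart_inv c has_derivative
     (\<lambda>u. frechet_derivative \<tau> (at z) (frechet_derivative (vf_comp c W) (at z) u) +
      frechet_derivative (\<lambda>y. frechet_derivative \<tau> (at y) (vf_comp c W z)) (at z) u)) (at (snd c p))"
    unfolding z_def[symmetric]
    by (rule has_derivative_transform_within_open[OF _ U z])
      (simp add: \<tau>_def vf_comp_change[OF c(1) d(1)])
qed

text \<open>The definition of the bracket uses a chart that changes from point to point, so its
  smoothness is not visible there. One fixed chart may be used instead because the second
  derivatives of the transition map cancel by symmetry.\<close>

lemma lie_bracket_chart:
  assumes VW: "V \<in> vector_fields A" "W \<in> vector_fields A" and c: "c \<in> A" "p \<in> fst c"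
  defines "z \<equiv> snd c p"
  shows "lie_bracket A V W p = coord_vec A c p
    (frechet_derivative (vf_comp c W) (at z) (vf_comp c V z) - frechet_derivative (vf_comp c V) (at z) (vf_comp c W z))"
proof -
  define e where "e = chart_at A p"
  have e: "e \<in> A" "p \<in> fst e" using chart_at by (auto simp: e_def)
  let ?\<tau> = "snd e \<circ> chart_inv c"
  have p: "chart_inv c z = p" using c by (simp add: z_def)
  have lin: "linear (frechet_derivative ?\<tau> (at z))"
    unfolding z_def by (rule has_derivative_linear[OF transition_has_derivative[OF c(1) e(1) c(2) e(2)]])
  have sym: "frechet_derivative (\<lambda>y. frechet_derivative ?\<tau> (at y) v) (at z) w =
      frechet_derivative (\<lambda>y. frechet_derivative ?\<tau> (at y) w) (at z) v" for v w
    by (rule symmetric_second_frechet_derivative[OF open_image_chart[OF c(1) open_dom[OF e(1)]]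
          smooth_transition[OF c(1) e(1)]]) (use c e in \<open>auto simp: z_def\<close>)
  show ?thesis
    unfolding lie_bracket_def Let_def e_def[symmetric] coord_vec_def
    using mderiv_vf_comp[OF VW(1) c e] mderiv_vf_comp[OF VW(2) c e] sym
    by (simp add: p z_def[symmetric] linear_diff[OF lin])
qed

lemma lie_bracket_vector_fields:
  assumes VW: "V \<in> vector_fields A" "W \<in> vector_fields A"
  shows "lie_bracket A V W \<in> vector_fields A"
  unfolding vector_fields_iff
proof
  fix c assume c: "c \<in> A"
  have VW': "smooth_on (snd c ` fst c) (vf_comp c V)" "smooth_on (snd c ` fst c) (vf_comp c W)"
    using VW c vector_fields_iff by auto
  have "smooth_on (snd c ` fst c) (\<lambda>z. frechet_derivative (vf_comp c W) (at z) (vf_comp c V z)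
      - frechet_derivative (vf_comp c V) (at z) (vf_comp c W z))"
    by (intro smooth_on_diff open_img c smooth_on_frechet_derivative_apply[OF open_img[OF c] VW'(1)]
        smooth_on_frechet_derivative_apply[OF open_img[OF c] VW'(2)] VW' smooth_on_id)
  then show "smooth_on (snd c ` fst c) (vf_comp c (lie_bracket A V W))"
    by (subst smooth_on_cong[OF open_img[OF c]]) (use c in \<open>auto simp: lie_bracket_chart[OF VW c]\<close>)
qed

lemma lie_bracket_coordinate_fields:
  assumes VW: "V \<in> vector_fields A" "W \<in> vector_fields A" and c: "c \<in> A" "p \<in> fst c"
    and N: "open N" "p \<in> N" "N \<subseteq> fst c"
    and "\<And>q. q \<in> N \<Longrightarrow> V q = coord_vec A c q v" "\<And>q. q \<in> N \<Longrightarrow> W q = coord_vec A c q w"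
  shows "lie_bracket A V W p = 0"
proof -
  have N': "open (snd c ` N)" "snd c p \<in> snd c ` N" using open_image_chart_subset[OF c(1) N(1,3)] N by auto
  have "frechet_derivative (vf_comp c V) (at (snd c p)) = frechet_derivative (\<lambda>z. v) (at (snd c p))"
    "frechet_derivative (vf_comp c W) (at (snd c p)) = frechet_derivative (\<lambda>z. w) (at (snd c p))"
    by (rule frechet_derivative_cong_open[OF N']; use c N assms(8,9) in \<open>auto simp: subset_iff\<close>)+
  then show ?thesis
    using lie_bracket_chart[OF VW c] linear_0[OF linear_coord_vec[OF c]] by simp
qed

end

section \<open>Smooth families of functions\<close>

lemma ball_segment:
  fixes a :: "'a::real_normed_vector"
  assumes "x \<in> ball a r" "y \<in> ball a r" "t \<in> {0..1::real}"
  shows "x + t *\<^sub>R (y - x) \<in> ball a r"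
proof -
  have "(1 - t) *\<^sub>R x + t *\<^sub>R y \<in> ball a r"
    using assms by (auto intro: convexD_alt[OF convex_ball] simp del: mem_ball)
  then show ?thesis by (simp add: algebra_simps)
qed

context smooth_mfd
begin

text \<open>Joint smoothness of a family of functions on the manifold whose parameter runs through
  an open set of a Euclidean space. The parameter space is left arbitrary because the proofs enlarge
  it by the point of evaluation and by an integration variable.\<close>

definition psmooth :: "'a::euclidean_space set \<Rightarrow> ('a \<Rightarrow> 'p \<Rightarrow> complex) \<Rightarrow> bool"
  where "psmooth Z h \<longleftrightarrow> open Z \<and>
    (\<forall>d\<in>A. smooth_on (Z \<times> snd d ` fst d) (\<lambda>w. h (fst w) (chart_inv d (snd w))))"

lemma psmooth_open: "psmooth Z h \<Longrightarrow> open Z"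
  by (simp add: psmooth_def)

lemma psmooth_chart:
  "psmooth Z h \<Longrightarrow> d \<in> A \<Longrightarrow> smooth_on (Z \<times> snd d ` fst d) (\<lambda>w. h (fst w) (chart_inv d (snd w)))"
  by (simp add: psmooth_def)

lemma open_Times_img: "open Z \<Longrightarrow> d \<in> A \<Longrightarrow> open (Z \<times> snd d ` fst d)"
  by (intro open_Times open_img)

lemma psmooth_subset: "psmooth Z h \<Longrightarrow> open Y \<Longrightarrow> Y \<subseteq> Z \<Longrightarrow> psmooth Y h"
  unfolding psmooth_def using Sigma_mono[of Y Z, OF _ order_refl]
  by (auto intro: smooth_on_subset simp del: split_paired_All)

lemma psmooth_cong:
  assumes "\<And>z q. z \<in> Z \<Longrightarrow> h z q = k z q"
  shows "psmooth Z h \<longleftrightarrow> psmooth Z k"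
proof (cases "open Z")
  case True
  have "smooth_on (Z \<times> snd d ` fst d) (\<lambda>w. h (fst w) (chart_inv d (snd w))) \<longleftrightarrow>
    smooth_on (Z \<times> snd d ` fst d) (\<lambda>w. k (fst w) (chart_inv d (snd w)))" if "d \<in> A" for d
    by (rule smooth_on_cong[OF open_Times_img[OF True that]]) (use assms in auto)
  then show ?thesis by (simp add: psmooth_def)
qed (simp add: psmooth_def)

lemma psmooth_local:
  assumes "open Z" "\<And>z. z \<in> Z \<Longrightarrow> \<exists>W. z \<in> W \<and> psmooth W h"
  shows "psmooth Z h"
  unfolding psmooth_def
proof (intro conjI ballI smooth_on_local assms(1))
  fix d w assume d: "d \<in> A" and w: "w \<in> Z \<times> snd d ` fst d"
  then obtain W where "fst w \<in> W" "psmooth W h" using assms(2) by (metis mem_Times_iff)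
  then show "\<exists>U. open U \<and> w \<in> U \<and> smooth_on U (\<lambda>w. h (fst w) (chart_inv d (snd w)))"
    using d w by (intro exI[of _ "W \<times> snd d ` fst d"]) (auto simp: psmooth_chart psmooth_open open_img intro!: open_Times)
qed

lemma psmoothI:
  assumes "open Z"
    and loc: "\<And>z q. z \<in> Z \<Longrightarrow> \<exists>c\<in>A. \<exists>W N. open W \<and> open N \<and> z \<in> W \<and> q \<in> N \<and> N \<subseteq> fst c \<and>
      smooth_on (W \<times> snd c ` N) (\<lambda>w. h (fst w) (chart_inv c (snd w)))"
  shows "psmooth Z h"
  unfolding psmooth_def
proof (intro conjI ballI smooth_on_localI assms(1))
  fix d w assume d: "d \<in> A" and w: "w \<in> Z \<times> snd d ` fst d"
  then obtain q where q: "q \<in> fst d" "snd w = snd d q" by (metis imageE mem_Times_iff)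
  have "fst w \<in> Z" using w by auto
  from loc[OF this, of q] obtain c W N where c: "c \<in> A" and W: "open W" "open N" "fst w \<in> W" "q \<in> N" "N \<subseteq> fst c"
    and sm: "smooth_on (W \<times> snd c ` N) (\<lambda>w. h (fst w) (chart_inv c (snd w)))" by blast
  let ?U = "W \<times> snd d ` (fst d \<inter> N)"
  have U: "open ?U" using W open_image_chart[OF d W(2)] by (intro open_Times)
  have "open (W \<times> snd c ` N)" using W open_image_chart_subset[OF c W(2,5)] by (intro open_Times)
  have tr: "smooth_on ?U (\<lambda>w. (snd c \<circ> chart_inv d) (snd w))"
    by (rule smooth_on_compose[OF smooth_transition[OF d c] open_image_chart[OF d open_dom[OF c]] U])
      (use W in \<open>auto intro!: smooth_intros U\<close>)
  have "smooth_on ?U (\<lambda>w. h (fst (fst w, (snd c \<circ> chart_inv d) (snd w))) (chart_inv c (snd (fst w, (snd c \<circ> chart_inv d) (snd w)))))"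
    by (rule smooth_on_compose[OF sm \<open>open (W \<times> snd c ` N)\<close> U smooth_on_Pair[OF U _ tr]])
      (use d W in \<open>auto intro!: smooth_intros U\<close>)
  moreover have "h (fst y) (chart_inv d (snd y)) =
      h (fst (fst y, (snd c \<circ> chart_inv d) (snd y))) (chart_inv c (snd (fst y, (snd c \<circ> chart_inv d) (snd y))))" if "y \<in> ?U" for y
    using that c d W by (auto simp: subset_iff)
  moreover have "w \<in> ?U" using q W by (auto simp: mem_Times_iff)
  ultimately show "\<exists>U g. open U \<and> w \<in> U \<and> smooth_on U g \<and> (\<forall>y\<in>U. h (fst y) (chart_inv d (snd y)) = g y)"
    using U by blast
qed

lemma psmooth_add: "psmooth Z h \<Longrightarrow> psmooth Z k \<Longrightarrow> psmooth Z (\<lambda>z q. h z q + k z q)"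
  unfolding psmooth_def by (intro conjI ballI smooth_on_add open_Times_img; blast)

lemma psmooth_diff: "psmooth Z h \<Longrightarrow> psmooth Z k \<Longrightarrow> psmooth Z (\<lambda>z q. h z q - k z q)"
  unfolding psmooth_def by (intro conjI ballI smooth_on_diff open_Times_img; blast)

lemma psmooth_mult: "psmooth Z h \<Longrightarrow> psmooth Z k \<Longrightarrow> psmooth Z (\<lambda>z q. h z q * k z q)"
  unfolding psmooth_def by (intro conjI ballI smooth_on_mult open_Times_img; blast)

lemma psmooth_sum: "open Z \<Longrightarrow> (\<And>i. i \<in> I \<Longrightarrow> psmooth Z (h i)) \<Longrightarrow> psmooth Z (\<lambda>z q. \<Sum>i\<in>I. h i z q)"
  unfolding psmooth_def by (intro conjI ballI smooth_on_sum open_Times_img; blast)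

lemma psmooth_param:
  assumes "open Z" "smooth_on Z g"
  shows "psmooth Z (\<lambda>z q. g z)"
  unfolding psmooth_def
proof (intro conjI ballI assms(1))
  fix d assume d: "d \<in> A"
  note U = open_Times_img[OF assms(1) d]
  show "smooth_on (Z \<times> snd d ` fst d) (\<lambda>w. g (fst w))"
    by (rule smooth_on_compose[OF assms(2,1) U smooth_on_fst[OF U smooth_on_id]]) auto
qed

lemma psmooth_fun: "open Z \<Longrightarrow> f \<in> smooth_functions A \<Longrightarrow> psmooth Z (\<lambda>z. f)"
  unfolding psmooth_def smooth_functions_def smooth_fun_def
proof (intro conjI ballI, assumption)
  fix d assume "open Z" and f: "f \<in> {f. open UNIV \<and> (\<forall>c\<in>A. smooth_on (snd c ` (fst c \<inter> UNIV)) (f \<circ> chart_inv c))}" and d: "d \<in> A"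
  have "smooth_on (snd d ` fst d) (f \<circ> chart_inv d)" using f d by simp
  from smooth_on_compose[OF this open_img[OF d] open_Times_img[OF \<open>open Z\<close> d] smooth_on_snd[OF open_Times_img[OF \<open>open Z\<close> d] smooth_on_id]]
  show "smooth_on (Z \<times> snd d ` fst d) (\<lambda>w. f (chart_inv d (snd w)))" by force
qed

lemma psmooth_compose:
  assumes "psmooth Z h" "open Y" "smooth_on Y g" "\<And>y. y \<in> Y \<Longrightarrow> g y \<in> Z"
  shows "psmooth Y (\<lambda>y. h (g y))"
  unfolding psmooth_def
proof (intro conjI ballI assms(2))
  fix d assume d: "d \<in> A"
  let ?U = "Y \<times> snd d ` fst d"
  have U: "open ?U" by (rule open_Times_img[OF assms(2) d])
  have "smooth_on ?U (\<lambda>w. g (fst w))"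
    by (rule smooth_on_compose[OF assms(3,2) U]) (auto intro!: smooth_intros U)
  then have p: "smooth_on ?U (\<lambda>w. (g (fst w), snd w))" by (intro smooth_intros U) auto
  have "smooth_on ?U (\<lambda>w. (\<lambda>w. h (fst w) (chart_inv d (snd w))) (g (fst w), snd w))"
    by (rule smooth_on_compose[OF psmooth_chart[OF assms(1) d] open_Times_img[OF psmooth_open[OF assms(1)] d] U p])
      (use assms(4) in auto)
  then show "smooth_on ?U (\<lambda>w. h (g (fst w)) (chart_inv d (snd w)))" by simp
qed

lemma psmooth_slice:
  assumes "psmooth Z h" "z \<in> Z"
  shows "h z \<in> smooth_functions A"
proof -
  have "smooth_on (snd d ` fst d) (h z \<circ> chart_inv d)" if d: "d \<in> A" for d
  proof -
    have "smooth_on (snd d ` fst d) (\<lambda>y. (\<lambda>w. h (fst w) (chart_inv d (snd w))) (z, y))"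
      by (rule smooth_on_compose[OF psmooth_chart[OF assms(1) d] open_Times_img[OF psmooth_open[OF assms(1)] d] open_img[OF d]])
        (use assms(2) in \<open>auto intro!: smooth_intros open_img d\<close>)
    then show ?thesis by (simp add: o_def)
  qed
  then show ?thesis by (simp add: smooth_functions_def smooth_fun_def)
qed

lemma psmooth_at_point:
  assumes "psmooth Z h"
  shows "smooth_on Z (\<lambda>z. h z q)"
proof -
  obtain d where d: "d \<in> A" "q \<in> fst d" using cover by blast
  have "smooth_on Z (\<lambda>z. (\<lambda>w. h (fst w) (chart_inv d (snd w))) (z, snd d q))"
    by (rule smooth_on_compose[OF psmooth_chart[OF assms d(1)] open_Times_img[OF psmooth_open[OF assms] d(1)] psmooth_open[OF assms]])
      (use d in \<open>auto intro!: smooth_intros psmooth_open[OF assms]\<close>)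
  then show ?thesis using d by simp
qed

lemma psmooth_has_derivative:
  "psmooth Z h \<Longrightarrow> z \<in> Z \<Longrightarrow> ((\<lambda>z. h z q) has_derivative frechet_derivative (\<lambda>z. h z q) (at z)) (at z)"
  by (rule smooth_on_has_derivative[OF psmooth_at_point])

lemma psmooth_deriv:
  assumes "psmooth Z h"
  shows "psmooth Z (\<lambda>z q. frechet_derivative (\<lambda>z. h z q) (at z) v)"
  unfolding psmooth_def
proof (intro conjI ballI psmooth_open[OF assms])
  fix d assume d: "d \<in> A"
  let ?U = "Z \<times> snd d ` fst d" and ?h = "\<lambda>w. h (fst w) (chart_inv d (snd w))"
  note sm = psmooth_chart[OF assms d]
  have U: "open ?U" by (rule open_Times_img[OF psmooth_open[OF assms] d])
  have "frechet_derivative (\<lambda>z. h z (chart_inv d y)) (at z) v = frechet_derivative ?h (at (z, y)) (v, 0)"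
    if "z \<in> Z" "y \<in> snd d ` fst d" for z y
    using frechet_derivative_eqI[OF has_derivative_slice_fst[OF smooth_on_has_derivative[OF sm]], of z y] that by simp
  then show "smooth_on ?U (\<lambda>w. frechet_derivative (\<lambda>z. h z (chart_inv d (snd w))) (at (fst w)) v)"
    by (subst smooth_on_cong[OF U, where g="\<lambda>w. frechet_derivative ?h (at w) (v, 0)"])
      (use smooth_on_frechet_derivative[OF sm, of "(v, 0)"] in \<open>auto simp: mem_Times_iff\<close>)
qed

lemma psmooth_integral:
  assumes "psmooth W h" "open Z" "\<And>t z. t \<in> {0..1::real} \<Longrightarrow> z \<in> Z \<Longrightarrow> (t, z) \<in> W"
  shows "psmooth Z (\<lambda>z q. integral {0..1} (\<lambda>t. h (t, z) q))"
  unfolding psmooth_def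
proof (intro conjI ballI assms(2))
  fix d assume d: "d \<in> A"
  \<comment> \<open>\<open>psmooth\<close> groups the variables as ((t, z), y), the integral as (t,
    (z, y)); the domain is pulled back along the regrouping.\<close>
  let ?X = "(\<lambda>p. ((fst p, fst (snd p)), snd (snd p))) -` (W \<times> snd d ` fst d)"
  define F where "F = (\<lambda>p. h (fst p, fst (snd p)) (chart_inv d (snd (snd p))))"
  have oX: "open (W \<times> snd d ` fst d)" by (rule open_Times_img[OF psmooth_open[OF assms(1)] d])
  have X: "open ?X" by (intro open_vimage oX continuous_intros)
  have "smooth_on ?X (\<lambda>p. ((fst p, fst (snd p)), snd (snd p)))" by (intro smooth_intros X)
  then have F: "smooth_on ?X F"
    using smooth_on_compose[OF psmooth_chart[OF assms(1) d] oX X, of "\<lambda>p. ((fst p, fst (snd p)), snd (snd p))"]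
    unfolding F_def by simp
  have "smooth_on (Z \<times> snd d ` fst d) (\<lambda>w. integral {0..1} (\<lambda>t. F (t, w)))"
    by (rule smooth_on_integral[OF X F open_Times_img[OF assms(2) d]]) (use assms(3) in auto)
  then show "smooth_on (Z \<times> snd d ` fst d) (\<lambda>w. integral {0..1} (\<lambda>t. h (t, fst w) (chart_inv d (snd w))))"
    by (simp add: F_def)
qed

text \<open>Hadamard remainders \<rho> exist only over a coordinate ball B. Multiplied by a cutoff
  with support in a compact part K of B they become families of functions on the whole manifold, to
  which operators can be applied.\<close>

lemma psmooth_extend:
  assumes c: "c \<in> A" and Z: "open Z" and B: "open B" "B \<subseteq> snd c ` fst c" and K: "compact K" "K \<subseteq> B"
    and \<eta>: "smooth_on UNIV \<eta>" "\<And>y. y \<notin> K \<Longrightarrow> \<eta> y = (0::real)"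
    and \<rho>: "smooth_on (Z \<times> B) \<rho>"
  shows "psmooth Z (\<lambda>z q. if q \<in> fst c then of_real (\<eta> (snd c q)) * \<rho> (z, snd c q) else 0)" (is "psmooth Z ?h")
proof (rule psmoothI[OF Z])
  fix z q assume z: "z \<in> Z"
  show "\<exists>c\<in>A. \<exists>W N. open W \<and> open N \<and> z \<in> W \<and> q \<in> N \<and> N \<subseteq> fst c \<and>
      smooth_on (W \<times> snd c ` N) (\<lambda>w. ?h (fst w) (chart_inv c (snd w)))"
  proof (cases "q \<in> fst c \<and> snd c q \<in> B")
    case True
    let ?N = "{p \<in> fst c. snd c p \<in> B}"
    have N: "snd c ` ?N = B" using B(2) by auto
    have ZB: "open (Z \<times> B)" using Z B by (intro open_Times)
    have "smooth_on (Z \<times> B) (\<lambda>w. \<eta> (snd w))"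
      by (rule smooth_on_compose[OF \<eta>(1) _ ZB]) (auto intro!: smooth_intros ZB)
    then have "smooth_on (Z \<times> B) (\<lambda>w. of_real (\<eta> (snd w)) * \<rho> w)"
      by (intro smooth_intros ZB \<rho>)
    then have "smooth_on (Z \<times> snd c ` ?N) (\<lambda>w. ?h (fst w) (chart_inv c (snd w)))"
      unfolding N by (subst smooth_on_cong[OF ZB]) (use B c in \<open>auto simp: subset_iff\<close>)
    then show ?thesis using True z c Z open_chart_preimage[OF c B(1)]
      by (intro bexI[of _ c] exI[of _ Z] exI[of _ ?N]) auto
  next
    case False
    obtain d where d: "d \<in> A" "q \<in> fst d" using cover by blast
    let ?N = "fst d \<inter> - chart_inv c ` K"
    have cl: "closed (chart_inv c ` K)" using closed_chart_compact[OF c K(1)] K(2) B(2) by blast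
    then have N: "open ?N" "?N \<subseteq> fst d" using open_dom[OF d(1)] by auto
    have "q \<in> ?N" using False d K B c by (auto simp: subset_iff)
    have 0: "?h z p = 0" if "p \<in> ?N" for z p
      using that \<eta>(2)[of "snd c p"] c by (force simp: image_iff)
    have "?h (fst w) (chart_inv d (snd w)) = 0" if "w \<in> Z \<times> snd d ` ?N" for w
    proof -
      have "snd w \<in> snd d ` ?N" using that by (rule SigmaE) simp
      then obtain p where p: "p \<in> ?N" "snd w = snd d p" by (rule imageE)
      then have "chart_inv d (snd w) \<in> ?N" using d by simp
      then show ?thesis by (rule 0)
    qed
    from smooth_on_cong[OF open_Times[OF Z open_image_chart_subset[OF d(1) N]] this]
    have "smooth_on (Z \<times> snd d ` ?N) (\<lambda>w. ?h (fst w) (chart_inv d (snd w)))" by simp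
    then show ?thesis using d N z Z \<open>q \<in> ?N\<close> by blast
  qed
qed

end

section \<open>Smoothness on a product of two manifolds\<close>

lemma open_Times_UNIV: "open (U \<times> UNIV) \<longleftrightarrow> open U"
proof
  assume "open (U \<times> (UNIV :: 'b set))"
  then have "open (fst ` (U \<times> (UNIV :: 'b set)))" by (rule open_image_fst)
  then show "open U" by simp
qed (simp add: open_Times)

locale mfd_pair = T: smooth_mfd T + M: smooth_mfd M
  for T :: "('t::{second_countable_topology, t2_space}, 'b::euclidean_space) chart set"
    and M :: "('p::{second_countable_topology, t2_space}, 'e::euclidean_space) chart set"
begin

text \<open>This translates between smoothness on the product, in which the definitions are phrased,
  and families parametrized by coordinates on T, with which all later calculus is done.\<close>

lemma smooth_fun_prod_iff:
  "smooth_fun (prod_atlas T M) (U \<times> UNIV) (\<lambda>(\<sigma>, x). h \<sigma> x) \<longleftrightarrow>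
    open U \<and> (\<forall>c\<in>T. M.psmooth (snd c ` (fst c \<inter> U)) (\<lambda>z. h (chart_inv c z)))"
proof (cases "open U")
  case True
  have eq: "smooth_on (snd e ` (fst e \<inter> U \<times> UNIV)) ((\<lambda>(\<sigma>, x). h \<sigma> x) \<circ> chart_inv e) \<longleftrightarrow>
      smooth_on (snd c ` (fst c \<inter> U) \<times> snd d ` fst d) (\<lambda>w. h (chart_inv c (fst w)) (chart_inv d (snd w)))"
    if c: "c \<in> T" and d: "d \<in> M" and e: "e = (fst c \<times> fst d, \<lambda>(p, q). (snd c p, snd d q))" for c d e
  proof -
    have img: "snd e ` (fst e \<inter> U \<times> UNIV) = snd c ` (fst c \<inter> U) \<times> snd d ` fst d"
      unfolding e by force
    \<comment> \<open>\<open>chart_inv\<close> is an \<open>inv_into\<close>, so its values on a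
      product chart have to be obtained from injectivity.\<close>
    have "inj_on (snd e) (fst e)"
    proof (rule inj_onI)
      fix x y assume xy: "x \<in> fst e" "y \<in> fst e" "snd e x = snd e y"
      obtain a b a' b' where ab: "x = (a, b)" "y = (a', b')" by fastforce
      have "snd c a = snd c a'" "a \<in> fst c" "a' \<in> fst c" "snd d b = snd d b'" "b \<in> fst d" "b' \<in> fst d"
        using xy by (simp_all add: e ab)
      then have "a = a'" "b = b'" using T.inv_chart[OF c] M.inv_chart[OF d] by metis+
      then show "x = y" by (simp add: ab)
    qed
    then have inv: "chart_inv e (snd c p, snd d q) = (p, q)" if "p \<in> fst c" "q \<in> fst d" for p q
      using inv_into_f_f[of "snd e" "fst e" "(p, q)"] that by (simp add: chart_inv_def e)
    show ?thesis unfolding img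
      by (rule smooth_on_cong)
        (use T.open_image_chart[OF c True] M.open_img[OF d] inv c d in \<open>auto intro!: open_Times\<close>)
  qed
  have "smooth_fun (prod_atlas T M) (U \<times> UNIV) (\<lambda>(\<sigma>, x). h \<sigma> x) \<longleftrightarrow>
    (\<forall>c\<in>T. \<forall>d\<in>M. smooth_on (snd c ` (fst c \<inter> U) \<times> snd d ` fst d)
      (\<lambda>w. h (chart_inv c (fst w)) (chart_inv d (snd w))))"
  proof -
    have "(\<forall>e\<in>prod_atlas T M. P e) \<longleftrightarrow>
        (\<forall>c\<in>T. \<forall>d\<in>M. P (fst c \<times> fst d, \<lambda>(p, q). (snd c p, snd d q)))" for P
      unfolding prod_atlas_def by blast
    then show ?thesis
      using eq[OF _ _ refl] True by (simp add: smooth_fun_def open_Times_UNIV cong: ball_cong)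
  qed
  then show ?thesis
    using True T.open_image_chart unfolding M.psmooth_def by (simp add: Ball_def del: split_paired_All)
qed (simp add: smooth_fun_def open_Times_UNIV)

end

section \<open>Differential operators\<close>

context smooth_mfd
begin

abbreviation C where "C \<equiv> smooth_functions A"

lemma C_add: "f \<in> C \<Longrightarrow> g \<in> C \<Longrightarrow> f + g \<in> C"
  and C_diff: "f \<in> C \<Longrightarrow> g \<in> C \<Longrightarrow> f - g \<in> C"
  and C_mult: "f \<in> C \<Longrightarrow> g \<in> C \<Longrightarrow> f * g \<in> C"
  and C_const: "(\<lambda>x. z) \<in> C"
  and C_0: "0 \<in> C" and C_1: "1 \<in> C"
  by (simp_all add: smooth_functions_def plus_fun_def fun_diff_def times_fun_def zero_fun_def one_fun_def
      smooth_fun_add smooth_fun_diff smooth_fun_mult)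

lemma C_scale: "f \<in> C \<Longrightarrow> (\<lambda>x. z * f x) \<in> C"
  using C_mult[OF C_const[of z], of f] by (simp add: times_fun_def)

lemma C_sum: "(\<And>i. i \<in> I \<Longrightarrow> f i \<in> C) \<Longrightarrow> (\<Sum>i\<in>I. f i) \<in> C"
  by (induction I rule: infinite_finite_induct) (auto simp: C_0 C_add)

lemma linear_opD:
  assumes "linear_op A F"
  shows "f \<in> C \<Longrightarrow> F f \<in> C" "f \<in> C \<Longrightarrow> g \<in> C \<Longrightarrow> F (f + g) = F f + F g"
    "f \<in> C \<Longrightarrow> F (\<lambda>x. z * f x) = (\<lambda>x. z * F f x)"
  using assms by (auto simp: linear_op_def)

lemma linear_op_0: "linear_op A F \<Longrightarrow> F 0 = 0"
  using linear_opD(2)[OF _ C_0 C_0, of F] by simp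

lemma linear_op_diff:
  assumes "linear_op A F" "f \<in> C" "g \<in> C"
  shows "F (f - g) = F f - F g"
  using linear_opD(2)[OF assms(1) C_diff[OF assms(2,3)] assms(3)] by (simp add: algebra_simps)

lemma linear_op_sum:
  assumes "linear_op A F" "\<And>i. i \<in> I \<Longrightarrow> f i \<in> C"
  shows "F (\<Sum>i\<in>I. f i) = (\<Sum>i\<in>I. F (f i))"
  using assms(2)
  by (induction I rule: infinite_finite_induct)
    (auto simp: linear_op_0[OF assms(1)] linear_opD(2)[OF assms(1)] C_sum)

lemma linear_op_cong: "(\<And>f. f \<in> C \<Longrightarrow> F f = G f) \<Longrightarrow> linear_op A F \<longleftrightarrow> linear_op A G"
  by (simp add: linear_op_def C_add C_scale cong: ball_cong)

lemma diff_ops_linear: "F \<in> diff_ops A n \<Longrightarrow> linear_op A F"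
  by (cases n) auto

declare plus_fun_apply [simp del] times_fun_apply [simp del] minus_apply [simp del] uminus_apply [simp del]

lemma diff_ops_cong:
  "(\<And>f. f \<in> C \<Longrightarrow> F f = G f) \<Longrightarrow> F \<in> diff_ops A n \<longleftrightarrow> G \<in> diff_ops A n"
proof (induction n arbitrary: F G)
  case 0
  have "F (f * g) = G (f * g)" if "f \<in> C" "g \<in> C" for f g using 0 C_mult that by blast
  then show ?case using linear_op_cong[OF 0] 0 by (simp cong: ball_cong)
next
  case (Suc n)
  have "(\<lambda>g. F (f * g) - f * F g) \<in> diff_ops A n \<longleftrightarrow> (\<lambda>g. G (f * g) - f * G g) \<in> diff_ops A n" if "f \<in> C" for f
    by (rule Suc.IH) (simp only: Suc.prems C_mult that)
  then show ?case using linear_op_cong[OF Suc.prems] by (simp cong: ball_cong)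
qed

lemma linear_op_add_op: "linear_op A F \<Longrightarrow> linear_op A G \<Longrightarrow> linear_op A (\<lambda>f. F f + G f)"
  unfolding linear_op_def by (auto simp: C_add ring_distribs fun_eq_iff plus_fun_apply)

lemma linear_op_mult_op: "h \<in> C \<Longrightarrow> linear_op A F \<Longrightarrow> linear_op A (\<lambda>f. h * F f)"
  unfolding linear_op_def by (auto simp: C_mult ring_distribs fun_eq_iff plus_fun_apply times_fun_apply)

lemma diff_ops_0: "(\<lambda>f. 0) \<in> diff_ops A n"
proof -
  have "linear_op A (\<lambda>f. 0)" unfolding linear_op_def by (simp add: C_0 fun_eq_iff)
  then show ?thesis by (induction n) simp_all
qed

lemma diff_ops_add: "F \<in> diff_ops A n \<Longrightarrow> G \<in> diff_ops A n \<Longrightarrow> (\<lambda>f. F f + G f) \<in> diff_ops A n"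
proof (induction n arbitrary: F G)
  case 0
  then show ?case using linear_op_add_op[of F G] by (simp add: ring_distribs)
next
  case (Suc n)
  have "(\<lambda>g. F (f * g) + G (f * g) - f * (F g + G g)) \<in> diff_ops A n" if "f \<in> C" for f
  proof -
    have "(\<lambda>g. F (f * g) + G (f * g) - f * (F g + G g)) = (\<lambda>g. (F (f * g) - f * F g) + (G (f * g) - f * G g))"
      by (simp add: algebra_simps)
    then show ?thesis using Suc.IH[of "\<lambda>g. F (f * g) - f * F g" "\<lambda>g. G (f * g) - f * G g"] Suc.prems that by simp
  qed
  then show ?case using Suc.prems by (simp add: linear_op_add_op)
qed

lemma diff_ops_mult: "h \<in> C \<Longrightarrow> F \<in> diff_ops A n \<Longrightarrow> (\<lambda>f. h * F f) \<in> diff_ops A n"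
proof (induction n arbitrary: F)
  case 0
  then show ?case using linear_op_mult_op[of h F] by (simp add: mult.left_commute)
next
  case (Suc n)
  have "(\<lambda>g. h * F (f * g) - f * (h * F g)) \<in> diff_ops A n" if "f \<in> C" for f
  proof -
    have "(\<lambda>g. h * F (f * g) - f * (h * F g)) = (\<lambda>g. h * (F (f * g) - f * F g))"
      by (simp add: algebra_simps)
    then show ?thesis using Suc.IH[of "\<lambda>g. F (f * g) - f * F g"] Suc.prems that by simp
  qed
  then show ?case using Suc.prems by (simp add: linear_op_mult_op)
qed

lemma diff_ops_uminus: "F \<in> diff_ops A n \<Longrightarrow> (\<lambda>f. - F f) \<in> diff_ops A n"
  using diff_ops_mult[of "-1" F n] C_diff[OF C_0 C_1] by simp

lemma diff_ops_diff: "F \<in> diff_ops A n \<Longrightarrow> G \<in> diff_ops A n \<Longrightarrow> (\<lambda>f. F f - G f) \<in> diff_ops A n"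
  using diff_ops_add[OF _ diff_ops_uminus] by fastforce

lemma diff_ops_sum:
  "(\<And>i. i \<in> I \<Longrightarrow> F i \<in> diff_ops A n) \<Longrightarrow> (\<lambda>f. \<Sum>i\<in>I. F i f) \<in> diff_ops A n"
  by (induction I rule: infinite_finite_induct) (auto simp: diff_ops_0 diff_ops_add)

lemma linear_op_comp: "linear_op A F \<Longrightarrow> linear_op A G \<Longrightarrow> linear_op A (\<lambda>f. F (G f))"
  by (auto simp: linear_op_def)

text \<open>\<open>[FG, f] = F [G, f] + [F, f] G\<close>.\<close>

lemma diff_ops_comp: "F \<in> diff_ops A m \<Longrightarrow> G \<in> diff_ops A n \<Longrightarrow> (\<lambda>f. F (G f)) \<in> diff_ops A (m + n)"
proof (induction "m + n" arbitrary: m n F G)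
  case 0
  then show ?case by (auto simp: linear_op_comp linear_opD(1))
next
  case (Suc k)
  have lin: "linear_op A F" "linear_op A G" using Suc.prems diff_ops_linear by blast+
  have "(\<lambda>g. F (G (f * g)) - f * F (G g)) \<in> diff_ops A k" if f: "f \<in> C" for f
  proof -
    have 1: "(\<lambda>g. F (G (f * g) - f * G g)) \<in> diff_ops A k"
    \<comment> \<open>An operator of order 0 commutes with multiplications, so the term vanishes.
      Otherwise the commutator has smaller order and the induction on m + n applies.\<close>
    proof (cases n)
      case 0
      have "F (G (f * g) - f * G g) = 0" if "g \<in> C" for g
        using Suc.prems(2) 0 f that linear_op_0[OF lin(1)] by auto
      then show ?thesis using diff_ops_0 by (subst diff_ops_cong[where G="\<lambda>f. 0"])
    next
      case (Suc n')
      then show ?thesis using Suc.hyps(1)[of m n' F "\<lambda>g. G (f * g) - f * G g"] Suc.prems \<open>Suc k = m + n\<close> f by simp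
    qed
    have 2: "(\<lambda>g. F (f * G g) - f * F (G g)) \<in> diff_ops A k"
    proof (cases m)
      case 0
      have "F (f * G g) - f * F (G g) = 0" if "g \<in> C" for g
        using Suc.prems(1) 0 f that linear_opD(1)[OF lin(2)] by auto
      then show ?thesis using diff_ops_0 by (subst diff_ops_cong[where G="\<lambda>f. 0"])
    next
      case (Suc m')
      then show ?thesis using Suc.hyps(1)[of m' n "\<lambda>g. F (f * g) - f * F g" G] Suc.prems \<open>Suc k = m + n\<close> f by simp
    qed
    show ?thesis
      by (subst diff_ops_cong[OF _, where G="\<lambda>g. F (G (f * g) - f * G g) + (F (f * G g) - f * F (G g))"])
        (use diff_ops_add[OF 1 2] f lin in \<open>auto simp: linear_op_diff linear_opD(1) C_mult\<close>)
  qed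
  then show ?case using linear_op_comp[OF lin] \<open>Suc k = m + n\<close>[symmetric] by simp
qed

declare plus_fun_apply [simp] times_fun_apply [simp] minus_apply [simp] uminus_apply [simp]

section \<open>Locality and smooth dependence of differential operators\<close>

text \<open>Coordinates are not functions on the whole manifold. Multiplied by a cutoff they are,
  and commutators with them can be formed.\<close>

lemma bump_function:
  assumes d: "d \<in> A" and "0 < r" "cball y R \<subseteq> snd d ` fst d" "r < R"
  obtains \<eta> :: "'e \<Rightarrow> real" where "smooth_on UNIV \<eta>" "\<And>z. z \<in> ball y r \<Longrightarrow> \<eta> z = 1" "\<And>z. z \<notin> cball y R \<Longrightarrow> \<eta> z = 0"
    "\<And>f. smooth_on UNIV f \<Longrightarrow> (\<lambda>q. if q \<in> fst d then of_real (\<eta> (snd d q) * f (snd d q)) else 0) \<in> C"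
proof -
  obtain \<eta> :: "'e \<Rightarrow> real" where \<eta>: "smooth_on UNIV \<eta>" "\<And>z. z \<in> ball y r \<Longrightarrow> \<eta> z = 1" "\<And>z. z \<notin> ball y R \<Longrightarrow> \<eta> z = 0"
    using smooth_bump[OF assms(2,4), of y] by metis
  have "(\<lambda>q. if q \<in> fst d then of_real (\<eta> (snd d q) * f (snd d q)) else 0) \<in> C" if "smooth_on UNIV f" for f
  proof -
    have "smooth_on UNIV (\<lambda>y. complex_of_real (\<eta> y * f y))" by (intro smooth_intros \<eta> that open_UNIV)
    from smooth_fun_extend[OF d compact_cball assms(3) smooth_on_subset[OF this subset_UNIV]] \<eta>(3)
    show ?thesis by (simp add: smooth_functions_def)
  qed
  then show ?thesis using \<eta> by (intro that[of \<eta>]) auto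
qed

text \<open>Choose u with u(p) = 0 and u f = f, namely 1 minus a cutoff supported in U. Then F f =
  F(u f) agrees at p with the commutator [F, u] applied to f, which has lower order.\<close>

lemma diff_ops_local:
  assumes F: "F \<in> diff_ops A n" and f: "f \<in> C" and U: "open U" "p \<in> U" "\<And>q. q \<in> U \<Longrightarrow> f q = 0"
  shows "F f p = 0"
proof -
  obtain d where d: "d \<in> A" "p \<in> fst d" using cover by blast
  have o: "open (snd d ` (fst d \<inter> U))" by (rule open_image_chart[OF d(1) U(1)])
  then obtain R where R: "R > 0" "cball (snd d p) R \<subseteq> snd d ` (fst d \<inter> U)"
    using open_contains_cball d U(2) by blast
  have sub: "cball (snd d p) R \<subseteq> snd d ` fst d" using R(2) by blast
  have R2: "0 < R / 2" "R / 2 < R" using R(1) by auto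
  obtain \<eta> :: "'e \<Rightarrow> real" where "smooth_on UNIV \<eta>"
    "\<And>z. z \<in> ball (snd d p) (R/2) \<Longrightarrow> \<eta> z = 1" "\<And>z. z \<notin> cball (snd d p) R \<Longrightarrow> \<eta> z = 0"
    "\<And>f. smooth_on UNIV f \<Longrightarrow> (\<lambda>q. if q \<in> fst d then of_real (\<eta> (snd d q) * f (snd d q)) else 0) \<in> C"
    by (rule bump_function[OF d(1) R2(1) sub R2(2)]) blast
  note \<eta> = this(2-)
  define u :: "'p \<Rightarrow> complex" where "u = 1 - (\<lambda>q. if q \<in> fst d then of_real (\<eta> (snd d q) * 1) else 0)"
  have u: "u \<in> C" unfolding u_def by (intro C_diff C_1 \<eta>(3) smooth_on_const)
  have "u p = 0" using \<eta>(1)[of "snd d p"] R d by (simp add: u_def)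
  have uf: "u * f = f"
  proof
    fix q
    show "(u * f) q = f q"
    proof (cases "q \<in> U")
      case False
      have "\<eta> (snd d q) = 0" if "q \<in> fst d"
      proof (rule \<eta>(2))
        show "snd d q \<notin> cball (snd d p) R"
        proof
          assume "snd d q \<in> cball (snd d p) R"
          then obtain q' where "q' \<in> fst d" "q' \<in> U" "snd d q = snd d q'" using R(2) by blast
          then have "q = q'" using inv_chart[OF d(1)] that by metis
          then show False using False \<open>q' \<in> U\<close> by simp
        qed
      qed
      then show ?thesis by (simp add: u_def)
    qed (simp add: U(3))
  qed
  show ?thesis using F
  proof (induction n arbitrary: F)
    case 0
    then have "F (u * f) p = (u * F f) p" using u f by simp
    then show ?case unfolding uf by (simp add: \<open>u p = 0\<close>)
  next
    case (Suc n)
    then have "(\<lambda>g. F (u * g) - u * F g) \<in> diff_ops A n" using u by simp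
    from Suc.IH[OF this] show ?case using \<open>u p = 0\<close> by (simp add: uf)
  qed
qed

lemma psmooth_commutator:
  assumes "open Z" "\<And>f. f \<in> C \<Longrightarrow> psmooth Z (\<lambda>z. F z f)" "u \<in> C" "g \<in> C"
  shows "psmooth Z (\<lambda>z. F z (u * g) - u * F z g)"
  using psmooth_diff[OF assms(2)[OF C_mult[OF assms(3,4)]] psmooth_mult[OF psmooth_fun[OF assms(1,3)] assms(2)[OF assms(4)]]]
  by (simp add: fun_diff_def times_fun_def)

lemma sum_fun_apply: "(\<Sum>i\<in>I. f i) x = (\<Sum>i\<in>I. f i x)"
  by (induction I rule: infinite_finite_induct) auto

text \<open>In a chart, Hadamard's lemma writes a function as its value at \<open>x\<close> plus a combination of
  products \<open>(Y\<^sub>b - Y\<^sub>b(x)) r\<^sub>b\<close>; at \<open>x\<close> the operator \<open>F\<close> acts on such a product as the commutator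
  \<open>[F, Y\<^sub>b]\<close>, which has lower order.  The remainders \<open>r\<^sub>b\<close> depend on \<open>x\<close>, so the induction
  needs functions \<open>s\<close> that depend on the coordinates of the point of evaluation.\<close>

lemma psmooth_diff_op_chart:
  fixes F :: "'z::euclidean_space \<Rightarrow> ('p \<Rightarrow> complex) \<Rightarrow> 'p \<Rightarrow> complex"
  assumes Z: "open Z" and d: "d \<in> A"
  shows "(\<And>z. z \<in> Z \<Longrightarrow> F z \<in> diff_ops A n) \<Longrightarrow> (\<And>f. f \<in> C \<Longrightarrow> psmooth Z (\<lambda>z. F z f)) \<Longrightarrow>
    open B \<Longrightarrow> B \<subseteq> snd d ` fst d \<Longrightarrow> psmooth (Z \<times> B) s \<Longrightarrow>
    smooth_on (Z \<times> B) (\<lambda>w. F (fst w) (s w) (chart_inv d (snd w)))"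
proof (induction n arbitrary: F s B)
  case (0 F s B)
  have ZB: "open (Z \<times> B)" using Z 0 by (intro open_Times)
  have "smooth_on (Z \<times> B) (\<lambda>w. (\<lambda>v. s (fst v) (chart_inv d (snd v))) (w, snd w))"
    by (rule smooth_on_compose[OF psmooth_chart[OF 0(5) d] open_Times_img[OF ZB d] ZB])
      (use 0(4) in \<open>auto intro!: smooth_intros ZB\<close>)
  moreover have "smooth_on (Z \<times> B) (\<lambda>w. F (fst w) 1 (chart_inv d (snd w)))"
    by (rule smooth_on_subset[OF psmooth_chart[OF 0(2)[OF C_1] d]]) (use 0(4) in auto)
  ultimately have "smooth_on (Z \<times> B) (\<lambda>w. s w (chart_inv d (snd w)) * F (fst w) 1 (chart_inv d (snd w)))"
    by (intro smooth_on_mult ZB) simp_all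
  moreover have "F (fst w) (s w) (chart_inv d (snd w)) = s w (chart_inv d (snd w)) * F (fst w) 1 (chart_inv d (snd w))"
    if "w \<in> Z \<times> B" for w
  proof -
    have "fst w \<in> Z" using that by auto
    then have "F (fst w) (s w * 1) = s w * F (fst w) 1"
      using 0(1) psmooth_slice[OF 0(5) that] C_1 unfolding diff_ops.simps by blast
    then have "F (fst w) (s w) = s w * F (fst w) 1" by (simp only: mult_1_right)
    then show ?thesis by simp
  qed
  ultimately show ?case by (subst smooth_on_cong[OF ZB])
next
  case (Suc n F s B)
  show ?case
  proof (rule smooth_on_localI)
    fix w0 assume "w0 \<in> Z \<times> B"
    then obtain z0 y0 where w0: "w0 = (z0, y0)" "z0 \<in> Z" "y0 \<in> B" by blast
    obtain R where R: "R > 0" "ball y0 R \<subseteq> B" using Suc.prems(3) w0(3) openE by blast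
    define BR where "BR = ball y0 R"
    \<comment> \<open>Three nested balls: radius R is convex and contains the segments of Hadamard's
      lemma, the cutoff is supported in radius R/2, and it is 1 on radius R/3, where the formula is
      to hold.\<close>
    define r where "r = R / 3"
    have r: "0 < r" "r < R / 2" "ball y0 r \<subseteq> BR" "cball y0 (R / 2) \<subseteq> BR" "BR \<subseteq> snd d ` fst d" "open BR"
      using R Suc.prems(4) by (auto simp: r_def BR_def)
    then have "cball y0 (R / 2) \<subseteq> snd d ` fst d" by blast
    then obtain \<eta> :: "'e \<Rightarrow> real" where \<eta>: "smooth_on UNIV \<eta>" "\<And>z. z \<in> ball y0 r \<Longrightarrow> \<eta> z = 1"
      "\<And>z. z \<notin> cball y0 (R/2) \<Longrightarrow> \<eta> z = 0"
      and \<eta>C: "\<And>f. smooth_on UNIV f \<Longrightarrow> (\<lambda>q. if q \<in> fst d then of_real (\<eta> (snd d q) * f (snd d q)) else 0) \<in> C"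
      by (rule bump_function[OF d r(1) _ r(2), of y0]) blast
    define Y :: "'e \<Rightarrow> 'p \<Rightarrow> complex"
      where "Y = (\<lambda>b q. if q \<in> fst d then of_real (\<eta> (snd d q) * (snd d q \<bullet> b)) else 0)"
    have Y: "Y b \<in> C" for b
      unfolding Y_def by (rule \<eta>C) (intro smooth_intros open_UNIV)
    let ?S = "\<lambda>v. s (fst v) (chart_inv d (snd v))"
    have ZR: "open (Z \<times> BR)" and Zr: "open (Z \<times> ball y0 r)" using Z r by (auto intro: open_Times)
    have sR: "psmooth (Z \<times> BR) s" by (rule psmooth_subset[OF Suc.prems(5) ZR]) (use R in \<open>auto simp: BR_def\<close>)
    have S: "smooth_on ((Z \<times> BR) \<times> snd d ` fst d) ?S" and So: "open ((Z \<times> BR) \<times> snd d ` fst d)"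
      by (rule psmooth_chart[OF sR d], rule open_Times_img[OF ZR d])
    \<comment> \<open>A point of W is (t, ((z, y), y')) with y the point of evaluation and y' the
      variable of the function. \<open>H b\<close> is the derivative of s along the segment from y
      to y', in direction b.\<close>
    define W where "W = (\<lambda>p :: real \<times> ('z \<times> 'e) \<times> 'e. (fst (snd p), snd (fst (snd p)) + fst p *\<^sub>R (snd (snd p) - snd (fst (snd p))))) -`
        ((Z \<times> BR) \<times> snd d ` fst d)"
    define H where "H = (\<lambda>b (p :: real \<times> ('z \<times> 'e) \<times> 'e).
        frechet_derivative ?S (at (fst (snd p), snd (fst (snd p)) + fst p *\<^sub>R (snd (snd p) - snd (fst (snd p))))) (0, b))"
    have W: "open W" unfolding W_def by (intro open_vimage So continuous_intros)
    have H: "smooth_on W (H b)" for b unfolding H_def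
      by (rule smooth_on_compose[OF smooth_on_frechet_derivative[OF S] So W])
        (auto simp: W_def[symmetric] intro!: smooth_intros W, auto simp: W_def)
    define \<rho> where "\<rho> = (\<lambda>b v. integral {0..1} (\<lambda>t. H b (t, v)))"
    have ZRR: "open ((Z \<times> BR) \<times> BR)" by (intro open_Times ZR r(6))
    have \<rho>: "smooth_on ((Z \<times> BR) \<times> BR) (\<rho> b)" for b
      unfolding \<rho>_def
    proof (rule smooth_on_integral[OF W H ZRR])
      fix t :: real and v assume t: "t \<in> {0..1}" and v: "v \<in> (Z \<times> BR) \<times> BR"
      have "snd (fst v) + t *\<^sub>R (snd v - snd (fst v)) \<in> BR"
        unfolding BR_def by (rule ball_segment) (use t v in \<open>auto simp: BR_def\<close>)
      then show "(t, v) \<in> W" using v r(5) by (auto simp: W_def)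
    qed
    define rb where "rb = (\<lambda>b w q. if q \<in> fst d then of_real (\<eta> (snd d q)) * \<rho> b (w, snd d q) else 0)"
    have rb: "psmooth (Z \<times> BR) (rb b)" for b
      unfolding rb_def
      by (rule psmooth_extend[OF d ZR r(6) r(5) compact_cball r(4) \<eta>(1) \<eta>(3) \<rho>])
    define G where "G = (\<lambda>b z g. F z (Y b * g) - Y b * F z g)"
    have G: "smooth_on (Z \<times> ball y0 r) (\<lambda>w. G b (fst w) (rb b w) (chart_inv d (snd w)))" for b
    proof (rule Suc.IH[of "G b" "ball y0 r" "rb b"])
      show "G b z \<in> diff_ops A n" if "z \<in> Z" for z using Suc.prems(1)[OF that] Y[of b] by (simp add: G_def)
      show "psmooth Z (\<lambda>z. G b z f)" if "f \<in> C" for f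
        unfolding G_def by (rule psmooth_commutator[OF Z Suc.prems(2) Y that])
      show "psmooth (Z \<times> ball y0 r) (rb b)" by (rule psmooth_subset[OF rb Zr]) (use r(3) in auto)
    qed (use r in auto)
    define g where "g = (\<lambda>w. s w (chart_inv d (snd w)) * F (fst w) 1 (chart_inv d (snd w)) +
      (\<Sum>b\<in>Basis. G b (fst w) (rb b w) (chart_inv d (snd w))))"
    have "smooth_on (Z \<times> ball y0 r) (\<lambda>w. ?S (w, snd w))"
      by (rule smooth_on_compose[OF S So Zr]) (use r(3,5) in \<open>auto intro!: smooth_intros Zr\<close>)
    moreover have "smooth_on (Z \<times> ball y0 r) (\<lambda>w. F (fst w) 1 (chart_inv d (snd w)))"
      by (rule smooth_on_subset[OF psmooth_chart[OF Suc.prems(2)[OF C_1] d]]) (use r(3,5) in auto)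
    ultimately have g: "smooth_on (Z \<times> ball y0 r) g" unfolding g_def
      by (intro smooth_on_add smooth_on_mult smooth_on_sum Zr G) simp_all
    have "F (fst w) (s w) (chart_inv d (snd w)) = g w" if w: "w \<in> Z \<times> ball y0 r" for w
    proof -
      obtain z y where zy: "w = (z, y)" "z \<in> Z" "y \<in> ball y0 r" using w by blast
      define x where "x = chart_inv d y"
      have yR: "y \<in> BR" using zy(3) r(3) by blast
      then have x: "x \<in> fst d" "snd d x = y" using r(5) d by (auto simp: x_def)
      have wR: "w \<in> Z \<times> BR" using zy yR by simp
      have F: "F z \<in> diff_ops A (Suc n)" and lin: "linear_op A (F z)"
        using Suc.prems(1)[OF zy(2)] diff_ops_linear by blast+
      define k :: "'p \<Rightarrow> complex" where "k = (\<lambda>q. s w x * 1 q)"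
      define a where "a = (\<lambda>b q. complex_of_real (y \<bullet> b) * rb b w q)"
      have rC: "rb b w \<in> C" for b by (rule psmooth_slice[OF rb wR])
      have aC: "a b \<in> C" for b unfolding a_def by (rule C_scale[OF rC])
      have kC: "k \<in> C" unfolding k_def by (rule C_scale[OF C_1])
      have sC: "s w \<in> C" by (rule psmooth_slice[OF sR wR])
      \<comment> \<open>The error of the Hadamard expansion. It need not vanish globally, but it
        does where the cutoff is 1, and by locality F cannot see it at x.\<close>
      define e where "e = s w - (k + (\<Sum>b\<in>Basis. Y b * rb b w - a b))"
      have eC: "e \<in> C" unfolding e_def by (intro C_diff C_add C_sum C_mult Y rC aC kC sC)
      have e0: "e q = 0" if q: "q \<in> {q \<in> fst d. snd d q \<in> ball y0 r}" for q
      proof -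
        define y' where "y' = snd d q"
        have q': "q \<in> fst d" "y' \<in> ball y0 r" "y' \<in> BR" "chart_inv d y' = q" using q r(3) d by (auto simp: y'_def)
        have seg: "y + t *\<^sub>R (y' - y) \<in> BR" if "t \<in> {0..1}" for t
          using ball_segment[OF _ _ that] yR q'(3) unfolding BR_def by blast
        have dS: "frechet_derivative (\<lambda>y. ?S (w, y)) (at v) b = frechet_derivative ?S (at (w, v)) (0, b)"
          if "v \<in> BR" for v b
          using frechet_derivative_eqI[OF has_derivative_slice_snd[OF smooth_on_has_derivative[OF S, of "(w, v)"]]]
            that wR r(5) by auto
        have "smooth_on BR (\<lambda>v. ?S (w, v))"
          by (rule smooth_on_compose[OF S So r(6)]) (use wR r(5) in \<open>auto intro!: smooth_intros r(6)\<close>)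
        from Hadamard_segment_Basis[OF r(6) this, of y "y' - y"] seg
        have "s w q - s w x = (\<Sum>b\<in>Basis. ((y' - y) \<bullet> b) *\<^sub>R
            integral {0..1} (\<lambda>t. frechet_derivative (\<lambda>y. ?S (w, y)) (at (y + t *\<^sub>R (y' - y))) b))"
          by (simp add: q' x_def)
        also have "\<dots> = (\<Sum>b\<in>Basis. ((y' - y) \<bullet> b) *\<^sub>R \<rho> b (w, y'))"
        proof (intro sum.cong refl arg_cong2[where f=scaleR])
          fix b :: 'e
          show "integral {0..1} (\<lambda>t. frechet_derivative (\<lambda>y. ?S (w, y)) (at (y + t *\<^sub>R (y' - y))) b) = \<rho> b (w, y')"
            unfolding \<rho>_def
          proof (rule integral_cong)
            fix t :: real assume "t \<in> {0..1}"
            from dS[OF seg[OF this]]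
            show "frechet_derivative (\<lambda>y. ?S (w, y)) (at (y + t *\<^sub>R (y' - y))) b = H b (t, w, y')"
              by (simp add: H_def zy(1))
          qed
        qed
        also have "\<dots> = (\<Sum>b\<in>Basis. Y b q * rb b w q - a b q)"
          using q' \<eta>(2)[OF q'(2)]
          by (intro sum.cong) (simp_all add: Y_def rb_def a_def y'_def scaleR_conv_of_real algebra_simps inner_diff_left)
        finally show ?thesis by (simp add: e_def k_def sum_fun_apply diff_eq_eq add.commute)
      qed
      have "open {q \<in> fst d. snd d q \<in> ball y0 r}" by (rule open_chart_preimage[OF d]) simp
      from diff_ops_local[OF F eC this _ e0, of x] have Fe: "F z e x = 0" using x zy(3) by simp
      have e1: "s w = e + (k + (\<Sum>b\<in>Basis. Y b * rb b w - a b))" by (simp add: e_def)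
      have "F z (s w) = F z e + (F z k + (\<Sum>b\<in>Basis. F z (Y b * rb b w) - F z (a b)))"
        using linear_op_sum[OF lin, of Basis "\<lambda>b. Y b * rb b w - a b"]
        by (subst e1) (simp add: linear_opD(2)[OF lin] linear_op_diff[OF lin] C_diff C_add C_sum C_mult Y rC aC kC eC)
      then have "F z (s w) x = F z k x + (\<Sum>b\<in>Basis. F z (Y b * rb b w) x - F z (a b) x)"
        by (simp add: Fe sum_fun_apply)
      moreover have "F z k x = s w x * F z 1 x" unfolding k_def linear_opD(3)[OF lin C_1] ..
      moreover have "F z (a b) x = Y b x * F z (rb b w) x" for b
        unfolding a_def linear_opD(3)[OF lin rC] using x \<eta>(2)[OF zy(3)] by (simp add: Y_def)
      ultimately show ?thesis
        by (simp add: g_def G_def zy(1) x_def)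
    qed
    then show "\<exists>U g. open U \<and> w0 \<in> U \<and> smooth_on U g \<and> (\<forall>w\<in>U. F (fst w) (s w) (chart_inv d (snd w)) = g w)"
      using g Zr w0 r(1) by (intro exI[of _ "Z \<times> ball y0 r"] exI[of _ g]) auto
  qed
qed

text \<open>Families of operators are smooth by definition when they are so on fixed functions.
  Composing and differentiating them needs arguments that vary with the same parameter.\<close>

lemma psmooth_diff_op:
  fixes F :: "'z::euclidean_space \<Rightarrow> ('p \<Rightarrow> complex) \<Rightarrow> 'p \<Rightarrow> complex"
  assumes "\<And>z. z \<in> Z \<Longrightarrow> F z \<in> diff_ops A n" "\<And>f. f \<in> C \<Longrightarrow> psmooth Z (\<lambda>z. F z f)" "psmooth Z s"
  shows "psmooth Z (\<lambda>z. F z (s z))"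
  unfolding psmooth_def
proof (intro conjI ballI psmooth_open[OF assms(3)])
  fix d assume d: "d \<in> A"
  note Z = psmooth_open[OF assms(3)]
  have "psmooth (Z \<times> snd d ` fst d) (\<lambda>w. s (fst w))"
    by (rule psmooth_compose[OF assms(3) open_Times_img[OF Z d]]) (auto intro!: smooth_intros open_Times_img[OF Z d])
  from psmooth_diff_op_chart[OF Z d assms(1,2) open_img[OF d] order_refl this]
  show "smooth_on (Z \<times> snd d ` fst d) (\<lambda>w. F (fst w) (s (fst w)) (chart_inv d (snd w)))" .
qed

text \<open>Hadamard's lemma in the parameter writes s(z) as s(z0) plus scalars (z - z0)_b times
  remainders r_b(z). The scalars pass through F(z) and vanish at z0, so of the families F(z)(r_b(z))
  only differentiability and the value at z0 matter. This replaces a limit in a function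
  space.\<close>

lemma has_derivative_diff_op:
  fixes F :: "'z::euclidean_space \<Rightarrow> ('p \<Rightarrow> complex) \<Rightarrow> 'p \<Rightarrow> complex"
  assumes F: "\<And>z. z \<in> Z \<Longrightarrow> F z \<in> diff_ops A n" "\<And>f. f \<in> C \<Longrightarrow> psmooth Z (\<lambda>z. F z f)" and s: "psmooth Z s"
    and z0: "z0 \<in> Z"
  shows "((\<lambda>z. F z (s z) x) has_derivative (\<lambda>v. frechet_derivative (\<lambda>z. F z (s z0) x) (at z0) v +
      F z0 (\<lambda>q. frechet_derivative (\<lambda>z. s z q) (at z0) v) x)) (at z0)"
proof -
  note Z = psmooth_open[OF s]
  obtain R where R: "R > 0" "ball z0 R \<subseteq> Z" using Z z0 openE by blast
  define B where "B = ball z0 R"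
  have B: "open B" "z0 \<in> B" "B \<subseteq> Z" using R by (auto simp: B_def)
  define W where "W = (\<lambda>p :: real \<times> 'z. z0 + fst p *\<^sub>R (snd p - z0)) -` B"
  have W: "open W" unfolding W_def by (intro open_vimage B continuous_intros)
  have seg: "z0 + t *\<^sub>R (z - z0) \<in> B" if "t \<in> {0..1}" "z \<in> B" for t z
    using ball_segment[OF _ _ that(1)] that(2) B(2) unfolding B_def by blast
  define r where "r = (\<lambda>b z q. integral {0..1} (\<lambda>t. frechet_derivative (\<lambda>z. s z q) (at (z0 + t *\<^sub>R (z - z0))) b))"
  have r: "psmooth B (r b)" for b
  proof -
    have "psmooth W (\<lambda>p q. frechet_derivative (\<lambda>z. s z q) (at (z0 + fst p *\<^sub>R (snd p - z0))) b)"
      by (rule psmooth_compose[OF psmooth_deriv[OF s] W]) (use B(3) in \<open>auto intro!: smooth_intros W simp: W_def[symmetric]\<close>, auto simp: W_def)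
    from psmooth_integral[OF this B(1)] seg show ?thesis unfolding r_def by (auto simp: W_def)
  qed
  have Fr: "psmooth B (\<lambda>z. F z (r b z))" for b
    by (rule psmooth_diff_op[OF F(1) psmooth_subset[OF F(2) B(1,3)] r]) (use B(3) in auto)
  have sC: "s z0 \<in> C" by (rule psmooth_slice[OF s z0])
  have rC: "r b z \<in> C" if "z \<in> B" for b z by (rule psmooth_slice[OF r that])
  have eq: "F z (s z) x = F z (s z0) x + (\<Sum>b\<in>Basis. complex_of_real ((z - z0) \<bullet> b) * F z (r b z) x)" if z: "z \<in> B" for z
  proof -
    have lin: "linear_op A (F z)" using F(1) z B(3) diff_ops_linear by blast
    have "s z q = s z0 q + (\<Sum>b\<in>Basis. complex_of_real ((z - z0) \<bullet> b) * r b z q)" for q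
      using Hadamard_segment_Basis[OF B(1) smooth_on_subset[OF psmooth_at_point[OF s] B(3)], of z0 "z - z0" q] seg z
      by (simp add: r_def scaleR_conv_of_real algebra_simps)
    then have "s z = s z0 + (\<Sum>b\<in>Basis. (\<lambda>q. complex_of_real ((z - z0) \<bullet> b) * r b z q))"
      by (intro ext) (simp add: sum_fun_apply)
    then have "F z (s z) = F z (s z0) + (\<Sum>b\<in>Basis. F z (\<lambda>q. complex_of_real ((z - z0) \<bullet> b) * r b z q))"
      using linear_op_sum[OF lin, of Basis "\<lambda>b q. complex_of_real ((z - z0) \<bullet> b) * r b z q"]
      by (simp add: linear_opD(2)[OF lin] sC C_sum C_scale[OF rC[OF z]])
    then show ?thesis by (simp add: linear_opD(3)[OF lin rC[OF z]] sum_fun_apply)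
  qed
  have lin: "linear_op A (F z0)" using F(1) z0 diff_ops_linear by blast
  have r0: "r b z0 q = frechet_derivative (\<lambda>z. s z q) (at z0) b" for b q by (simp add: r_def)
  have "((\<lambda>z. F z (s z0) x + (\<Sum>b\<in>Basis. complex_of_real ((z - z0) \<bullet> b) * F z (r b z) x)) has_derivative
      (\<lambda>v. frechet_derivative (\<lambda>z. F z (s z0) x) (at z0) v + (\<Sum>b\<in>Basis. complex_of_real (v \<bullet> b) * F z0 (r b z0) x))) (at z0)"
  proof (intro has_derivative_add has_derivative_sum psmooth_has_derivative[OF F(2)[OF sC] z0])
    fix b :: 'z assume "b \<in> Basis"
    have "((\<lambda>z. complex_of_real ((z - z0) \<bullet> b)) has_derivative (\<lambda>v. complex_of_real (v \<bullet> b))) (at z0)"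
      by (auto intro!: derivative_eq_intros)
    from has_derivative_mult[OF this psmooth_has_derivative[OF Fr B(2)]]
    show "((\<lambda>z. complex_of_real ((z - z0) \<bullet> b) * F z (r b z) x) has_derivative
        (\<lambda>v. complex_of_real (v \<bullet> b) * F z0 (r b z0) x)) (at z0)" by simp
  qed
  moreover have "(\<Sum>b\<in>Basis. complex_of_real (v \<bullet> b) * F z0 (r b z0) x) =
      F z0 (\<lambda>q. frechet_derivative (\<lambda>z. s z q) (at z0) v) x" for v
  proof -
    have "frechet_derivative (\<lambda>z. s z q) (at z0) v = (\<Sum>b\<in>Basis. complex_of_real (v \<bullet> b) * r b z0 q)" for q
      unfolding r0 using linear_euclidean_expand[OF has_derivative_linear[OF psmooth_has_derivative[OF s z0, of q]], of v]
      by (simp add: scaleR_conv_of_real)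
    then have "(\<lambda>q. frechet_derivative (\<lambda>z. s z q) (at z0) v) = (\<Sum>b\<in>Basis. (\<lambda>q. complex_of_real (v \<bullet> b) * r b z0 q))"
      by (intro ext) (simp add: sum_fun_apply)
    then show ?thesis
      by (simp add: linear_op_sum[OF lin] C_scale rC[OF B(2)] linear_opD(3)[OF lin rC[OF B(2)]] sum_fun_apply)
  qed
  ultimately show ?thesis
    by (intro has_derivative_transform_within_open[OF _ B(1,2) eq[symmetric]]) simp_all
qed

end

section \<open>Families of operators over the parameter manifold\<close>

context mfd_pair
begin

abbreviation C where "C \<equiv> smooth_functions M"

text \<open>Joint smoothness, the condition imposed on each coefficient of a smooth section.\<close>

definition js :: "('t \<Rightarrow> 'p \<Rightarrow> complex) \<Rightarrow> bool"
  where "js s \<longleftrightarrow> smooth_fun (prod_atlas T M) UNIV (\<lambda>(\<sigma>, x). s \<sigma> x)"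

lemma js_iff: "js s \<longleftrightarrow> (\<forall>c\<in>T. M.psmooth (snd c ` fst c) (\<lambda>z. s (chart_inv c z)))"
  using smooth_fun_prod_iff[of UNIV s] by (simp add: js_def)

lemma js_chart: "js s \<Longrightarrow> c \<in> T \<Longrightarrow> M.psmooth (snd c ` fst c) (\<lambda>z. s (chart_inv c z))"
  by (simp add: js_iff)

lemma js_slice: "js s \<Longrightarrow> s \<sigma> \<in> C"
proof -
  assume s: "js s"
  obtain c where c: "c \<in> T" "\<sigma> \<in> fst c" using T.cover by blast
  from M.psmooth_slice[OF js_chart[OF s c(1)], of "snd c \<sigma>"] c show ?thesis by simp
qed

lemma js_point: "js s \<Longrightarrow> smooth_fun T UNIV (\<lambda>\<sigma>. s \<sigma> x)"
  using M.psmooth_at_point[OF js_chart] by (simp add: smooth_fun_def o_def)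

lemma js_const: "f \<in> C \<Longrightarrow> js (\<lambda>\<sigma>. f)"
  unfolding js_iff using M.psmooth_fun[OF T.open_img] by blast

lemma js_add: "js s \<Longrightarrow> js t \<Longrightarrow> js (\<lambda>\<sigma>. s \<sigma> + t \<sigma>)"
  unfolding js_iff plus_fun_def using M.psmooth_add by fast

lemma js_diff: "js s \<Longrightarrow> js t \<Longrightarrow> js (\<lambda>\<sigma>. s \<sigma> - t \<sigma>)"
  unfolding js_iff fun_diff_def using M.psmooth_diff by fast

lemma js_sum: "(\<And>i. i \<in> I \<Longrightarrow> js (s i)) \<Longrightarrow> js (\<lambda>\<sigma>. \<Sum>i\<in>I. s i \<sigma>)"
  by (induction I rule: infinite_finite_induct) (simp_all add: js_const M.C_0 js_add)

abbreviation pd :: "('t \<Rightarrow> 'p \<Rightarrow> complex) \<Rightarrow> 't \<Rightarrow> 'b \<Rightarrow> 'p \<Rightarrow> complex"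
  where "pd s \<sigma> v \<equiv> \<lambda>x. mderiv T (\<lambda>\<tau>. s \<tau> x) \<sigma> v"

lemma pd_coord:
  assumes "js s" "c \<in> T" "\<sigma> \<in> fst c"
  shows "pd s \<sigma> (coord_vec T c \<sigma> w) x = frechet_derivative (\<lambda>z. s (chart_inv c z) x) (at (snd c \<sigma>)) w"
  using T.mderiv_coord_vec[OF assms(2,3) T.smooth_fun_differentiable[OF js_point[OF assms(1)] _ assms(2,3)]]
  by (simp add: o_def)

lemma pd_vf:
  assumes "js s" "c \<in> T" "z \<in> snd c ` fst c"
  shows "pd s (chart_inv c z) (V (chart_inv c z)) x = frechet_derivative (\<lambda>z. s (chart_inv c z) x) (at z) (T.vf_comp c V z)"
proof -
  obtain q where q: "q \<in> fst c" "z = snd c q" using assms(3) by blast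
  show ?thesis using pd_coord[OF assms(1,2) q(1), where w="T.vf_comp c V z"] q assms(2) by simp
qed

lemma js_pd:
  assumes s: "js s" and V: "V \<in> vector_fields T"
  shows "js (\<lambda>\<sigma>. pd s \<sigma> (V \<sigma>))"
  unfolding js_iff
proof
  fix c assume c: "c \<in> T"
  let ?Z = "snd c ` fst c"
  note p = js_chart[OF s c]
  have V: "smooth_on ?Z (T.vf_comp c V)" using V c T.vector_fields_iff by blast
  have Z: "open ?Z" by (rule T.open_img[OF c])
  have "M.psmooth ?Z (\<lambda>z x. \<Sum>b\<in>Basis. complex_of_real (T.vf_comp c V z \<bullet> b) *
      frechet_derivative (\<lambda>z. s (chart_inv c z) x) (at z) b)"
    by (intro M.psmooth_sum M.psmooth_mult Z M.psmooth_deriv p M.psmooth_param smooth_intros V)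
  then show "M.psmooth ?Z (\<lambda>z. pd s (chart_inv c z) (V (chart_inv c z)))"
  proof (rule M.psmooth_cong[THEN iffD2, rotated])
    fix z x assume z: "z \<in> ?Z"
    show "pd s (chart_inv c z) (V (chart_inv c z)) x = (\<Sum>b\<in>Basis. complex_of_real (T.vf_comp c V z \<bullet> b) *
      frechet_derivative (\<lambda>z. s (chart_inv c z) x) (at z) b)"
      unfolding pd_vf[OF s c z]
      using linear_euclidean_expand[OF has_derivative_linear[OF M.psmooth_has_derivative[OF p z, of x]], of "T.vf_comp c V z"]
      by (simp only: scaleR_conv_of_real)
  qed
qed

text \<open>The vector v is extended to a vector field, along which the derivative of s is jointly
  smooth.\<close>

lemma pd_C:
  assumes "js s"
  shows "pd s \<sigma> v \<in> C"
proof -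
  obtain V where V: "V \<in> vector_fields T" "V \<sigma> = v" using T.vector_field_through by blast
  from js_slice[OF js_pd[OF assms V(1)], of \<sigma>] V(2) show ?thesis by simp
qed

text \<open>One order bound n for all \<sigma>, stronger than the local bound in
  \<open>smooth_diff_ops\<close>. It can be had because the coefficient of \<open>h^k\<close> is to
  have order at most k everywhere.\<close>

definition smooth_op :: "nat \<Rightarrow> ('t \<Rightarrow> ('p \<Rightarrow> complex) \<Rightarrow> 'p \<Rightarrow> complex) \<Rightarrow> bool"
  where "smooth_op n F \<longleftrightarrow> (\<forall>\<sigma>. F \<sigma> \<in> diff_ops M n) \<and> (\<forall>f\<in>C. js (\<lambda>\<sigma>. F \<sigma> f))"

lemma smooth_op_linear: "smooth_op n F \<Longrightarrow> linear_op M (F \<sigma>)"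
  using M.diff_ops_linear by (auto simp: smooth_op_def)

lemma smooth_op_smooth_diff_ops: "smooth_op n F \<Longrightarrow> smooth_diff_ops T M UNIV F"
  unfolding smooth_op_def smooth_diff_ops_def js_def by (auto intro!: exI[of _ UNIV])

lemma js_smooth_op:
  assumes F: "smooth_op n F" and s: "js s"
  shows "js (\<lambda>\<sigma>. F \<sigma> (s \<sigma>))"
  unfolding js_iff
proof
  fix c assume c: "c \<in> T"
  show "M.psmooth (snd c ` fst c) (\<lambda>z. F (chart_inv c z) (s (chart_inv c z)))"
  proof (rule M.psmooth_diff_op[where n=n, OF _ _ js_chart[OF s c]])
    show "M.psmooth (snd c ` fst c) (\<lambda>z. F (chart_inv c z) f)" if "f \<in> C" for f
      using F js_chart[of "\<lambda>\<sigma>. F \<sigma> f", OF _ c] that by (simp add: smooth_op_def)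
  qed (use F in \<open>simp add: smooth_op_def\<close>)
qed

lemma pd_smooth_op:
  assumes F: "smooth_op n F" and s: "js s"
  shows "pd (\<lambda>\<tau>. F \<tau> (s \<tau>)) \<sigma> v = pd (\<lambda>\<tau>. F \<tau> (s \<sigma>)) \<sigma> v + F \<sigma> (pd s \<sigma> v)"
proof
  fix x
  define c where "c = chart_at T \<sigma>"
  have c: "c \<in> T" "\<sigma> \<in> fst c" by (simp_all add: c_def T.chart_at)
  have "((\<lambda>z. F (chart_inv c z) (s (chart_inv c z)) x) has_derivative
      (\<lambda>v. frechet_derivative (\<lambda>z. F (chart_inv c z) (s (chart_inv c (snd c \<sigma>))) x) (at (snd c \<sigma>)) v +
      F (chart_inv c (snd c \<sigma>)) (\<lambda>q. frechet_derivative (\<lambda>z. s (chart_inv c z) q) (at (snd c \<sigma>)) v) x)) (at (snd c \<sigma>))"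
  proof (rule M.has_derivative_diff_op[where n=n, OF _ _ js_chart[OF s c(1)]])
    show "M.psmooth (snd c ` fst c) (\<lambda>z. F (chart_inv c z) f)" if "f \<in> C" for f
      using F js_chart[of "\<lambda>\<sigma>. F \<sigma> f", OF _ c(1)] that by (simp add: smooth_op_def)
  qed (use F c in \<open>simp_all add: smooth_op_def\<close>)
  then show "pd (\<lambda>\<tau>. F \<tau> (s \<tau>)) \<sigma> v x = (pd (\<lambda>\<tau>. F \<tau> (s \<sigma>)) \<sigma> v + F \<sigma> (pd s \<sigma> v)) x"
    using c unfolding mderiv_def c_def[symmetric] by (simp add: frechet_derivative_eqI o_def)
qed

lemma diff_op_one_form_linear:
  "diff_op_one_form T M B \<Longrightarrow> f \<in> C \<Longrightarrow> linear (\<lambda>v. B \<sigma> v f x)"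
  by (simp add: diff_op_one_form_def)

text \<open>Smoothness of B is given on coordinate fields; V is expanded in them with smooth
  coefficients, using linearity in the tangent vector.\<close>

lemma smooth_op_one_form:
  assumes B: "diff_op_one_form T M B" "\<And>\<sigma> v. B \<sigma> v \<in> diff_ops M n" and V: "V \<in> vector_fields T"
  shows "smooth_op n (\<lambda>\<sigma>. B \<sigma> (V \<sigma>))"
  unfolding smooth_op_def js_iff
proof (intro conjI allI ballI B(2))
  fix f c assume f: "f \<in> C" and c: "c \<in> T"
  let ?Z = "snd c ` fst c"
  have V: "smooth_on ?Z (T.vf_comp c V)" using V c T.vector_fields_iff by blast
  have Z: "open ?Z" by (rule T.open_img[OF c])
  have "M.psmooth ?Z (\<lambda>z. B (chart_inv c z) (coord_vec T c (chart_inv c z) b) f)" for b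
  proof -
    have "smooth_diff_ops T M (fst c) (\<lambda>\<sigma>. B \<sigma> (coord_vec T c \<sigma> b))"
      using B(1) c unfolding diff_op_one_form_def by blast
    then have "smooth_fun (prod_atlas T M) (fst c \<times> UNIV) (\<lambda>(\<sigma>, x). B \<sigma> (coord_vec T c \<sigma> b) f x)"
      using f by (simp add: smooth_diff_ops_def)
    then have "\<forall>c'\<in>T. M.psmooth (snd c' ` (fst c' \<inter> fst c))
        (\<lambda>z. B (chart_inv c' z) (coord_vec T c (chart_inv c' z) b) f)"
      unfolding smooth_fun_prod_iff by (rule conjunct2)
    from bspec[OF this c] show ?thesis by simp
  qed
  then have "M.psmooth ?Z (\<lambda>z x. \<Sum>b\<in>Basis. complex_of_real (T.vf_comp c V z \<bullet> b) *
      B (chart_inv c z) (coord_vec T c (chart_inv c z) b) f x)"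
    by (intro M.psmooth_sum M.psmooth_mult Z M.psmooth_param smooth_intros V)
  then show "M.psmooth ?Z (\<lambda>z. B (chart_inv c z) (V (chart_inv c z)) f)"
  proof (rule M.psmooth_cong[THEN iffD2, rotated])
    fix z x assume z: "z \<in> ?Z"
    obtain q where q: "q \<in> fst c" "z = snd c q" using z by blast
    have "linear (\<lambda>w. B q (coord_vec T c q w) f x)"
      using linear_compose[OF T.linear_coord_vec[OF c q(1)] diff_op_one_form_linear[OF B(1) f]] by (simp add: o_def)
    from linear_euclidean_expand[OF this, of "T.vf_comp c V z"]
    show "B (chart_inv c z) (V (chart_inv c z)) f x = (\<Sum>b\<in>Basis. complex_of_real (T.vf_comp c V z \<bullet> b) *
      B (chart_inv c z) (coord_vec T c (chart_inv c z) b) f x)"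
      using q c by (simp add: scaleR_conv_of_real)
  qed
qed

section \<open>Regularity of families recovered from their derivatives\<close>

text \<open>Primitives obtained for each x separately have no known dependence on x. In a coordinate
  ball, h is its value at one point plus an integral of its jointly smooth derivative along a
  segment. So if one value in the ball lies in C, the family is jointly smooth over the ball, and
  membership in C spreads from the base points over their components.\<close>

lemma js_of_pd:
  assumes h: "\<And>x. smooth_fun T UNIV (\<lambda>\<sigma>. h \<sigma> x)"
    and d: "\<And>V. V \<in> vector_fields T \<Longrightarrow> js (\<lambda>\<sigma>. pd h \<sigma> (V \<sigma>))"
    and base: "\<And>\<sigma>. h (T.base \<sigma>) \<in> C"
  shows "js h"
proof -
  have sm: "smooth_on (snd c ` fst c) (\<lambda>z. h (chart_inv c z) x)" if "c \<in> T" for c x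
    using h[of x] that unfolding smooth_fun_def by (simp add: o_def)
  define k where "k = (\<lambda>(c :: ('t, 'b) chart) b z x. frechet_derivative (\<lambda>z. h (chart_inv c z) x) (at z) b)"
  have k: "M.psmooth (snd c ` fst c) (k c b)" if c: "c \<in> T" for c b
  proof (rule M.psmooth_local[OF T.open_img[OF c]])
    fix z assume "z \<in> snd c ` fst c"
    then obtain q where q: "q \<in> fst c" "z = snd c q" by blast
    from T.local_coordinate_field[OF c q(1)] obtain N V where N: "open N" "q \<in> N" "N \<subseteq> fst c"
      and V: "V \<in> vector_fields T" "\<And>p. p \<in> N \<Longrightarrow> V p = coord_vec T c p b" by blast
    have o: "open (snd c ` N)" by (rule T.open_image_chart_subset[OF c N(1,3)])
    have "M.psmooth (snd c ` N) (\<lambda>z. pd h (chart_inv c z) (V (chart_inv c z)))"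
      by (rule M.psmooth_subset[OF js_chart[OF d[OF V(1)] c] o]) (use N in blast)
    then have "M.psmooth (snd c ` N) (k c b)"
    proof (rule M.psmooth_cong[THEN iffD1, rotated])
      fix z' x assume "z' \<in> snd c ` N"
      then obtain p where p: "p \<in> N" "z' = snd c p" by blast
      have pc: "p \<in> fst c" using p N by blast
      show "pd h (chart_inv c z') (V (chart_inv c z')) x = k c b z' x"
        using T.mderiv_coord_vec[OF c pc T.smooth_fun_differentiable[OF h[of x] _ c pc], of b]
          pc p V(2)[OF p(1)] c by (simp add: k_def o_def)
    qed
    then show "\<exists>W. z \<in> W \<and> M.psmooth W (k c b)" using N q by blast
  qed
  have ball: "M.psmooth (ball z0 r) (\<lambda>z. h (chart_inv c z))"
    if c: "c \<in> T" and B: "ball z0 r \<subseteq> snd c ` fst c" and z1: "z1 \<in> ball z0 r" "h (chart_inv c z1) \<in> C" for c z0 r z1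
  proof -
    let ?B = "ball z0 r" and ?W = "(\<lambda>p :: real \<times> 'b. z1 + fst p *\<^sub>R (snd p - z1)) -` ball z0 r"
    have W: "open ?W" by (intro open_vimage open_ball continuous_intros)
    have seg: "z1 + t *\<^sub>R (z - z1) \<in> ?B" if "t \<in> {0..1}" "z \<in> ?B" for t z
      by (rule ball_segment[OF z1(1) that(2,1)])
    have "M.psmooth ?W (\<lambda>p. k c b (z1 + fst p *\<^sub>R (snd p - z1)))" for b
      by (rule M.psmooth_compose[OF k[OF c] W]) (use B in \<open>auto intro!: smooth_intros W\<close>)
    from M.psmooth_integral[OF this open_ball] seg
    have "M.psmooth ?B (\<lambda>z x. integral {0..1} (\<lambda>t. k c b (z1 + t *\<^sub>R (z - z1)) x))" for b by auto
    then have "M.psmooth ?B (\<lambda>z x. h (chart_inv c z1) x + (\<Sum>b\<in>Basis. complex_of_real ((z - z1) \<bullet> b) *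
        integral {0..1} (\<lambda>t. k c b (z1 + t *\<^sub>R (z - z1)) x)))"
      by (intro M.psmooth_add M.psmooth_sum M.psmooth_mult M.psmooth_param M.psmooth_fun z1 open_ball smooth_intros)
    then show ?thesis
    proof (rule M.psmooth_cong[THEN iffD2, rotated])
      fix z x assume z: "z \<in> ?B"
      from Hadamard_segment_Basis[OF open_ball smooth_on_subset[OF sm[OF c] B], of z1 "z - z1" x] seg z
      show "h (chart_inv c z) x = h (chart_inv c z1) x + (\<Sum>b\<in>Basis. complex_of_real ((z - z1) \<bullet> b) *
        integral {0..1} (\<lambda>t. k c b (z1 + t *\<^sub>R (z - z1)) x))"
        by (simp add: k_def scaleR_conv_of_real diff_eq_eq add.commute)
    qed
  qed
  \<comment> \<open>Membership in C passes between any two points of the neighbourhood, which makes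
    both the set of such points and its complement open.\<close>
  have nbhd: "\<exists>U. open U \<and> \<sigma> \<in> U \<and> (\<forall>\<tau>\<in>U. \<forall>\<tau>'\<in>U. h \<tau> \<in> C \<longrightarrow> h \<tau>' \<in> C)" for \<sigma>
  proof -
    obtain c where c: "c \<in> T" "\<sigma> \<in> fst c" using T.cover by blast
    obtain r where r: "r > 0" "ball (snd c \<sigma>) r \<subseteq> snd c ` fst c"
      using T.open_img[OF c(1)] c openE by blast
    define U where "U = {q \<in> fst c. snd c q \<in> ball (snd c \<sigma>) r}"
    have "h \<tau>' \<in> C" if "\<tau> \<in> U" "\<tau>' \<in> U" "h \<tau> \<in> C" for \<tau> \<tau>'
      using M.psmooth_slice[OF ball[OF c(1) r(2), of "snd c \<tau>"], of "snd c \<tau>'"] that c by (simp add: U_def)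
    moreover have "open U" "\<sigma> \<in> U" using c r by (auto simp: U_def T.open_chart_preimage simp del: mem_ball)
    ultimately show ?thesis by blast
  qed
  then obtain U where U: "\<And>\<sigma>. open (U \<sigma>)" "\<And>\<sigma>. \<sigma> \<in> U \<sigma>" "\<And>\<sigma> \<tau> \<tau>'. \<tau> \<in> U \<sigma> \<Longrightarrow> \<tau>' \<in> U \<sigma> \<Longrightarrow> h \<tau> \<in> C \<Longrightarrow> h \<tau>' \<in> C"
    by metis
  have "{\<sigma>. h \<sigma> \<in> C} = (\<Union>\<sigma>\<in>{\<sigma>. h \<sigma> \<in> C}. U \<sigma>)" "- {\<sigma>. h \<sigma> \<in> C} = (\<Union>\<sigma>\<in>- {\<sigma>. h \<sigma> \<in> C}. U \<sigma>)"
    using U(2,3) by blast+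
  then have "open {\<sigma>. h \<sigma> \<in> C}" "open (- {\<sigma>. h \<sigma> \<in> C})"
    using U(1) by (metis open_UN)+
  from clopen_connected_component[OF this _ T.base_component] base have hC: "h \<sigma> \<in> C" for \<sigma> by blast
  show ?thesis
    unfolding js_iff
  proof (intro ballI M.psmooth_local T.open_img)
    fix c z assume c: "c \<in> T" and z: "z \<in> snd c ` fst c"
    obtain r where "r > 0" "ball z r \<subseteq> snd c ` fst c" using T.open_img[OF c] z openE by blast
    then show "\<exists>W. z \<in> W \<and> M.psmooth W (\<lambda>z. h (chart_inv c z))"
      using ball[OF c _ _ hC, of z r z] by (intro exI[of _ "ball z r"]) simp
  qed
qed

text \<open>Differentiating in \<sigma> commutes with taking the commutator with a fixed f. The
  commutators of Q thus satisfy the same hypotheses with order n - 1, and additivity, homogeneity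
  and the order 0 condition become vanishing statements for functions on T.\<close>

lemma diff_ops_of_pd:
  assumes "\<And>f. f \<in> C \<Longrightarrow> js (\<lambda>\<sigma>. Q \<sigma> f)"
    and "\<And>\<sigma> v. (\<lambda>f. pd (\<lambda>\<tau>. Q \<tau> f) \<sigma> v) \<in> diff_ops M n"
    and "\<And>\<sigma> f. f \<in> C \<Longrightarrow> Q (T.base \<sigma>) f = 0"
  shows "Q \<sigma> \<in> diff_ops M n"
proof -
  have zero: "s \<sigma> = 0" if "js s" "\<And>\<sigma> v. pd s \<sigma> v = 0" "\<And>\<sigma>. s (T.base \<sigma>) = 0" for s \<sigma>
  proof
    fix x show "s \<sigma> x = 0 x"
      using T.eq_zero_of_mderiv[OF js_point[OF that(1)], of x \<sigma>] that(2,3) by (simp add: fun_eq_iff)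
  qed
  have lin: "linear_op M (Q \<sigma>)"
    if Q: "\<And>f. f \<in> C \<Longrightarrow> js (\<lambda>\<sigma>. Q \<sigma> f)"
      and d: "\<And>\<sigma> v. linear_op M (\<lambda>f. pd (\<lambda>\<tau>. Q \<tau> f) \<sigma> v)"
      and b: "\<And>\<sigma> f. f \<in> C \<Longrightarrow> Q (T.base \<sigma>) f = 0" for Q \<sigma>
    unfolding linear_op_def
  proof (intro conjI ballI allI)
    show "Q \<sigma> f \<in> C" if "f \<in> C" for f by (rule js_slice[OF Q[OF that]])
    fix f g assume f: "f \<in> C" and g: "g \<in> C"
    note Qfg = Q[OF M.C_add[OF f g]] Q[OF f] Q[OF g]
    have "Q \<sigma> (f + g) - (Q \<sigma> f + Q \<sigma> g) = 0"
    proof (rule zero[of "\<lambda>\<sigma>. Q \<sigma> (f + g) - (Q \<sigma> f + Q \<sigma> g)"])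
      show "js (\<lambda>\<sigma>. Q \<sigma> (f + g) - (Q \<sigma> f + Q \<sigma> g))" by (intro js_diff js_add Qfg)
      show "pd (\<lambda>\<sigma>. Q \<sigma> (f + g) - (Q \<sigma> f + Q \<sigma> g)) \<sigma> v = 0" for \<sigma> v
        using M.linear_opD(2)[OF d[of \<sigma> v] f g] T.smooth_fun_add[OF js_point[OF Qfg(2)] js_point[OF Qfg(3)]]
        by (simp add: fun_eq_iff T.mderiv_diff[OF js_point[OF Qfg(1)]] T.mderiv_add[OF js_point[OF Qfg(2)] js_point[OF Qfg(3)]])
      show "Q (T.base \<sigma>) (f + g) - (Q (T.base \<sigma>) f + Q (T.base \<sigma>) g) = 0" for \<sigma>
        by (simp add: b f g M.C_add)
    qed
    then show "Q \<sigma> (f + g) = Q \<sigma> f + Q \<sigma> g" by simp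
  next
    fix f z assume f: "f \<in> C"
    have zQ: "js (\<lambda>\<sigma> x. z * Q \<sigma> f x)"
      using Q[OF f] M.psmooth_mult[OF M.psmooth_fun[OF T.open_img M.C_const[of z]]] unfolding js_iff by blast
    note Qf = Q[OF M.C_scale[OF f]]
    have "Q \<sigma> (\<lambda>x. z * f x) - (\<lambda>x. z * Q \<sigma> f x) = 0"
    proof (rule zero[of "\<lambda>\<sigma>. Q \<sigma> (\<lambda>x. z * f x) - (\<lambda>x. z * Q \<sigma> f x)"])
      show "js (\<lambda>\<sigma>. Q \<sigma> (\<lambda>x. z * f x) - (\<lambda>x. z * Q \<sigma> f x))" by (intro js_diff Qf zQ)
      show "pd (\<lambda>\<sigma>. Q \<sigma> (\<lambda>x. z * f x) - (\<lambda>x. z * Q \<sigma> f x)) \<sigma> v = 0" for \<sigma> v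
        using M.linear_opD(3)[OF d[of \<sigma> v] f, of z]
        by (simp add: fun_eq_iff T.mderiv_diff[OF js_point[OF Qf] js_point[OF zQ]]
            T.mderiv_bounded_linear[OF bounded_linear_mult_right js_point[OF Q[OF f]]])
      show "Q (T.base \<sigma>) (\<lambda>x. z * f x) - (\<lambda>x. z * Q (T.base \<sigma>) f x) = 0" for \<sigma>
        by (simp add: b f M.C_scale fun_eq_iff)
    qed
    then show "Q \<sigma> (\<lambda>x. z * f x) = (\<lambda>x. z * Q \<sigma> f x)" by simp
  qed
  have comm: "js (\<lambda>\<sigma>. Q \<sigma> (f * g) - f * Q \<sigma> g)"
    "pd (\<lambda>\<tau>. Q \<tau> (f * g) - f * Q \<tau> g) \<sigma> v = pd (\<lambda>\<tau>. Q \<tau> (f * g)) \<sigma> v - f * pd (\<lambda>\<tau>. Q \<tau> g) \<sigma> v"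
    if Q: "\<And>f. f \<in> C \<Longrightarrow> js (\<lambda>\<sigma>. Q \<sigma> f)" and f: "f \<in> C" and g: "g \<in> C"
    for Q :: "'t \<Rightarrow> ('p \<Rightarrow> complex) \<Rightarrow> 'p \<Rightarrow> complex" and f g \<sigma> v
  proof -
    have fQ: "js (\<lambda>\<sigma>. f * Q \<sigma> g)"
      using Q[OF g] M.psmooth_mult[OF M.psmooth_fun[OF T.open_img f]] unfolding js_iff times_fun_def by blast
    note Qfg = Q[OF M.C_mult[OF f g]]
    show "js (\<lambda>\<sigma>. Q \<sigma> (f * g) - f * Q \<sigma> g)" by (intro js_diff fQ Qfg)
    show "pd (\<lambda>\<tau>. Q \<tau> (f * g) - f * Q \<tau> g) \<sigma> v = pd (\<lambda>\<tau>. Q \<tau> (f * g)) \<sigma> v - f * pd (\<lambda>\<tau>. Q \<tau> g) \<sigma> v"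
      using T.mderiv_diff[OF js_point[OF Qfg] js_point[OF fQ]]
      by (simp add: fun_eq_iff T.mderiv_bounded_linear[OF bounded_linear_mult_right js_point[OF Q[OF g]]])
  qed
  show ?thesis
    using assms
  proof (induction n arbitrary: Q)
    case (0 Q)
    have "Q \<sigma> (f * g) - f * Q \<sigma> g = 0" if f: "f \<in> C" and g: "g \<in> C" for f g
    proof (rule zero[of "\<lambda>\<sigma>. Q \<sigma> (f * g) - f * Q \<sigma> g"])
      show "js (\<lambda>\<sigma>. Q \<sigma> (f * g) - f * Q \<sigma> g)" by (rule comm(1)[OF 0(1) f g])
      show "pd (\<lambda>\<tau>. Q \<tau> (f * g) - f * Q \<tau> g) \<sigma> v = 0" for \<sigma> v
      proof (rule trans[OF comm(2)[OF 0(1) f g]])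
        have "pd (\<lambda>\<tau>. Q \<tau> (f * g)) \<sigma> v = f * pd (\<lambda>\<tau>. Q \<tau> g) \<sigma> v"
          using 0(2)[of \<sigma> v] f g unfolding diff_ops.simps by blast
        then show "pd (\<lambda>\<tau>. Q \<tau> (f * g)) \<sigma> v - f * pd (\<lambda>\<tau>. Q \<tau> g) \<sigma> v = 0"
          by (rule eq_iff_diff_eq_0[THEN iffD1])
      qed
      show "Q (T.base \<sigma>) (f * g) - f * Q (T.base \<sigma>) g = 0" for \<sigma>
        unfolding 0(3)[OF M.C_mult[OF f g]] 0(3)[OF g] by (simp only: mult_zero_right diff_self)
    qed
    then show ?case using lin[OF 0(1) M.diff_ops_linear[OF 0(2)] 0(3)] by simp
  next
    case (Suc n Q)
    have "(\<lambda>g. Q \<sigma> (f * g) - f * Q \<sigma> g) \<in> diff_ops M n" if f: "f \<in> C" for f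
    proof (rule Suc.IH[of "\<lambda>\<sigma> g. Q \<sigma> (f * g) - f * Q \<sigma> g"])
      show "js (\<lambda>\<sigma>. Q \<sigma> (f * g) - f * Q \<sigma> g)" if "g \<in> C" for g by (rule comm(1)[OF Suc.prems(1) f that])
      show "(\<lambda>g. pd (\<lambda>\<tau>. Q \<tau> (f * g) - f * Q \<tau> g) \<sigma> v) \<in> diff_ops M n" for \<sigma> v
        by (subst M.diff_ops_cong[OF comm(2)[OF Suc.prems(1) f]]) (use Suc.prems(2)[of \<sigma> v] f in simp_all)
      show "Q (T.base \<sigma>) (f * g) - f * Q (T.base \<sigma>) g = 0" if "g \<in> C" for g \<sigma>
        unfolding Suc.prems(3)[OF M.C_mult[OF f that]] Suc.prems(3)[OF that] by (simp only: mult_zero_right diff_self)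
    qed
    then show ?case using lin[OF Suc.prems(1) M.diff_ops_linear[OF Suc.prems(2)] Suc.prems(3)] by simp
  qed
qed

end

section \<open>Formal operators\<close>

lemma formal_op_nth: "fps_nth (formal_op B F) n = (\<Sum>k\<le>n. B k (fps_nth F (n - k)))"
  by (simp add: formal_op_def)

lemma star_nth: "fps_nth (star c F G) n = (\<Sum>i\<le>n. \<Sum>j\<le>n - i. c (n - i - j) (fps_nth F i) (fps_nth G j))"
  by (simp add: star_def)

lemma fps_const_shift_decomp: "F = fps_const (fps_nth F 0) + fps_X * fps_shift 1 (F :: 'a::comm_ring_1 fps)"
  by (rule fps_ext) simp

context smooth_mfd
begin

abbreviation FF where "FF \<equiv> formal_functions A"

lemma FF_nth: "F \<in> FF \<Longrightarrow> fps_nth F n \<in> C"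
  by (simp add: formal_functions_def)

lemma FF_const: "f \<in> C \<Longrightarrow> fps_const f \<in> FF"
  by (simp add: formal_functions_def C_0)

lemma FF_add: "F \<in> FF \<Longrightarrow> G \<in> FF \<Longrightarrow> F + G \<in> FF"
  and FF_diff: "F \<in> FF \<Longrightarrow> G \<in> FF \<Longrightarrow> F - G \<in> FF"
  and FF_X: "F \<in> FF \<Longrightarrow> fps_X * F \<in> FF"
  and FF_shift: "F \<in> FF \<Longrightarrow> fps_shift k F \<in> FF"
  by (auto simp: formal_functions_def C_0 C_add C_diff)

text \<open>Additivity on smooth functions is what the formal calculations use, and the derivative
  of a family of operators inherits it directly.\<close>

definition additive_op :: "(('p \<Rightarrow> complex) \<Rightarrow> 'p \<Rightarrow> complex) \<Rightarrow> bool"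
  where "additive_op F \<longleftrightarrow> (\<forall>f\<in>C. F f \<in> C) \<and> (\<forall>f\<in>C. \<forall>g\<in>C. F (f + g) = F f + F g)"

lemma additive_op_linear: "linear_op A F \<Longrightarrow> additive_op F"
  by (simp add: additive_op_def linear_op_def)

lemma additive_op_0: "additive_op F \<Longrightarrow> F 0 = 0"
  unfolding additive_op_def using C_0 by (metis add_cancel_left_left)

text \<open>Additive maps of formal functions commuting with \<open>h\<close>: they are determined by their
  restriction to functions that are constant in \<open>h\<close>.\<close>

definition hlin :: "('p formal \<Rightarrow> 'p formal) \<Rightarrow> bool"
  where "hlin \<Phi> \<longleftrightarrow> (\<forall>F\<in>FF. \<Phi> F \<in> FF) \<and> (\<forall>F\<in>FF. \<forall>G\<in>FF. \<Phi> (F + G) = \<Phi> F + \<Phi> G) \<and>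
    (\<forall>F\<in>FF. \<Phi> (fps_X * F) = fps_X * \<Phi> F)"

lemma hlinD:
  assumes "hlin \<Phi>"
  shows "F \<in> FF \<Longrightarrow> \<Phi> F \<in> FF" "F \<in> FF \<Longrightarrow> G \<in> FF \<Longrightarrow> \<Phi> (F + G) = \<Phi> F + \<Phi> G"
    "F \<in> FF \<Longrightarrow> \<Phi> (fps_X * F) = fps_X * \<Phi> F"
  using assms by (auto simp: hlin_def)

lemma hlin_diff_arg: "hlin \<Phi> \<Longrightarrow> F \<in> FF \<Longrightarrow> G \<in> FF \<Longrightarrow> \<Phi> (F - G) = \<Phi> F - \<Phi> G"
  using hlinD(2)[of \<Phi> "F - G" G] FF_diff by (simp add: algebra_simps)

lemma hlin_comp: "hlin \<Phi> \<Longrightarrow> hlin \<Psi> \<Longrightarrow> hlin (\<lambda>F. \<Phi> (\<Psi> F))"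
  by (simp add: hlin_def)

lemma hlin_diff: "hlin \<Phi> \<Longrightarrow> hlin \<Psi> \<Longrightarrow> hlin (\<lambda>F. \<Phi> F - \<Psi> F)"
  by (simp add: hlin_def FF_diff algebra_simps)

text \<open>Writing F = f + h G with f constant in h, coefficient n of \<Phi> F is that of \<Phi> f
  plus coefficient n - 1 of \<Phi> G. Hence the vanishing on constants is required for all m up to
  n.\<close>

lemma hlin_nth_eq_0:
  assumes \<Phi>: "hlin \<Phi>" and 0: "\<And>f m. f \<in> C \<Longrightarrow> m \<le> n \<Longrightarrow> fps_nth (\<Phi> (fps_const f)) m = 0"
  shows "F \<in> FF \<Longrightarrow> fps_nth (\<Phi> F) n = 0"
  using 0
proof (induction n arbitrary: F)
  case 0
  have "\<Phi> F = \<Phi> (fps_const (fps_nth F 0)) + fps_X * \<Phi> (fps_shift 1 F)"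
    using 0(1) by (subst fps_const_shift_decomp) (simp only: hlinD[OF \<Phi>] FF_const FF_nth FF_X FF_shift)
  then show ?case using 0 by (simp add: FF_nth)
next
  case (Suc n)
  have "\<Phi> F = \<Phi> (fps_const (fps_nth F 0)) + fps_X * \<Phi> (fps_shift 1 F)"
    using Suc.prems(1) by (subst fps_const_shift_decomp) (simp only: hlinD[OF \<Phi>] FF_const FF_nth FF_X FF_shift)
  then show ?case using Suc.prems Suc.IH[OF FF_shift[OF Suc.prems(1)]] by (simp add: FF_nth)
qed

lemma hlin_formal_op:
  assumes B: "\<And>k. additive_op (B k)"
  shows "hlin (formal_op B)"
  unfolding hlin_def
proof (intro conjI ballI)
  have BC: "B k f \<in> C" if "f \<in> C" for k f using B that by (simp add: additive_op_def)
  show "formal_op B F \<in> FF" if "F \<in> FF" for F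
    using that by (auto simp: formal_functions_def formal_op_nth intro!: C_sum BC)
  show "formal_op B (F + G) = formal_op B F + formal_op B G" if "F \<in> FF" "G \<in> FF" for F G
    using B that by (intro fps_ext) (simp add: formal_op_nth additive_op_def FF_nth sum.distrib)
  show "formal_op B (fps_X * F) = fps_X * formal_op B F" for F
  proof (rule fps_ext)
    fix n
    show "fps_nth (formal_op B (fps_X * F)) n = fps_nth (fps_X * formal_op B F) n"
    proof (cases n)
      case (Suc m)
      have "(\<Sum>k\<le>m. B k (fps_nth (fps_X * F) (Suc m - k))) = (\<Sum>k\<le>m. B k (fps_nth F (m - k)))"
        by (intro sum.cong) (auto simp: Suc_diff_le)
      then show ?thesis unfolding Suc formal_op_nth by (simp add: additive_op_0[OF B] formal_op_nth)
    qed (simp add: formal_op_nth additive_op_0[OF B])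
  qed
qed

lemma formal_op_const_nth:
  assumes "\<And>k. additive_op (B k)"
  shows "fps_nth (formal_op B (fps_const f)) n = B n f"
proof -
  have "(\<Sum>k\<le>n. B k (fps_nth (fps_const f) (n - k))) = (\<Sum>k\<le>n. if k = n then B n f else 0)"
    by (intro sum.cong) (auto simp: additive_op_0[OF assms])
  then show ?thesis by (simp add: formal_op_nth)
qed

text \<open>B is the identity modulo h, so the lowest coefficient of a formal function survives.
  This gives meaning to the \<open>inv_into\<close> in \<open>gauge_equivalent\<close>.\<close>

lemma formal_op_inj:
  assumes B: "\<And>k. additive_op (B k)" "\<And>f. f \<in> C \<Longrightarrow> B 0 f = f"
  shows "inj_on (formal_op B) FF"
proof (rule inj_onI)
  fix F G assume F: "F \<in> FF" and G: "G \<in> FF" and eq: "formal_op B F = formal_op B G"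
  note hl = hlin_formal_op[OF B(1)]
  define H where "H = F - G"
  have H: "H \<in> FF" "formal_op B H = 0" using F G eq by (simp_all add: H_def FF_diff hlin_diff_arg[OF hl])
  have "fps_nth H n = 0" for n
  proof (induction n rule: less_induct)
    case (less n)
    have "(\<Sum>k\<le>n. B k (fps_nth H (n - k))) = (\<Sum>k\<le>n. if k = 0 then B 0 (fps_nth H n) else 0)"
      by (intro sum.cong) (auto simp: less additive_op_0[OF B(1)] simp del: zero_fun_apply)
    then have "fps_nth (formal_op B H) n = fps_nth H n"
      by (simp add: formal_op_nth B(2) FF_nth[OF H(1)])
    then show ?case using H(2) by simp
  qed
  then show "F = G" unfolding H_def by (metis diff_eq_eq add_0 fps_ext fps_zero_nth)
qed

text \<open>Commutation with h in either argument is a shift of summation indices; the additional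
  terms contain the argument 0 and vanish by additivity.\<close>

lemma hlin_star:
  assumes c: "\<And>k f. f \<in> C \<Longrightarrow> additive_op (c k f)" "\<And>k g. g \<in> C \<Longrightarrow> additive_op (\<lambda>f. c k f g)"
  shows "G \<in> FF \<Longrightarrow> hlin (\<lambda>F. star c F G)" "F \<in> FF \<Longrightarrow> hlin (\<lambda>G. star c F G)"
proof -
  have cC: "c k f g \<in> C" if "f \<in> C" "g \<in> C" for k f g using c(1)[OF that(1), of k] that by (simp add: additive_op_def)
  have c0: "c k f 0 = 0" "c k 0 f = 0" if "f \<in> C" for k f
    using additive_op_0[OF c(1)[OF that]] additive_op_0[OF c(2)[OF that]] by auto
  have cadd: "c k f (g + g') = c k f g + c k f g'" "c k (g + g') f = c k g f + c k g' f"
    if "f \<in> C" "g \<in> C" "g' \<in> C" for k f g g'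
    using c(1)[OF that(1), of k] c(2)[OF that(1), of k] that by (simp_all add: additive_op_def)
  have FFs: "star c F G \<in> FF" if "F \<in> FF" "G \<in> FF" for F G
    using that by (auto simp: formal_functions_def star_nth intro!: C_sum cC)
  {
    assume G: "G \<in> FF"
    show "hlin (\<lambda>F. star c F G)"
      unfolding hlin_def
    proof (intro conjI ballI)
      show "star c F G \<in> FF" if "F \<in> FF" for F by (rule FFs[OF that G])
      show "star c (F + F') G = star c F G + star c F' G" if "F \<in> FF" "F' \<in> FF" for F F'
        using that G by (intro fps_ext) (simp add: star_nth cadd FF_nth sum.distrib)
      show "star c (fps_X * F) G = fps_X * star c F G" for F
      proof (rule fps_ext)
        fix n show "fps_nth (star c (fps_X * F) G) n = fps_nth (fps_X * star c F G) n"
          using G by (cases n) (simp_all add: star_nth c0 FF_nth sum.atMost_Suc_shift del: sum.atMost_Suc)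
      qed
    qed
  next
    assume F: "F \<in> FF"
    show "hlin (\<lambda>G. star c F G)"
      unfolding hlin_def
    proof (intro conjI ballI)
      show "star c F G \<in> FF" if "G \<in> FF" for G by (rule FFs[OF F that])
      show "star c F (G + G') = star c F G + star c F G'" if "G \<in> FF" "G' \<in> FF" for G G'
        using that F by (intro fps_ext) (simp add: star_nth cadd FF_nth sum.distrib)
      show "star c F (fps_X * G) = fps_X * star c F G" for G
      proof (rule fps_ext)
        fix n show "fps_nth (star c F (fps_X * G)) n = fps_nth (fps_X * star c F G) n"
        proof (cases n)
          case (Suc m)
          have "(\<Sum>j\<le>Suc m - i. c (Suc m - i - j) (fps_nth F i) (fps_nth (fps_X * G) j)) =
              (\<Sum>j\<le>m - i. c (m - i - j) (fps_nth F i) (fps_nth G j))" if "i \<le> m" for i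
            using that F by (simp add: Suc_diff_le c0 FF_nth sum.atMost_Suc_shift del: sum.atMost_Suc)
          then show ?thesis using F by (simp add: Suc star_nth c0 FF_nth)
        qed (use F in \<open>simp add: star_nth c0 FF_nth\<close>)
      qed
    qed
  }
qed

end

context mfd_pair
begin

section \<open>Smooth sections and their derivatives\<close>

abbreviation SS where "SS \<equiv> smooth_sections T M"

lemma SS_iff: "s \<in> SS \<longleftrightarrow> (\<forall>n. js (\<lambda>\<sigma>. fps_nth (s \<sigma>) n))"
  by (simp add: smooth_sections_def js_def)

lemma SS_FF:
  assumes "s \<in> SS"
  shows "s \<sigma> \<in> M.FF"
proof -
  have "fps_nth (s \<sigma>) n \<in> C" for n
    using js_slice[of "\<lambda>\<sigma>. fps_nth (s \<sigma>) n"] assms by (simp add: SS_iff)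
  then show ?thesis by (simp add: formal_functions_def)
qed

lemma SS_const: "F \<in> M.FF \<Longrightarrow> (\<lambda>\<sigma>. F) \<in> SS"
  by (simp add: SS_iff js_const M.FF_nth)

lemma SS_add: "s \<in> SS \<Longrightarrow> t \<in> SS \<Longrightarrow> (\<lambda>\<sigma>. s \<sigma> + t \<sigma>) \<in> SS"
  by (simp add: SS_iff js_add)

lemma SS_diff: "s \<in> SS \<Longrightarrow> t \<in> SS \<Longrightarrow> (\<lambda>\<sigma>. s \<sigma> - t \<sigma>) \<in> SS"
  by (simp add: SS_iff js_diff)

lemma SS_formal_op:
  assumes "\<And>k. smooth_op (N k) (P k)" "s \<in> SS"
  shows "(\<lambda>\<sigma>. formal_op (\<lambda>k. P k \<sigma>) (s \<sigma>)) \<in> SS"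
  unfolding SS_iff formal_op_nth
proof (intro allI js_sum)
  fix n k
  show "js (\<lambda>\<sigma>. P k \<sigma> (fps_nth (s \<sigma>) (n - k)))"
    by (rule js_smooth_op[OF assms(1)]) (use assms(2) in \<open>simp add: SS_iff\<close>)
qed

text \<open>\<open>section_deriv\<close> at a single tangent vector, so that product rules can be
  stated without a vector field.\<close>

definition sd :: "('t \<Rightarrow> 'p formal) \<Rightarrow> 't \<Rightarrow> 'b \<Rightarrow> 'p formal"
  where "sd s \<sigma> v = Abs_fps (\<lambda>n. pd (\<lambda>\<tau>. fps_nth (s \<tau>) n) \<sigma> v)"

lemma sd_nth: "fps_nth (sd s \<sigma> v) n = pd (\<lambda>\<tau>. fps_nth (s \<tau>) n) \<sigma> v"
  by (simp add: sd_def)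

lemma section_deriv_sd: "section_deriv T V s \<sigma> = sd s \<sigma> (V \<sigma>)"
  by (simp add: section_deriv_def sd_def)

lemma sd_const: "sd (\<lambda>\<sigma>. F) \<sigma> v = 0"
  by (rule fps_ext) (simp add: sd_nth fun_eq_iff)

lemma sd_FF: "s \<in> SS \<Longrightarrow> sd s \<sigma> v \<in> M.FF"
  by (auto simp: formal_functions_def sd_nth SS_iff intro: pd_C)

lemma SS_sd: "s \<in> SS \<Longrightarrow> V \<in> vector_fields T \<Longrightarrow> (\<lambda>\<sigma>. sd s \<sigma> (V \<sigma>)) \<in> SS"
  by (simp add: SS_iff sd_nth js_pd)

lemma pd_diff: "js s \<Longrightarrow> js t \<Longrightarrow> pd (\<lambda>\<tau>. s \<tau> - t \<tau>) \<sigma> v = pd s \<sigma> v - pd t \<sigma> v"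
  by (simp add: fun_eq_iff T.mderiv_diff[OF js_point js_point])

lemma pd_add: "js s \<Longrightarrow> js t \<Longrightarrow> pd (\<lambda>\<tau>. s \<tau> + t \<tau>) \<sigma> v = pd s \<sigma> v + pd t \<sigma> v"
  by (simp add: fun_eq_iff T.mderiv_add[OF js_point js_point])

lemma pd_sum: "(\<And>i. i \<in> I \<Longrightarrow> js (s i)) \<Longrightarrow> pd (\<lambda>\<tau>. \<Sum>i\<in>I. s i \<tau>) \<sigma> v = (\<Sum>i\<in>I. pd (s i) \<sigma> v)"
proof
  fix x assume "\<And>i. i \<in> I \<Longrightarrow> js (s i)"
  from T.mderiv_sum[where f="\<lambda>i \<tau>. s i \<tau> x", OF js_point[OF this] UNIV_I]
  show "pd (\<lambda>\<tau>. \<Sum>i\<in>I. s i \<tau>) \<sigma> v x = (\<Sum>i\<in>I. pd (s i) \<sigma> v) x"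
    by (simp add: M.sum_fun_apply)
qed

lemma sd_diff: "s \<in> SS \<Longrightarrow> t \<in> SS \<Longrightarrow> sd (\<lambda>\<tau>. s \<tau> - t \<tau>) \<sigma> v = sd s \<sigma> v - sd t \<sigma> v"
proof (rule fps_ext)
  fix n assume s: "s \<in> SS" and t: "t \<in> SS"
  from pd_diff[of "\<lambda>\<tau>. fps_nth (s \<tau>) n" "\<lambda>\<tau>. fps_nth (t \<tau>) n" \<sigma> v] s t
  show "fps_nth (sd (\<lambda>\<tau>. s \<tau> - t \<tau>) \<sigma> v) n = fps_nth (sd s \<sigma> v - sd t \<sigma> v) n"
    by (simp add: sd_nth SS_iff)
qed

abbreviation op_deriv :: "('t \<Rightarrow> ('p \<Rightarrow> complex) \<Rightarrow> 'p \<Rightarrow> complex) \<Rightarrow> 't \<Rightarrow> 'b \<Rightarrow> ('p \<Rightarrow> complex) \<Rightarrow> 'p \<Rightarrow> complex"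
  where "op_deriv P \<sigma> v \<equiv> \<lambda>f. pd (\<lambda>\<tau>. P \<tau> f) \<sigma> v"

lemma additive_smooth_op: "smooth_op n F \<Longrightarrow> M.additive_op (F \<sigma>)"
  by (intro M.additive_op_linear smooth_op_linear)

lemma additive_op_deriv:
  assumes F: "smooth_op n F"
  shows "M.additive_op (op_deriv F \<sigma> v)"
proof -
  have Fj: "js (\<lambda>\<sigma>. F \<sigma> f)" if "f \<in> C" for f using F that by (simp add: smooth_op_def)
  have "pd (\<lambda>\<tau>. F \<tau> (f + g)) \<sigma> v = pd (\<lambda>\<tau>. F \<tau> f) \<sigma> v + pd (\<lambda>\<tau>. F \<tau> g) \<sigma> v" if fg: "f \<in> C" "g \<in> C" for f g
    using pd_add[OF Fj[OF fg(1)] Fj[OF fg(2)], of \<sigma> v] M.linear_opD(2)[OF smooth_op_linear[OF F] fg] by simp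
  then show ?thesis by (simp add: M.additive_op_def pd_C[OF Fj])
qed

lemma sd_formal_op:
  assumes P: "\<And>k. smooth_op (N k) (P k)" and s: "s \<in> SS"
  shows "sd (\<lambda>\<tau>. formal_op (\<lambda>k. P k \<tau>) (s \<tau>)) \<sigma> v =
    formal_op (\<lambda>k. op_deriv (P k) \<sigma> v) (s \<sigma>) + formal_op (\<lambda>k. P k \<sigma>) (sd s \<sigma> v)"
proof (rule fps_ext)
  fix n
  have sj: "js (\<lambda>\<tau>. fps_nth (s \<tau>) m)" for m using s by (simp add: SS_iff)
  have "fps_nth (sd (\<lambda>\<tau>. formal_op (\<lambda>k. P k \<tau>) (s \<tau>)) \<sigma> v) n = (\<Sum>k\<le>n. pd (\<lambda>\<tau>. P k \<tau> (fps_nth (s \<tau>) (n - k))) \<sigma> v)"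
    unfolding sd_nth formal_op_nth by (rule pd_sum) (rule js_smooth_op[OF P sj])
  also have "\<dots> = (\<Sum>k\<le>n. pd (\<lambda>\<tau>. P k \<tau> (fps_nth (s \<sigma>) (n - k))) \<sigma> v + P k \<sigma> (pd (\<lambda>\<tau>. fps_nth (s \<tau>) (n - k)) \<sigma> v))"
    by (rule sum.cong[OF refl pd_smooth_op[OF P sj]])
  finally show "fps_nth (sd (\<lambda>\<tau>. formal_op (\<lambda>k. P k \<tau>) (s \<tau>)) \<sigma> v) n =
      fps_nth (formal_op (\<lambda>k. op_deriv (P k) \<sigma> v) (s \<sigma>) + formal_op (\<lambda>k. P k \<sigma>) (sd s \<sigma> v)) n"
    by (simp only: fps_add_nth formal_op_nth sd_nth sum.distrib)
qed

section \<open>Connection forms, flatness and exactness\<close>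

definition connection_form :: "(nat \<Rightarrow> 't \<Rightarrow> 'b \<Rightarrow> ('p \<Rightarrow> complex) \<Rightarrow> 'p \<Rightarrow> complex) \<Rightarrow> bool"
  where "connection_form B \<longleftrightarrow> (\<forall>k. diff_op_one_form T M (B k)) \<and> (\<forall>\<sigma> v. \<forall>f\<in>C. B 0 \<sigma> v f = 0) \<and>
    (\<forall>k \<sigma> v. B k \<sigma> v \<in> diff_ops M k)"

abbreviation cop :: "(nat \<Rightarrow> 't \<Rightarrow> 'b \<Rightarrow> ('p \<Rightarrow> complex) \<Rightarrow> 'p \<Rightarrow> complex) \<Rightarrow> 't \<Rightarrow> 'b \<Rightarrow> 'p formal \<Rightarrow> 'p formal"
  where "cop B \<sigma> v \<equiv> formal_op (\<lambda>k. B k \<sigma> v)"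

lemma connection_form_additive: "connection_form B \<Longrightarrow> M.additive_op (B k \<sigma> v)"
  unfolding connection_form_def using M.additive_op_linear M.diff_ops_linear by blast

lemma hlin_cop: "connection_form B \<Longrightarrow> M.hlin (cop B \<sigma> v)"
  by (intro M.hlin_formal_op connection_form_additive)

lemma connection_form_smooth_op:
  "connection_form B \<Longrightarrow> V \<in> vector_fields T \<Longrightarrow> smooth_op k (\<lambda>\<sigma>. B k \<sigma> (V \<sigma>))"
  by (intro smooth_op_one_form) (auto simp: connection_form_def)

lemma connection_form_linear: "connection_form B \<Longrightarrow> f \<in> C \<Longrightarrow> linear (\<lambda>v. B k \<sigma> v f x)"
  by (intro diff_op_one_form_linear) (simp_all add: connection_form_def)

lemma cop_0_vec:
  assumes "connection_form B" "F \<in> M.FF"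
  shows "cop B \<sigma> 0 F = 0"
proof (rule fps_ext)
  fix n
  have "B k \<sigma> 0 f = 0" if "f \<in> C" for k f
    using linear_0[OF connection_form_linear[OF assms(1) that]] by (simp add: fun_eq_iff)
  then show "fps_nth (cop B \<sigma> 0 F) n = fps_nth 0 n" by (simp add: formal_op_nth M.FF_nth[OF assms(2)])
qed

text \<open>Since \<open>A\<^sup>0 = 0\<close>, the coefficient of \<open>h\<^sup>n\<close> of \<open>A F\<close> only depends on \<open>F\<close> modulo \<open>h\<^sup>n\<close>.\<close>

lemma cop_nth_cong:
  assumes B: "connection_form B" and F: "F \<in> M.FF" "G \<in> M.FF" and "\<And>j. j < n \<Longrightarrow> fps_nth F j = fps_nth G j"
  shows "fps_nth (cop B \<sigma> v F) n = fps_nth (cop B \<sigma> v G) n"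
  unfolding formal_op_nth
proof (rule sum.cong[OF refl])
  fix k assume "k \<in> {..n}"
  have "B 0 \<sigma> v f = 0" if "f \<in> C" for f using B that by (simp add: connection_form_def)
  then show "B k \<sigma> v (fps_nth F (n - k)) = B k \<sigma> v (fps_nth G (n - k))"
    using assms(4)[of "n - k"] F \<open>k \<in> {..n}\<close> by (cases "k = 0") (auto simp: M.FF_nth)
qed

lemma cop_nth_0: "connection_form B \<Longrightarrow> F \<in> M.FF \<Longrightarrow> fps_nth (cop B \<sigma> v F) 0 = 0"
  by (simp add: formal_op_nth connection_form_def M.FF_nth)

definition connection_of ::
  "(nat \<Rightarrow> 't \<Rightarrow> 'b \<Rightarrow> ('p \<Rightarrow> complex) \<Rightarrow> 'p \<Rightarrow> complex) \<Rightarrow> (('t \<Rightarrow> 'b) \<Rightarrow> ('t \<Rightarrow> 'p formal) \<Rightarrow> 't \<Rightarrow> 'p formal) \<Rightarrow> bool"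
  where "connection_of B D \<longleftrightarrow> connection_form B \<and>
    (\<forall>V\<in>vector_fields T. \<forall>s\<in>SS. \<forall>\<sigma>. D V s \<sigma> = sd s \<sigma> (V \<sigma>) + cop B \<sigma> (V \<sigma>) (s \<sigma>))"

lemma formal_connection_iff: "formal_connection T M D \<longleftrightarrow> (\<exists>B. connection_of B D)"
  unfolding formal_connection_def connection_of_def connection_form_def section_deriv_sd by blast

lemma connection_ofD:
  "connection_of B D \<Longrightarrow> V \<in> vector_fields T \<Longrightarrow> s \<in> SS \<Longrightarrow> D V s \<sigma> = sd s \<sigma> (V \<sigma>) + cop B \<sigma> (V \<sigma>) (s \<sigma>)"
  by (simp add: connection_of_def)

lemma connection_SS:
  assumes B: "connection_of B D" and V: "V \<in> vector_fields T" and s: "s \<in> SS"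
  shows "D V s \<in> SS"
proof -
  have "D V s = (\<lambda>\<sigma>. sd s \<sigma> (V \<sigma>) + cop B \<sigma> (V \<sigma>) (s \<sigma>))" using connection_ofD[OF assms] by blast
  moreover have "connection_form B" using B by (simp add: connection_of_def)
  ultimately show ?thesis
    using SS_add[OF SS_sd[OF s V] SS_formal_op[OF connection_form_smooth_op[OF _ V] s]] by simp
qed

text \<open>The two sides are D_V D_W and D_W D_V on a constant section, so this is the
  Maurer-Cartan equation dA + A A = 0 on fields that commute at p. Vanishing of the bracket at p is
  enough because A is tensorial in the vector field.\<close>

lemma flat_connection_form:
  assumes B: "connection_of B D" and flat: "flat_connection T M D"
    and V: "V \<in> vector_fields T" and W: "W \<in> vector_fields T" and VW: "lie_bracket T V W p = 0" and F: "F \<in> M.FF"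
  shows "formal_op (\<lambda>k. op_deriv (\<lambda>\<tau>. B k \<tau> (W \<tau>)) p (V p)) F + cop B p (V p) (cop B p (W p) F) =
    formal_op (\<lambda>k. op_deriv (\<lambda>\<tau>. B k \<tau> (V \<tau>)) p (W p)) F + cop B p (W p) (cop B p (V p) F)"
proof -
  have form: "connection_form B" using B by (simp add: connection_of_def)
  note sF = SS_const[OF F]
  have DD: "D V (D W (\<lambda>\<sigma>. F)) p = formal_op (\<lambda>k. op_deriv (\<lambda>\<tau>. B k \<tau> (W \<tau>)) p (V p)) F + cop B p (V p) (cop B p (W p) F)"
    if V: "V \<in> vector_fields T" and W: "W \<in> vector_fields T" for V W
  proof -
    have DW: "D W (\<lambda>\<sigma>. F) = (\<lambda>\<tau>. cop B \<tau> (W \<tau>) F)"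
      by (rule ext) (use connection_ofD[OF B W sF] in \<open>simp add: sd_const\<close>)
    have "sd (\<lambda>\<tau>. cop B \<tau> (W \<tau>) F) p (V p) = formal_op (\<lambda>k. op_deriv (\<lambda>\<tau>. B k \<tau> (W \<tau>)) p (V p)) F"
      using sd_formal_op[where N="\<lambda>k. k" and \<sigma>=p and v="V p", OF connection_form_smooth_op[OF form W] sF] by (simp add: sd_const fps_eq_iff formal_op_nth M.additive_op_0[OF connection_form_additive[OF form]])
    then show ?thesis
      using connection_ofD[OF B V connection_SS[OF B W sF], of p] by (simp add: DW)
  qed
  have "D (lie_bracket T V W) (\<lambda>\<sigma>. F) p = 0"
    using connection_ofD[OF B T.lie_bracket_vector_fields[OF V W] sF, of p]
    by (simp add: sd_const VW cop_0_vec[OF form F])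
  moreover have "D V (D W (\<lambda>\<sigma>. F)) p - D W (D V (\<lambda>\<sigma>. F)) p - D (lie_bracket T V W) (\<lambda>\<sigma>. F) p = 0"
    using flat V W sF unfolding flat_connection_def by blast
  ultimately show ?thesis unfolding DD[OF V W] DD[OF W V] by simp
qed

text \<open>\<open>trivial_H1\<close> concerns real forms, so real and imaginary parts get separate
  primitives. Symmetry of the derivative is only asked where the bracket vanishes; coordinate fields
  extend to global fields with this property.\<close>

lemma exact_complex_form:
  fixes \<beta> :: "'t \<Rightarrow> 'b \<Rightarrow> complex"
  assumes H1: "trivial_H1 T" and lin: "\<And>\<sigma>. linear (\<beta> \<sigma>)"
    and sm: "\<And>V. V \<in> vector_fields T \<Longrightarrow> smooth_fun T UNIV (\<lambda>\<sigma>. \<beta> \<sigma> (V \<sigma>))"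
    and closed: "\<And>V W p. V \<in> vector_fields T \<Longrightarrow> W \<in> vector_fields T \<Longrightarrow> lie_bracket T V W p = 0 \<Longrightarrow>
      mderiv T (\<lambda>\<sigma>. \<beta> \<sigma> (W \<sigma>)) p (V p) = mderiv T (\<lambda>\<sigma>. \<beta> \<sigma> (V \<sigma>)) p (W p)"
  shows "\<exists>u. smooth_fun T UNIV u \<and> (\<forall>p v. mderiv T u p v = \<beta> p v)"
proof -
  have real: "\<exists>u :: 't \<Rightarrow> real. smooth_fun T UNIV u \<and> (\<forall>p v. mderiv T u p v = L (\<beta> p v))"
    if L: "bounded_linear L" for L :: "complex \<Rightarrow> real"
  proof -
    let ?\<alpha> = "\<lambda>\<sigma> v. L (\<beta> \<sigma> v)"
    have "closed_one_form T ?\<alpha>"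
      unfolding closed_one_form_def one_form_on_def
    proof (intro conjI ballI allI)
      show "linear (?\<alpha> p)" for p using linear_compose[OF lin bounded_linear.linear[OF L]] by (simp add: o_def)
      fix c assume c: "c \<in> T"
      show "smooth_fun T (fst c \<inter> UNIV) (\<lambda>p. ?\<alpha> p (coord_vec T c p w))" for w
      proof (rule T.smooth_fun_local)
        fix p assume p: "p \<in> fst c \<inter> UNIV"
        then obtain N V where N: "open N" "p \<in> N" and V: "V \<in> vector_fields T" "\<And>q. q \<in> N \<Longrightarrow> V q = coord_vec T c q w"
          using T.local_coordinate_field[OF c, of p] by blast
        have "smooth_fun T N (\<lambda>p. ?\<alpha> p (V p))"
          by (rule T.smooth_fun_subset[OF T.smooth_fun_bounded_linear[OF L sm[OF V(1)]] N(1)]) simp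
        then have "smooth_fun T N (\<lambda>p. ?\<alpha> p (coord_vec T c p w))"
          by (rule T.smooth_fun_cong[THEN iffD1, rotated]) (simp add: V(2))
        then show "\<exists>V. p \<in> V \<and> smooth_fun T V (\<lambda>p. ?\<alpha> p (coord_vec T c p w))" using N by blast
      qed (use T.open_dom[OF c] in simp)
      fix p v w assume p: "p \<in> fst c"
      obtain N where N: "open N" "p \<in> N" "N \<subseteq> fst c"
        and ex: "\<And>w. \<exists>V\<in>vector_fields T. \<forall>q\<in>N. V q = coord_vec T c q w"
        using T.local_coordinate_field[OF c p] by blast
      obtain V W where V: "V \<in> vector_fields T" "\<And>q. q \<in> N \<Longrightarrow> V q = coord_vec T c q v"
        and W: "W \<in> vector_fields T" "\<And>q. q \<in> N \<Longrightarrow> W q = coord_vec T c q w" using ex by metis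
      have br: "lie_bracket T V W p = 0"
        by (rule T.lie_bracket_coordinate_fields[OF V(1) W(1) c p N V(2) W(2)])
      have "mderiv T (\<lambda>q. ?\<alpha> q (coord_vec T c q w)) p u = L (mderiv T (\<lambda>q. \<beta> q (W q)) p u)" for u
        using T.mderiv_cong_open[OF N(1,2), of "\<lambda>q. ?\<alpha> q (coord_vec T c q w)" "\<lambda>q. ?\<alpha> q (W q)"] W(2)
          T.mderiv_bounded_linear[OF L sm[OF W(1)]] by simp
      moreover have "mderiv T (\<lambda>q. ?\<alpha> q (coord_vec T c q v)) p u = L (mderiv T (\<lambda>q. \<beta> q (V q)) p u)" for u
        using T.mderiv_cong_open[OF N(1,2), of "\<lambda>q. ?\<alpha> q (coord_vec T c q v)" "\<lambda>q. ?\<alpha> q (V q)"] V(2)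
          T.mderiv_bounded_linear[OF L sm[OF V(1)]] by simp
      ultimately show "ext_deriv1 T ?\<alpha> c p v w = 0"
        unfolding ext_deriv1_def V(2)[OF N(2), symmetric] W(2)[OF N(2), symmetric]
        by (simp add: closed[OF V(1) W(1) br])
    qed simp
    then have "exact_one_form T ?\<alpha>" using H1 by (simp add: trivial_H1_def)
    then show ?thesis unfolding exact_one_form_def by metis
  qed
  obtain u where u: "smooth_fun T UNIV u" "\<And>p v. mderiv T u p v = Re (\<beta> p v)" using real[OF bounded_linear_Re] by blast
  obtain w where w: "smooth_fun T UNIV w" "\<And>p v. mderiv T w p v = Im (\<beta> p v)" using real[OF bounded_linear_Im] by blast
  have bl': "bounded_linear complex_of_real" by (rule bounded_linear_of_real)
  have bl: "bounded_linear (\<lambda>r. \<i> * complex_of_real r)"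
    by (intro bounded_linear_const_mult bounded_linear_of_real)
  let ?f = "\<lambda>\<sigma>. complex_of_real (u \<sigma>) + \<i> * complex_of_real (w \<sigma>)"
  have sm': "smooth_fun T UNIV (\<lambda>\<sigma>. complex_of_real (u \<sigma>))" "smooth_fun T UNIV (\<lambda>\<sigma>. \<i> * complex_of_real (w \<sigma>))"
    by (rule T.smooth_fun_bounded_linear[OF bl' u(1)], rule T.smooth_fun_bounded_linear[OF bl w(1)])
  have "mderiv T ?f p v = \<beta> p v" for p v
    using T.mderiv_add[OF sm'] T.mderiv_bounded_linear[OF bl' u(1)] T.mderiv_bounded_linear[OF bl w(1)]
    by (simp add: u(2) w(2) complex_eq[symmetric])
  then show ?thesis using T.smooth_fun_add[OF sm'] by blast
qed

end

section \<open>Gauge transformations between flat connections\<close>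

text \<open>The bookkeeping of d(P A' - A P) = 0. The first assumption is flatness of d + A'
  followed by P, the second is flatness of d + A after P. The letters b and e are the mixed terms
  A(V) P A'(W) and A(W) P A'(V), which occur on both sides.\<close>

lemma curvature_cancel:
  fixes a :: "'a::ab_group_add"
  assumes "c + a = c' + a'" "d + g' = d' + g"
  shows "a - b + c - d - (e - g) = a' - e + c' - d' - (b - g')"
proof -
  have "a = c' + a' - c" "d = d' + g - g'"
    using assms by (simp_all add: eq_diff_eq add.commute)
  then show ?thesis by (simp add: algebra_simps)
qed

locale flat_pair = mfd_pair T M
  for T :: "('t::{second_countable_topology, t2_space}, 'b::euclidean_space) chart set"
    and M :: "('p::{second_countable_topology, t2_space}, 'e::euclidean_space) chart set" +
  fixes A A' :: "nat \<Rightarrow> 't \<Rightarrow> 'b \<Rightarrow> ('p \<Rightarrow> complex) \<Rightarrow> 'p \<Rightarrow> complex"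
    and D D' :: "('t \<Rightarrow> 'b) \<Rightarrow> ('t \<Rightarrow> 'p formal) \<Rightarrow> 't \<Rightarrow> 'p formal"
  assumes A: "connection_of A D" "flat_connection T M D"
    and A': "connection_of A' D'" "flat_connection T M D'"
    and H1: "trivial_H1 T"
begin

lemma form: "connection_form A" "connection_form A'"
  using A(1) A'(1) by (simp_all add: connection_of_def)

lemma A_0: "f \<in> C \<Longrightarrow> A 0 \<sigma> v f = 0" "f \<in> C \<Longrightarrow> A' 0 \<sigma> v f = 0"
  using form by (auto simp: connection_form_def)

section \<open>The equation \<open>dP = P A' - A P\<close>, order by order\<close>

abbreviation gop :: "(nat \<Rightarrow> 't \<Rightarrow> ('p \<Rightarrow> complex) \<Rightarrow> 'p \<Rightarrow> complex) \<Rightarrow> 't \<Rightarrow> 'p formal \<Rightarrow> 'p formal"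
  where "gop P \<sigma> \<equiv> formal_op (\<lambda>k. P k \<sigma>)"

text \<open>The gauge transformation \<open>P\<close> from \<open>d + A\<close> to \<open>d + A'\<close> solves \<open>dP = P A' - A P\<close>; the
  coefficient of \<open>h\<^sup>k\<close> of the right-hand side only involves \<open>P\<^sub>j\<close> with \<open>j < k\<close>.\<close>

definition defect :: "(nat \<Rightarrow> 't \<Rightarrow> ('p \<Rightarrow> complex) \<Rightarrow> 'p \<Rightarrow> complex) \<Rightarrow> 't \<Rightarrow> 'b \<Rightarrow> 'p formal \<Rightarrow> 'p formal"
  where "defect P \<sigma> v F = gop P \<sigma> (cop A' \<sigma> v F) - cop A \<sigma> v (gop P \<sigma> F)"

definition smooth_ops :: "(nat \<Rightarrow> 't \<Rightarrow> ('p \<Rightarrow> complex) \<Rightarrow> 'p \<Rightarrow> complex) \<Rightarrow> bool"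
  where "smooth_ops P \<longleftrightarrow> (\<forall>k. smooth_op k (P k))"

lemma smooth_opsD: "smooth_ops P \<Longrightarrow> smooth_op k (P k)"
  by (simp add: smooth_ops_def)

lemma additive_P: "smooth_ops P \<Longrightarrow> M.additive_op (P k \<sigma>)"
  by (rule additive_smooth_op[OF smooth_opsD])

lemma hlin_gop: "smooth_ops P \<Longrightarrow> M.hlin (gop P \<sigma>)"
  by (rule M.hlin_formal_op) (rule additive_P)

lemma hlin_defect: "smooth_ops P \<Longrightarrow> M.hlin (defect P \<sigma> v)"
  unfolding defect_def
  by (rule M.hlin_diff[OF M.hlin_comp[OF hlin_gop hlin_cop[OF form(2)]] M.hlin_comp[OF hlin_cop[OF form(1)] hlin_gop]])

lemma SS_gop: "smooth_ops P \<Longrightarrow> s \<in> SS \<Longrightarrow> (\<lambda>\<sigma>. gop P \<sigma> (s \<sigma>)) \<in> SS"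
  by (rule SS_formal_op[where N="\<lambda>k. k"]) (rule smooth_opsD)

lemma SS_cop:
  "connection_form B \<Longrightarrow> V \<in> vector_fields T \<Longrightarrow> s \<in> SS \<Longrightarrow> (\<lambda>\<sigma>. cop B \<sigma> (V \<sigma>) (s \<sigma>)) \<in> SS"
  by (rule SS_formal_op[where N="\<lambda>k. k"]) (rule connection_form_smooth_op)

lemma SS_defect:
  assumes P: "smooth_ops P" and V: "V \<in> vector_fields T" and s: "s \<in> SS"
  shows "(\<lambda>\<sigma>. defect P \<sigma> (V \<sigma>) (s \<sigma>)) \<in> SS"
  unfolding defect_def
  by (rule SS_diff[OF SS_gop[OF P SS_cop[OF form(2) V s]] SS_cop[OF form(1) V SS_gop[OF P s]]])

lemma defect_const_nth:
  assumes P: "smooth_ops P" and f: "f \<in> C"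
  shows "fps_nth (defect P \<sigma> v (fps_const f)) n =
    (\<Sum>k\<le>n. P k \<sigma> (A' (n - k) \<sigma> v f)) - (\<Sum>k\<le>n. A k \<sigma> v (P (n - k) \<sigma> f))"
  unfolding defect_def fps_sub_nth formal_op_nth[of _ "formal_op _ _"]
  by (simp add: M.formal_op_const_nth additive_P[OF P] connection_form_additive[OF form(1)] connection_form_additive[OF form(2)])

text \<open>The top coefficient of P meets only \<open>A 0\<close> or \<open>A' 0\<close>, which
  vanish. So a new coefficient can be put into P at index n without disturbing the right-hand sides
  up to order n.\<close>

lemma defect_cong:
  assumes P: "smooth_ops P" "smooth_ops P'" and eq: "\<And>j f. j < n \<Longrightarrow> f \<in> C \<Longrightarrow> P j \<sigma> f = P' j \<sigma> f" and f: "f \<in> C"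
  shows "fps_nth (defect P \<sigma> v (fps_const f)) n = fps_nth (defect P' \<sigma> v (fps_const f)) n"
proof -
  have AC: "A' k \<sigma> v f \<in> C" for k
    using connection_form_additive[OF form(2)] f by (auto simp: M.additive_op_def)
  have PC: "P k \<sigma> f \<in> C" "P' k \<sigma> f \<in> C" for k
    using additive_P[OF P(1)] additive_P[OF P(2)] f by (auto simp: M.additive_op_def)
  have "P k \<sigma> (A' (n - k) \<sigma> v f) = P' k \<sigma> (A' (n - k) \<sigma> v f)" if "k \<le> n" for k
    using eq[of k] AC that by (cases "k = n") (auto simp: A_0(2)[OF f] M.additive_op_0[OF additive_P[OF P(1)]] M.additive_op_0[OF additive_P[OF P(2)]])
  moreover have "A k \<sigma> v (P (n - k) \<sigma> f) = A k \<sigma> v (P' (n - k) \<sigma> f)" if "k \<le> n" for k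
    using eq[of "n - k"] f that by (cases "k = 0") (auto simp: A_0(1) PC)
  ultimately show ?thesis by (simp add: defect_const_nth P f)
qed

lemma linear_defect:
  assumes P: "smooth_ops P" and f: "f \<in> C"
  shows "linear (\<lambda>v. fps_nth (defect P \<sigma> v (fps_const f)) n x)"
proof -
  have lin_op: "linear (\<lambda>v. P k \<sigma> (A' m \<sigma> v f) x)" for k m
  proof -
    have AC: "A' m \<sigma> v f \<in> C" for v
      using connection_form_additive[OF form(2)] f by (auto simp: M.additive_op_def)
    have l: "linear (\<lambda>v. A' m \<sigma> v f y)" for y by (rule connection_form_linear[OF form(2) f])
    note lin = smooth_op_linear[OF smooth_opsD[OF P], of k \<sigma>]
    show ?thesis
    proof (rule linearI)
      fix v w
      have "A' m \<sigma> (v + w) f = A' m \<sigma> v f + A' m \<sigma> w f"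
        using linear_add[OF l] by (simp add: fun_eq_iff)
      then show "P k \<sigma> (A' m \<sigma> (v + w) f) x = P k \<sigma> (A' m \<sigma> v f) x + P k \<sigma> (A' m \<sigma> w f) x"
        by (simp add: M.linear_opD(2)[OF lin AC AC])
    next
      fix r v
      have "A' m \<sigma> (r *\<^sub>R v) f = (\<lambda>y. complex_of_real r * A' m \<sigma> v f y)"
        using linear_cmul[OF l] by (simp add: fun_eq_iff scaleR_conv_of_real)
      then show "P k \<sigma> (A' m \<sigma> (r *\<^sub>R v) f) x = r *\<^sub>R P k \<sigma> (A' m \<sigma> v f) x"
        by (simp add: M.linear_opD(3)[OF lin AC] scaleR_conv_of_real)
    qed
  qed
  have PC: "P k \<sigma> f \<in> C" for k using additive_P[OF P] f by (auto simp: M.additive_op_def)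
  have "linear (\<lambda>v. (\<Sum>k\<le>n. P k \<sigma> (A' (n - k) \<sigma> v f) x) - (\<Sum>k\<le>n. A k \<sigma> v (P (n - k) \<sigma> f) x))"
    by (intro linear_compose_sub linear_compose_sum ballI lin_op connection_form_linear[OF form(1) PC])
  then show ?thesis by (simp add: defect_const_nth[OF P f] M.sum_fun_apply)
qed

text \<open>Orders add under composition, and the two indices in each term of coefficient n sum to
  n. This is what keeps \<open>P n\<close> at order n.\<close>

lemma diff_ops_defect:
  assumes P: "smooth_ops P"
  shows "(\<lambda>f. fps_nth (defect P \<sigma> v (fps_const f)) n) \<in> diff_ops M n"
proof -
  have PA: "P k \<sigma> \<in> diff_ops M k" "A k \<sigma> v \<in> diff_ops M k" "A' k \<sigma> v \<in> diff_ops M k" for k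
    using smooth_opsD[OF P, of k] form by (auto simp: smooth_op_def connection_form_def)
  have "(\<lambda>f. P k \<sigma> (A' (n - k) \<sigma> v f)) \<in> diff_ops M n" "(\<lambda>f. A k \<sigma> v (P (n - k) \<sigma> f)) \<in> diff_ops M n" if "k \<le> n" for k
    using M.diff_ops_comp[OF PA(1)[of k] PA(3)[of "n - k"]] M.diff_ops_comp[OF PA(2)[of k] PA(1)[of "n - k"]] that by simp_all
  then have "(\<lambda>f. (\<Sum>k\<le>n. P k \<sigma> (A' (n - k) \<sigma> v f)) - (\<Sum>k\<le>n. A k \<sigma> v (P (n - k) \<sigma> f))) \<in> diff_ops M n"
    by (intro M.diff_ops_diff M.diff_ops_sum) auto
  then show ?thesis
    by (rule M.diff_ops_cong[THEN iffD2, rotated]) (simp add: defect_const_nth[OF P])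
qed

lemma sd_gop:
  assumes "smooth_ops P" "s \<in> SS"
  shows "sd (\<lambda>\<tau>. gop P \<tau> (s \<tau>)) \<sigma> v = formal_op (\<lambda>k. op_deriv (P k) \<sigma> v) (s \<sigma>) + gop P \<sigma> (sd s \<sigma> v)"
  by (rule sd_formal_op[where N="\<lambda>k. k"]) (use assms smooth_opsD in auto)

lemma sd_cop:
  assumes "connection_form B" "V \<in> vector_fields T" "s \<in> SS"
  shows "sd (\<lambda>\<tau>. cop B \<tau> (V \<tau>) (s \<tau>)) \<sigma> v =
    formal_op (\<lambda>k. op_deriv (\<lambda>\<tau>. B k \<tau> (V \<tau>)) \<sigma> v) (s \<sigma>) + cop B \<sigma> (V \<sigma>) (sd s \<sigma> v)"
  by (rule sd_formal_op[where N="\<lambda>k. k"]) (use assms connection_form_smooth_op in auto)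

text \<open>The differential equation is known on functions constant in h. Both sides commute with
  h, so their coefficients below k agree on all formal functions.\<close>

lemma op_deriv_nth:
  assumes P: "smooth_ops P" and eq: "\<And>j f. j < k \<Longrightarrow> f \<in> C \<Longrightarrow> op_deriv (P j) \<sigma> v f = fps_nth (defect P \<sigma> v (fps_const f)) j"
    and F: "F \<in> M.FF" and n: "n < k"
  shows "fps_nth (formal_op (\<lambda>j. op_deriv (P j) \<sigma> v) F) n = fps_nth (defect P \<sigma> v F) n"
proof -
  have add: "M.additive_op (op_deriv (P j) \<sigma> v)" for j by (rule additive_op_deriv[OF smooth_opsD[OF P]])
  have "fps_nth (formal_op (\<lambda>j. op_deriv (P j) \<sigma> v) F - defect P \<sigma> v F) n = 0"
  proof (rule M.hlin_nth_eq_0[OF M.hlin_diff[OF M.hlin_formal_op[OF add] hlin_defect[OF P]] _ F])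
    fix f m assume "f \<in> C" "m \<le> n"
    then show "fps_nth (formal_op (\<lambda>j. op_deriv (P j) \<sigma> v) (fps_const f) - defect P \<sigma> v (fps_const f)) m = 0"
      using eq[of m f] n by (simp only: fps_sub_nth M.formal_op_const_nth[OF add] diff_self)
  qed
  then show ?thesis by simp
qed

text \<open>The product rule produces dP only next to A or A', which are divisible by h. Coefficient
  k therefore needs dP below order k only, where the equation already turns it into the
  defect.\<close>

lemma pd_defect:
  assumes P: "smooth_ops P"
    and eq: "\<And>j \<sigma> v f. j < k \<Longrightarrow> f \<in> C \<Longrightarrow> op_deriv (P j) \<sigma> v f = fps_nth (defect P \<sigma> v (fps_const f)) j"
    and V: "V \<in> vector_fields T" and W: "W \<in> vector_fields T" and F: "F \<in> M.FF"
  shows "fps_nth (sd (\<lambda>\<tau>. defect P \<tau> (W \<tau>) F) p (V p)) k =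
    fps_nth (defect P p (V p) (cop A' p (W p) F)
      + gop P p (formal_op (\<lambda>j. op_deriv (\<lambda>\<tau>. A' j \<tau> (W \<tau>)) p (V p)) F)
      - formal_op (\<lambda>j. op_deriv (\<lambda>\<tau>. A j \<tau> (W \<tau>)) p (V p)) (gop P p F)
      - cop A p (W p) (defect P p (V p) F)) k"
proof -
  note sF = SS_const[OF F]
  let ?dP = "formal_op (\<lambda>j. op_deriv (P j) p (V p))"
  have hdP: "M.hlin ?dP" by (intro M.hlin_formal_op additive_op_deriv[OF smooth_opsD[OF P]])
  have 0: "cop B \<sigma> v 0 = 0" "gop P \<sigma> 0 = 0" if "connection_form B" for B \<sigma> v
    by (simp_all add: fps_eq_iff formal_op_nth M.additive_op_0[OF connection_form_additive[OF that]]
        M.additive_op_0[OF additive_P[OF P]])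
  have A'F: "cop A' p (W p) F \<in> M.FF" by (rule M.hlinD(1)[OF hlin_cop[OF form(2)] F])
  have s1: "(\<lambda>\<tau>. cop A' \<tau> (W \<tau>) F) \<in> SS" and s2: "(\<lambda>\<tau>. gop P \<tau> F) \<in> SS"
    by (rule SS_cop[OF form(2) W sF], rule SS_gop[OF P sF])
  have "sd (\<lambda>\<tau>. defect P \<tau> (W \<tau>) F) p (V p) =
      sd (\<lambda>\<tau>. gop P \<tau> (cop A' \<tau> (W \<tau>) F)) p (V p) - sd (\<lambda>\<tau>. cop A \<tau> (W \<tau>) (gop P \<tau> F)) p (V p)"
    unfolding defect_def by (rule sd_diff[OF SS_gop[OF P s1] SS_cop[OF form(1) W s2]])
  also have "sd (\<lambda>\<tau>. gop P \<tau> (cop A' \<tau> (W \<tau>) F)) p (V p) = ?dP (cop A' p (W p) F)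
      + gop P p (formal_op (\<lambda>j. op_deriv (\<lambda>\<tau>. A' j \<tau> (W \<tau>)) p (V p)) F)"
    using sd_gop[OF P s1, of p "V p"] sd_cop[OF form(2) W sF, of p "V p"] by (simp add: sd_const 0[OF form(2)])
  also have "sd (\<lambda>\<tau>. cop A \<tau> (W \<tau>) (gop P \<tau> F)) p (V p) =
      formal_op (\<lambda>j. op_deriv (\<lambda>\<tau>. A j \<tau> (W \<tau>)) p (V p)) (gop P p F) + cop A p (W p) (?dP F)"
    using sd_cop[OF form(1) W s2, of p "V p"] sd_gop[OF P sF, of p "V p"] by (simp add: sd_const 0[OF form(1)])
  finally have *: "sd (\<lambda>\<tau>. defect P \<tau> (W \<tau>) F) p (V p) = ?dP (cop A' p (W p) F)
      + gop P p (formal_op (\<lambda>j. op_deriv (\<lambda>\<tau>. A' j \<tau> (W \<tau>)) p (V p)) F)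
      - (formal_op (\<lambda>j. op_deriv (\<lambda>\<tau>. A j \<tau> (W \<tau>)) p (V p)) (gop P p F) + cop A p (W p) (?dP F))" .
  have "fps_nth (?dP (cop A' p (W p) F)) k = fps_nth (defect P p (V p) (cop A' p (W p) F)) k"
  proof -
    \<comment> \<open>A' F is h times H, so coefficient k of dP (A' F) is coefficient k - 1 of dP
      H.\<close>
    define H where "H = fps_shift 1 (cop A' p (W p) F)"
    have H: "H \<in> M.FF" "cop A' p (W p) F = fps_X * H"
      using M.FF_shift[OF A'F] fps_const_shift_decomp[of "cop A' p (W p) F"] cop_nth_0[OF form(2) F, of p "W p"]
      by (simp_all add: H_def del: zero_fun_apply)
    show ?thesis
      unfolding H(2) M.hlinD(3)[OF hdP H(1)] M.hlinD(3)[OF hlin_defect[OF P] H(1)]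
      using op_deriv_nth[of P k p "V p" H "k - 1"] P eq H(1) by simp
  qed
  moreover have "fps_nth (cop A p (W p) (?dP F)) k = fps_nth (cop A p (W p) (defect P p (V p) F)) k"
    by (rule cop_nth_cong[OF form(1) M.hlinD(1)[OF hdP F] M.hlinD(1)[OF hlin_defect[OF P] F] op_deriv_nth[OF P eq F]])
  ultimately show ?thesis unfolding * by simp
qed

lemma defect_closed:
  assumes P: "smooth_ops P"
    and eq: "\<And>j \<sigma> v f. j < k \<Longrightarrow> f \<in> C \<Longrightarrow> op_deriv (P j) \<sigma> v f = fps_nth (defect P \<sigma> v (fps_const f)) j"
    and V: "V \<in> vector_fields T" and W: "W \<in> vector_fields T" and VW: "lie_bracket T V W p = 0" and F: "F \<in> M.FF"
  shows "fps_nth (sd (\<lambda>\<tau>. defect P \<tau> (W \<tau>) F) p (V p)) k = fps_nth (sd (\<lambda>\<tau>. defect P \<tau> (V \<tau>) F) p (W p)) k"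
proof -
  let ?d = "\<lambda>B W V. formal_op (\<lambda>j. op_deriv (\<lambda>\<tau>. B j \<tau> (W \<tau>)) p (V p))"
  have e1: "fps_nth (sd (\<lambda>\<tau>. defect P \<tau> (W \<tau>) F) p (V p)) k = fps_nth (defect P p (V p) (cop A' p (W p) F)
      + gop P p (?d A' W V F) - ?d A W V (gop P p F) - cop A p (W p) (defect P p (V p) F)) k"
    by (rule pd_defect[OF P eq V W F])
  have e2: "fps_nth (sd (\<lambda>\<tau>. defect P \<tau> (V \<tau>) F) p (W p)) k = fps_nth (defect P p (W p) (cop A' p (V p) F)
      + gop P p (?d A' V W F) - ?d A V W (gop P p F) - cop A p (V p) (defect P p (W p) F)) k"
    by (rule pd_defect[OF P eq W V F])
  note hP = hlin_gop[OF P, of p] and hA = hlin_cop[OF form(1)] and hA' = hlin_cop[OF form(2)]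
  have PF: "gop P p F \<in> M.FF" by (rule M.hlinD(1)[OF hP F])
  have A'F: "cop A' p v F \<in> M.FF" for v by (rule M.hlinD(1)[OF hA' F])
  have A'A'F: "cop A' p v (cop A' p w F) \<in> M.FF" for v w by (rule M.hlinD(1)[OF hA' A'F])
  have PA'F: "gop P p (cop A' p v F) \<in> M.FF" for v by (rule M.hlinD(1)[OF hP A'F])
  have APF: "cop A p v (gop P p F) \<in> M.FF" for v by (rule M.hlinD(1)[OF hA PF])
  have dF: "?d A' W V F \<in> M.FF" if "W \<in> vector_fields T" for W V
    by (intro M.hlinD(1)[OF M.hlin_formal_op F] additive_op_deriv[OF connection_form_smooth_op[OF form(2) that]])
  \<comment> \<open>Flatness of d + A' is used on F and then transported by P, that of d + A is used
    on P F; the terms so obtained match the expansion of the derivative.\<close>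
  have "gop P p (?d A' W V F + cop A' p (V p) (cop A' p (W p) F)) = gop P p (?d A' V W F + cop A' p (W p) (cop A' p (V p) F))"
    by (simp only: flat_connection_form[OF A' V W VW F])
  then have "gop P p (?d A' W V F) + gop P p (cop A' p (V p) (cop A' p (W p) F)) =
      gop P p (?d A' V W F) + gop P p (cop A' p (W p) (cop A' p (V p) F))"
    by (simp only: M.hlinD(2)[OF hP dF[OF W] A'A'F] M.hlinD(2)[OF hP dF[OF V] A'A'F])
  moreover have "?d A W V (gop P p F) + cop A p (V p) (cop A p (W p) (gop P p F)) =
      ?d A V W (gop P p F) + cop A p (W p) (cop A p (V p) (gop P p F))"
    by (rule flat_connection_form[OF A V W VW PF])
  moreover have e3: "cop A p w (defect P p v F) = cop A p w (gop P p (cop A' p v F)) - cop A p w (cop A p v (gop P p F))" for v w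
    unfolding defect_def by (rule M.hlin_diff_arg[OF hA PA'F APF])
  ultimately show ?thesis
    unfolding e1 e2 e3
      defect_def[of P p "V p" "cop A' p (W p) F"] defect_def[of P p "W p" "cop A' p (V p) F"]
    by (intro arg_cong[where f="\<lambda>F. fps_nth F k"] curvature_cancel)
qed

section \<open>Recursive construction of the gauge transformation\<close>

text \<open>The equation is solved up to order k, while the later coefficients are any smooth
  operators vanishing at the base points. Carrying a complete sequence makes the lemmas on formal
  operators available at every stage.\<close>

definition good :: "nat \<Rightarrow> (nat \<Rightarrow> 't \<Rightarrow> ('p \<Rightarrow> complex) \<Rightarrow> 'p \<Rightarrow> complex) \<Rightarrow> bool"
  where "good k P \<longleftrightarrow> smooth_ops P \<and> (\<forall>\<sigma>. \<forall>f\<in>C. P 0 \<sigma> f = f) \<and>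
    (\<forall>j \<sigma>. \<forall>f\<in>C. 0 < j \<longrightarrow> P j (T.base \<sigma>) f = 0) \<and>
    (\<forall>j \<sigma> v. \<forall>f\<in>C. j \<le> k \<longrightarrow> op_deriv (P j) \<sigma> v f = fps_nth (defect P \<sigma> v (fps_const f)) j)"

lemma good_0: "\<exists>P. good 0 P"
proof -
  define P :: "nat \<Rightarrow> 't \<Rightarrow> ('p \<Rightarrow> complex) \<Rightarrow> 'p \<Rightarrow> complex" where "P = (\<lambda>j \<sigma> f. if j = 0 then f else 0)"
  have "linear_op M (\<lambda>f. f)" by (simp add: linear_op_def)
  then have "smooth_op 0 (P 0)"
    by (simp add: smooth_op_def P_def js_const)
  moreover have "smooth_op k (P k)" if "k > 0" for k
    using that by (simp add: smooth_op_def P_def js_const M.C_0 M.diff_ops_0 del: zero_fun_apply)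
  ultimately have P: "smooth_ops P" unfolding smooth_ops_def by (metis gr0I)
  have "op_deriv (P 0) \<sigma> v f = fps_nth (defect P \<sigma> v (fps_const f)) 0" if "f \<in> C" for \<sigma> v f
    using that unfolding defect_const_nth[OF P that] by (simp add: P_def A_0 fun_eq_iff)
  then show ?thesis using P unfolding good_def by (intro exI[of _ P]) (auto simp: P_def)
qed

lemma good_Suc:
  assumes "good k P"
  shows "\<exists>P'. good (Suc k) P' \<and> (\<forall>j\<le>k. P' j = P j)"
proof -
  have P: "smooth_ops P" and P0: "\<And>\<sigma> f. f \<in> C \<Longrightarrow> P 0 \<sigma> f = f"
    and Pb: "\<And>j \<sigma> f. f \<in> C \<Longrightarrow> 0 < j \<Longrightarrow> P j (T.base \<sigma>) f = 0"
    and eq: "\<And>j \<sigma> v f. j < Suc k \<Longrightarrow> f \<in> C \<Longrightarrow> op_deriv (P j) \<sigma> v f = fps_nth (defect P \<sigma> v (fps_const f)) j"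
    using assms by (auto simp: good_def less_Suc_eq_le)
  define \<alpha> where "\<alpha> = (\<lambda>\<sigma> v f. fps_nth (defect P \<sigma> v (fps_const f)) (Suc k))"
  have js\<alpha>: "js (\<lambda>\<sigma>. \<alpha> \<sigma> (V \<sigma>) f)" if "f \<in> C" "V \<in> vector_fields T" for f V
    using SS_defect[OF P that(2) SS_const[OF M.FF_const[OF that(1)]]] by (simp add: SS_iff \<alpha>_def)
  have "\<exists>u. smooth_fun T UNIV u \<and> (\<forall>p v. mderiv T u p v = \<alpha> p v f x)" if f: "f \<in> C" for f x
  proof (rule exact_complex_form[OF H1])
    show "linear (\<lambda>v. \<alpha> \<sigma> v f x)" for \<sigma> unfolding \<alpha>_def by (rule linear_defect[OF P f])
    show "smooth_fun T UNIV (\<lambda>\<sigma>. \<alpha> \<sigma> (V \<sigma>) f x)" if "V \<in> vector_fields T" for V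
      by (rule js_point[OF js\<alpha>[OF f that]])
    show "mderiv T (\<lambda>\<sigma>. \<alpha> \<sigma> (W \<sigma>) f x) p (V p) = mderiv T (\<lambda>\<sigma>. \<alpha> \<sigma> (V \<sigma>) f x) p (W p)"
      if "V \<in> vector_fields T" "W \<in> vector_fields T" "lie_bracket T V W p = 0" for V W p
    proof -
      have "fps_nth (sd (\<lambda>\<tau>. defect P \<tau> (W \<tau>) (fps_const f)) p (V p)) (Suc k) =
          fps_nth (sd (\<lambda>\<tau>. defect P \<tau> (V \<tau>) (fps_const f)) p (W p)) (Suc k)"
        by (rule defect_closed[OF P eq that M.FF_const[OF f]])
      from fun_cong[OF this, of x] show ?thesis unfolding sd_nth \<alpha>_def .
    qed
  qed
  \<comment> \<open>The primitives are chosen independently for each f and x, so at this point u has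
    no known linearity in f or smoothness in x.\<close>
  then obtain u where u: "\<And>f x. f \<in> C \<Longrightarrow> smooth_fun T UNIV (u f x)"
    "\<And>f x p v. f \<in> C \<Longrightarrow> mderiv T (u f x) p v = \<alpha> p v f x" by metis
  \<comment> \<open>Subtracting the value at the base point removes the locally constant ambiguity
    of the primitive. With this normalization the derivative determines Q, and smoothness, linearity
    and order follow from those of \<alpha>.\<close>
  define Q where "Q = (\<lambda>\<sigma> f x. u f x \<sigma> - u f x (T.base \<sigma>))"
  \<comment> \<open>Near p the base point does not move, so Q differs from u by constants
    there.\<close>
  have Qloc: "\<exists>U. open U \<and> p \<in> U \<and> (\<forall>\<sigma>\<in>U. \<forall>f x. Q \<sigma> f x = u f x \<sigma> - u f x (T.base p))" for p
  proof -
    obtain U where U: "open U" "p \<in> U" "\<forall>q\<in>U. T.base q = T.base p"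
      using T.base_locally_const[of p] by blast
    have "Q \<sigma> f x = u f x \<sigma> - u f x (T.base p)" if "\<sigma> \<in> U" for \<sigma> f x
      unfolding Q_def bspec[OF U(3) that] ..
    then show ?thesis using U(1,2) by blast
  qed
  have Qsm: "smooth_fun T UNIV (\<lambda>\<sigma>. Q \<sigma> f x)" if f: "f \<in> C" for f x
  proof (rule T.smooth_fun_local)
    fix p
    from Qloc[of p] obtain U where U: "open U" "p \<in> U" "\<And>\<sigma>. \<sigma> \<in> U \<Longrightarrow> Q \<sigma> f x = u f x \<sigma> - u f x (T.base p)" by blast
    have "smooth_fun T U (\<lambda>\<sigma>. u f x \<sigma> - u f x (T.base p))"
      by (rule T.smooth_fun_diff[OF T.smooth_fun_subset[OF u(1)[OF f] U(1)] T.smooth_fun_const[OF U(1)]]) simp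
    then have "smooth_fun T U (\<lambda>\<sigma>. Q \<sigma> f x)" by (rule T.smooth_fun_cong[THEN iffD2, rotated]) (rule U(3))
    then show "\<exists>V. p \<in> V \<and> smooth_fun T V (\<lambda>\<sigma>. Q \<sigma> f x)" using U(2) by blast
  qed simp
  have Qd: "op_deriv Q p v f = \<alpha> p v f" if f: "f \<in> C" for p v f
  proof
    fix x
    from Qloc[of p] obtain U where U: "open U" "p \<in> U" "\<And>\<sigma>. \<sigma> \<in> U \<Longrightarrow> Q \<sigma> f x = u f x \<sigma> - u f x (T.base p)" by blast
    show "op_deriv Q p v f x = \<alpha> p v f x"
      using T.mderiv_cong_open[where v=v, OF U] T.mderiv_diff[OF u(1)[OF f] T.smooth_fun_const[OF open_UNIV], of p x "u f x (T.base p)" v]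
      by (simp add: u(2)[OF f])
  qed
  have Qb: "Q (T.base \<sigma>) f = 0" for \<sigma> f by (simp add: Q_def fun_eq_iff)
  have Qjs: "js (\<lambda>\<sigma>. Q \<sigma> f)" if f: "f \<in> C" for f
  proof (rule js_of_pd)
    show "smooth_fun T UNIV (\<lambda>\<sigma>. Q \<sigma> f x)" for x by (rule Qsm[OF f])
    show "js (\<lambda>\<sigma>. op_deriv Q \<sigma> (V \<sigma>) f)" if "V \<in> vector_fields T" for V
      using js\<alpha>[OF f that] by (simp only: Qd[OF f])
    show "Q (T.base \<sigma>) f \<in> C" for \<sigma> by (simp only: Qb M.C_0)
  qed
  have "Q \<sigma> \<in> diff_ops M (Suc k)" for \<sigma>
  proof (rule diff_ops_of_pd[OF Qjs _ Qb])
    show "op_deriv Q \<sigma> v \<in> diff_ops M (Suc k)" for \<sigma> v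
      using diff_ops_defect[OF P, of \<sigma> v "Suc k"]
      by (subst M.diff_ops_cong[OF Qd]) (simp_all only: \<alpha>_def)
  qed
  then have Qop: "smooth_op (Suc k) Q" using Qjs by (simp add: smooth_op_def)
  define P' where "P' = P(Suc k := Q)"
  have P': "smooth_ops P'" using P Qop by (simp add: smooth_ops_def P'_def)
  have "op_deriv (P' j) \<sigma> v f = fps_nth (defect P' \<sigma> v (fps_const f)) j" if j: "j \<le> Suc k" and f: "f \<in> C" for j \<sigma> v f
  proof -
    have "fps_nth (defect P' \<sigma> v (fps_const f)) j = fps_nth (defect P \<sigma> v (fps_const f)) j"
      by (rule defect_cong[OF P' P _ f]) (use j in \<open>simp add: P'_def\<close>)
    moreover have "op_deriv (P' j) \<sigma> v f = fps_nth (defect P \<sigma> v (fps_const f)) j"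
    proof (cases "j = Suc k")
      case True
      then show ?thesis using Qd[OF f] by (simp add: P'_def \<alpha>_def)
    next
      case False
      then show ?thesis using eq[OF _ f, of j] j by (simp add: P'_def)
    qed
    ultimately show ?thesis by simp
  qed
  then have "good (Suc k) P'"
    using P' P0 Pb Qb by (simp add: good_def P'_def)
  then show ?thesis by (intro exI[of _ P']) (simp add: P'_def)
qed

lemma gauge_exists:
  obtains P where "smooth_ops P" "\<And>\<sigma> f. f \<in> C \<Longrightarrow> P 0 \<sigma> f = f" "\<And>j \<sigma> f. f \<in> C \<Longrightarrow> 0 < j \<Longrightarrow> P j (T.base \<sigma>) f = 0"
    "\<And>j \<sigma> v f. f \<in> C \<Longrightarrow> op_deriv (P j) \<sigma> v f = fps_nth (defect P \<sigma> v (fps_const f)) j"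
proof -
  have "\<exists>X. \<forall>n. good n (X n) \<and> (\<forall>j\<le>n. X (Suc n) j = X n j)"
    by (rule dependent_nat_choice) (use good_0 good_Suc in blast)+
  then obtain X where X: "\<And>n. good n (X n)" "\<And>n j. j \<le> n \<Longrightarrow> X (Suc n) j = X n j" by blast
  \<comment> \<open>Stage j fixes coefficient j for good, so the diagonal agrees with every stage up
    to its index.\<close>
  define P where "P = (\<lambda>j. X j j)"
  have XP: "X n j = P j" if "j \<le> n" for n j
    using that by (induction n rule: dec_induct) (simp_all add: P_def X(2))
  have P: "smooth_ops P"
    using X(1) unfolding good_def smooth_ops_def P_def by blast
  show ?thesis
  proof
    show "op_deriv (P j) \<sigma> v f = fps_nth (defect P \<sigma> v (fps_const f)) j" if f: "f \<in> C" for j \<sigma> v f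
    proof -
      have "op_deriv (X j j) \<sigma> v f = fps_nth (defect (X j) \<sigma> v (fps_const f)) j"
        using X(1)[of j] f by (simp add: good_def)
      also have "\<dots> = fps_nth (defect P \<sigma> v (fps_const f)) j"
        by (rule defect_cong[OF _ P _ f]) (use X(1)[of j] in \<open>simp_all add: good_def XP\<close>)
      finally show ?thesis by (simp add: P_def)
    qed
  qed (use P X(1) in \<open>auto simp: good_def P_def\<close>)
qed

text \<open>D(P s) = (dP) s + P ds + A P s, and inserting dP = P A' - A P leaves P (ds + A'
  s).\<close>

lemma gauge_intertwines:
  assumes P: "smooth_ops P" and eq: "\<And>j \<sigma> v f. f \<in> C \<Longrightarrow> op_deriv (P j) \<sigma> v f = fps_nth (defect P \<sigma> v (fps_const f)) j"
    and V: "V \<in> vector_fields T" and s: "s \<in> SS"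
  shows "D V (\<lambda>\<tau>. gop P \<tau> (s \<tau>)) \<sigma> = gop P \<sigma> (D' V s \<sigma>)"
proof -
  note sF = SS_FF[OF s]
  have "formal_op (\<lambda>j. op_deriv (P j) \<sigma> (V \<sigma>)) (s \<sigma>) = defect P \<sigma> (V \<sigma>) (s \<sigma>)"
    by (rule fps_ext) (rule op_deriv_nth[OF P eq sF lessI])
  then have "D V (\<lambda>\<tau>. gop P \<tau> (s \<tau>)) \<sigma> = gop P \<sigma> (cop A' \<sigma> (V \<sigma>) (s \<sigma>)) + gop P \<sigma> (sd s \<sigma> (V \<sigma>))"
    by (simp add: connection_ofD[OF A(1) V SS_gop[OF P s]] sd_gop[OF P s] defect_def)
  also have "\<dots> = gop P \<sigma> (D' V s \<sigma>)"
    unfolding connection_ofD[OF A'(1) V s]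
    by (subst M.hlinD(2)[OF hlin_gop[OF P] sd_FF[OF s] M.hlinD(1)[OF hlin_cop[OF form(2)] sF]]) (rule add.commute)
  finally show ?thesis .
qed

end

section \<open>Multiplicativity and gauge equivalence\<close>

context flat_pair
begin

lemma connection_diff:
  assumes "V \<in> vector_fields T" "s \<in> SS" "t \<in> SS"
  shows "D V (\<lambda>\<tau>. s \<tau> - t \<tau>) \<sigma> = D V s \<sigma> - D V t \<sigma>"
  using M.hlin_diff_arg[OF hlin_cop[OF form(1)] SS_FF[OF assms(2)] SS_FF[OF assms(3)]]
  by (simp add: connection_ofD[OF A(1) assms(1)] assms SS_diff sd_diff)

text \<open>The error E(F, G) = P(F * G) - P F * P G is h-linear in both arguments and satisfies D
  E(f, g) = E(D' f, g) + E(f, D' g). For functions f and g constant on T and in h, D' f and D' g are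
  divisible by h, so coefficient n of the right-hand side involves E below order n only.\<close>

lemma gauge_multiplicative:
  assumes P: "smooth_ops P" and P0: "\<And>\<sigma> f. f \<in> C \<Longrightarrow> P 0 \<sigma> f = f"
    and Pb: "\<And>j \<sigma> f. f \<in> C \<Longrightarrow> 0 < j \<Longrightarrow> P j (T.base \<sigma>) f = 0"
    and eq: "\<And>j \<sigma> v f. f \<in> C \<Longrightarrow> op_deriv (P j) \<sigma> v f = fps_nth (defect P \<sigma> v (fps_const f)) j"
    and c: "\<And>\<sigma> k f. f \<in> C \<Longrightarrow> M.additive_op (c \<sigma> k f)" "\<And>\<sigma> k g. g \<in> C \<Longrightarrow> M.additive_op (\<lambda>f. c \<sigma> k f g)"
    and comp: "compatible_connection T M c D" "compatible_connection T M c D'"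
    and FG: "F \<in> M.FF" "G \<in> M.FF"
  shows "gop P \<sigma> (star (c \<sigma>) F G) = star (c \<sigma>) (gop P \<sigma> F) (gop P \<sigma> G)"
proof -
  note hP = hlin_gop[OF P]
  have hstar: "M.hlin (\<lambda>F. star (c \<sigma>) F G)" "M.hlin (star (c \<sigma>) G)" if "G \<in> M.FF" for \<sigma> G
    using M.hlin_star[where c="c \<sigma>", OF c that] by blast+
  define E where "E = (\<lambda>\<sigma> F G. gop P \<sigma> (star (c \<sigma>) F G) - star (c \<sigma>) (gop P \<sigma> F) (gop P \<sigma> G))"
  have hE1: "M.hlin (\<lambda>F. E \<sigma> F G)" and hE2: "M.hlin (E \<sigma> G)" if "G \<in> M.FF" for \<sigma> G
    unfolding E_def
    using M.hlin_diff[OF M.hlin_comp[OF hP hstar(1)[OF that]] M.hlin_comp[OF hstar(1)[OF M.hlinD(1)[OF hP that]] hP]]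
      M.hlin_diff[OF M.hlin_comp[OF hP hstar(2)[OF that]] M.hlin_comp[OF hstar(2)[OF M.hlinD(1)[OF hP that]] hP]] by blast+
  have star_SS: "(\<lambda>\<tau>. star (c \<tau>) (s \<tau>) (t \<tau>)) \<in> SS" if "s \<in> SS" "t \<in> SS" for s t
    using comp(1) that unfolding compatible_connection_def by blast
  have Dstar: "D V (\<lambda>\<tau>. star (c \<tau>) (s \<tau>) (t \<tau>)) \<sigma> = star (c \<sigma>) (D V s \<sigma>) (t \<sigma>) + star (c \<sigma>) (s \<sigma>) (D V t \<sigma>)"
    "D' V (\<lambda>\<tau>. star (c \<tau>) (s \<tau>) (t \<tau>)) \<sigma> = star (c \<sigma>) (D' V s \<sigma>) (t \<sigma>) + star (c \<sigma>) (s \<sigma>) (D' V t \<sigma>)"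
    if "s \<in> SS" "t \<in> SS" "V \<in> vector_fields T" for V s t \<sigma>
    using comp that unfolding compatible_connection_def by blast+
  have inter: "D V (\<lambda>\<tau>. gop P \<tau> (s \<tau>)) \<sigma> = gop P \<sigma> (D' V s \<sigma>)"
    if "V \<in> vector_fields T" "s \<in> SS" for V s \<sigma>
    by (rule gauge_intertwines[OF P eq that])
  have "fps_nth (E \<sigma> F G) n = 0" if "F \<in> M.FF" "G \<in> M.FF" for n \<sigma> F G
    using that
  proof (induction n arbitrary: \<sigma> F G rule: less_induct)
    case (less n \<sigma> F G)
    have const: "fps_nth (E \<sigma> (fps_const f) (fps_const g)) n = 0" if f: "f \<in> C" and g: "g \<in> C" for f g \<sigma>
    proof
      fix x
      let ?f = "\<lambda>\<tau>::'t. fps_const f" and ?g = "\<lambda>\<tau>::'t. fps_const g"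
      define e where "e = (\<lambda>\<tau>. E \<tau> (fps_const f) (fps_const g))"
      have FFf: "fps_const f \<in> M.FF" "fps_const g \<in> M.FF" using f g M.FF_const by blast+
      have S: "?f \<in> SS" "?g \<in> SS" by (intro SS_const FFf)+
      note PS = SS_gop[OF P S(1)] SS_gop[OF P S(2)]
      note S1 = SS_gop[OF P star_SS[OF S]] and S2 = star_SS[OF PS]
      have eS: "e \<in> SS" unfolding e_def E_def by (rule SS_diff[OF S1 S2])
      have e_js: "js (\<lambda>\<tau>. fps_nth (e \<tau>) n)" using eS by (simp add: SS_iff)
      have "pd (\<lambda>\<tau>. fps_nth (e \<tau>) n) \<sigma> v = 0" for \<sigma> v
      proof -
        obtain V where V: "V \<in> vector_fields T" "V \<sigma> = v" using T.vector_field_through by blast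
        have FFD: "D' V ?f \<sigma> \<in> M.FF" "D' V ?g \<sigma> \<in> M.FF"
          using SS_FF[OF connection_SS[OF A'(1) V(1)]] S by blast+
        \<comment> \<open>On a constant section D' reduces to A', which vanishes modulo h; this is
          where the induction gains one order.\<close>
        have van: "fps_nth (D' V (\<lambda>\<tau>. H) \<sigma>) 0 = 0" if "H \<in> M.FF" for H
          by (simp add: connection_ofD[OF A'(1) V(1) SS_const[OF that]] sd_const cop_nth_0[OF form(2) that] del: zero_fun_apply)
        \<comment> \<open>Dividing the argument by h lowers the coefficient of interest to n - 1;
          for n = 0 the coefficient is 0 outright.\<close>
        have low: "fps_nth (\<Phi> H) n = 0"
          if "M.hlin \<Phi>" "H \<in> M.FF" "fps_nth H 0 = 0" "\<And>K m. K \<in> M.FF \<Longrightarrow> m < n \<Longrightarrow> fps_nth (\<Phi> K) m = 0" for \<Phi> H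
        proof -
          have "H = fps_X * fps_shift 1 H" using fps_const_shift_decomp[of H] that(3) by (simp del: zero_fun_apply)
          then have "\<Phi> H = fps_X * \<Phi> (fps_shift 1 H)" using M.hlinD(3)[OF that(1) M.FF_shift[OF that(2)]] by metis
          then show ?thesis using that(4)[OF M.FF_shift[OF that(2)], of "n - 1"] by simp
        qed
        have "D V e \<sigma> = D V (\<lambda>\<tau>. gop P \<tau> (star (c \<tau>) (fps_const f) (fps_const g))) \<sigma> -
            D V (\<lambda>\<tau>. star (c \<tau>) (gop P \<tau> (fps_const f)) (gop P \<tau> (fps_const g))) \<sigma>"
          unfolding e_def E_def by (rule connection_diff[OF V(1) S1 S2])
        also have "\<dots> = gop P \<sigma> (star (c \<sigma>) (D' V ?f \<sigma>) (fps_const g) + star (c \<sigma>) (fps_const f) (D' V ?g \<sigma>)) -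
            (star (c \<sigma>) (gop P \<sigma> (D' V ?f \<sigma>)) (gop P \<sigma> (fps_const g)) + star (c \<sigma>) (gop P \<sigma> (fps_const f)) (gop P \<sigma> (D' V ?g \<sigma>)))"
          unfolding inter[OF V(1) star_SS[OF S]] Dstar(2)[OF S V(1)] Dstar(1)[OF PS V(1)]
            inter[OF V(1) S(1)] inter[OF V(1) S(2)] ..
        also have "\<dots> = E \<sigma> (D' V ?f \<sigma>) (fps_const g) + E \<sigma> (fps_const f) (D' V ?g \<sigma>)"
          unfolding E_def M.hlinD(2)[OF hP M.hlinD(1)[OF hstar(1)[OF FFf(2)] FFD(1)] M.hlinD(1)[OF hstar(2)[OF FFf(1)] FFD(2)]]
          by (simp add: algebra_simps)
        finally have De: "D V e \<sigma> = E \<sigma> (D' V ?f \<sigma>) (fps_const g) + E \<sigma> (fps_const f) (D' V ?g \<sigma>)" .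
        have "fps_nth (E \<sigma> (D' V ?f \<sigma>) (fps_const g)) n = 0"
          by (rule low[OF hE1[OF FFf(2)] FFD(1) van[OF FFf(1)] less.IH]) (simp_all add: FFf)
        moreover have "fps_nth (E \<sigma> (fps_const f) (D' V ?g \<sigma>)) n = 0"
          by (rule low[OF hE2[OF FFf(1)] FFD(2) van[OF FFf(2)] less.IH]) (simp_all add: FFf)
        ultimately have "fps_nth (D V e \<sigma>) n = 0" unfolding De by (simp del: zero_fun_apply)
        \<comment> \<open>As e vanishes below order n and A modulo h, coefficient n of A e is 0.
          Coefficient n of D e is therefore the plain derivative of that coefficient of e.\<close>
        moreover have "fps_nth (cop A \<sigma> v (e \<sigma>)) n = fps_nth (cop A \<sigma> v 0) n"
          by (rule cop_nth_cong[OF form(1) SS_FF[OF eS]])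
            (use less.IH FFf in \<open>simp_all add: e_def formal_functions_def M.C_0 del: zero_fun_apply\<close>)
        moreover have "fps_nth (cop A \<sigma> v 0) n = 0"
          by (simp add: formal_op_nth M.additive_op_0[OF connection_form_additive[OF form(1)]] del: zero_fun_apply)
        ultimately show ?thesis
          unfolding connection_ofD[OF A(1) V(1) eS] fps_add_nth sd_nth V(2) by (simp only: add_0_right)
      qed
      then have "mderiv T (\<lambda>\<tau>. fps_nth (e \<tau>) n x) \<sigma> v = 0" for \<sigma> v
        by (metis zero_fun_apply)
      moreover have "fps_nth (e (T.base \<sigma>)) n x = 0" for \<sigma>
      proof -
        \<comment> \<open>At base points P is the identity to all orders, which gives the initial
          value E = 0.\<close>
        have "gop P (T.base \<sigma>) H = H" if "H \<in> M.FF" for H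
        proof (rule fps_ext)
          fix m
          have "(\<Sum>k\<le>m. P k (T.base \<sigma>) (fps_nth H (m - k))) = (\<Sum>k\<le>m. if k = 0 then fps_nth H m else 0)"
            by (intro sum.cong) (auto simp: P0 Pb M.FF_nth[OF that] simp del: zero_fun_apply)
          then show "fps_nth (gop P (T.base \<sigma>) H) m = fps_nth H m" by (simp add: formal_op_nth)
        qed
        then show ?thesis using FFf M.hlinD(1)[OF hstar(1)[OF FFf(2)] FFf(1)] by (simp add: e_def E_def)
      qed
      ultimately show "fps_nth (E \<sigma> (fps_const f) (fps_const g)) n x = 0 x"
        using T.eq_zero_of_mderiv[OF js_point[OF e_js], of x \<sigma>] by (simp add: e_def)
    qed
    \<comment> \<open>From constants to all formal functions in two rounds, first in F and then in
      G. The induction hypothesis supplies the coefficients below n.\<close>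
    have "fps_nth (E \<sigma> F (fps_const g)) m = 0" if "g \<in> C" "m \<le> n" for g m
    proof (rule M.hlin_nth_eq_0[OF hE1[OF M.FF_const[OF that(1)]] _ less.prems(1)])
      fix f k assume "f \<in> C" "k \<le> m"
      then show "fps_nth (E \<sigma> (fps_const f) (fps_const g)) k = 0"
        using const[OF _ that(1)] less.IH[of k] that M.FF_const by (cases "k = n") auto
    qed
    from M.hlin_nth_eq_0[OF hE2[OF less.prems(1)] this less.prems(2)] show ?case .
  qed
  then have "E \<sigma> F G = 0" using FG by (intro fps_ext) simp
  then show ?thesis by (simp add: E_def)
qed

lemma gauge_equivalentI:
  assumes c: "\<And>\<sigma> k f. f \<in> C \<Longrightarrow> M.additive_op (c \<sigma> k f)" "\<And>\<sigma> k g. g \<in> C \<Longrightarrow> M.additive_op (\<lambda>f. c \<sigma> k f g)"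
    and comp: "compatible_connection T M c D" "compatible_connection T M c D'"
  shows "gauge_equivalent T M c D D'"
proof -
  obtain P where P: "smooth_ops P" "\<And>\<sigma> f. f \<in> C \<Longrightarrow> P 0 \<sigma> f = f" "\<And>j \<sigma> f. f \<in> C \<Longrightarrow> 0 < j \<Longrightarrow> P j (T.base \<sigma>) f = 0"
    "\<And>j \<sigma> v f. f \<in> C \<Longrightarrow> op_deriv (P j) \<sigma> v f = fps_nth (defect P \<sigma> v (fps_const f)) j"
    by (rule gauge_exists) blast
  have mult: "gop P \<sigma> (star (c \<sigma>) (fps_const f) (fps_const g)) = star (c \<sigma>) (gop P \<sigma> (fps_const f)) (gop P \<sigma> (fps_const g))"
    if "f \<in> C" "g \<in> C" for \<sigma> f g
    by (rule gauge_multiplicative[where c=c, OF P c comp M.FF_const[OF that(1)] M.FF_const[OF that(2)]])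
  have "D' V s \<sigma> = inv_into M.FF (gop P \<sigma>) (D V (\<lambda>\<tau>. gop P \<tau> (s \<tau>)) \<sigma>)"
    if V: "V \<in> vector_fields T" and s: "s \<in> SS" for V s \<sigma>
  proof -
    have "inj_on (gop P \<sigma>) M.FF" by (rule M.formal_op_inj) (rule additive_P[OF P(1)], rule P(2))
    moreover have "D V (\<lambda>\<tau>. gop P \<tau> (s \<tau>)) \<sigma> = gop P \<sigma> (D' V s \<sigma>)"
      by (rule gauge_intertwines[OF P(1,4) V s])
    \<comment> \<open>The argument of \<open>inv_into\<close> is the image of
      \<open>D' V s \<sigma>\<close>, a formal function, so injectivity identifies the
      preimage.\<close>
    ultimately show ?thesis
      using inv_into_f_f[OF _ SS_FF[OF connection_SS[OF A'(1) V s]]] by metis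
  qed
  then show ?thesis
    unfolding gauge_equivalent_def
    using mult P(2) smooth_op_smooth_diff_ops[OF smooth_opsD[OF P(1)]] by (intro exI[of _ P]) blast
qed

end

theorem corollary1p7:
  fixes M :: "('p::{second_countable_topology, t2_space}, real ^ 'm::finite) chart set"
    and \<omega> :: "'p \<Rightarrow> real ^ 'm \<Rightarrow> real ^ 'm \<Rightarrow> real"
    and L :: "('i, 'p, real ^ 'm) line_bundle"
    and T :: "('t::{second_countable_topology, t2_space}, complex ^ 'd::finite) chart set"
    and J :: "'t \<Rightarrow> 'p \<Rightarrow> real ^ 'm \<Rightarrow> real ^ 'm"
    and c :: "'t \<Rightarrow> nat \<Rightarrow> ('p \<Rightarrow> complex) \<Rightarrow> ('p \<Rightarrow> complex) \<Rightarrow> ('p \<Rightarrow> complex)"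
    and D D' :: "('t \<Rightarrow> complex ^ 'd) \<Rightarrow> ('t \<Rightarrow> 'p formal) \<Rightarrow> 't \<Rightarrow> 'p formal"
  assumes "smooth_manifold M" and "compact (UNIV :: 'p set)"
    and "symplectic_form M \<omega>"
    and "prequantum_bundle M \<omega> L"
    and "complex_manifold T" and "trivial_H1 T"
    and "kaehler_family T M \<omega> J"
    and "\<And>\<sigma>. berezin_toeplitz M \<omega> L (J \<sigma>) (c \<sigma>)"
    and "formal_hitchin_connection T M c D"
    and "formal_hitchin_connection T M c D'"
  shows "gauge_equivalent T M c D D'"
proof -
  interpret mfd_pair T M
    using assms(1,5) by (unfold_locales) (auto simp: complex_manifold_def)
  obtain A where A: "connection_of A D" using assms(9) by (auto simp: formal_hitchin_connection_def formal_connection_iff)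
  obtain A' where A': "connection_of A' D'" using assms(10) by (auto simp: formal_hitchin_connection_def formal_connection_iff)
  interpret flat_pair T M A A' D D'
    using A A' assms(6,9,10) by unfold_locales (auto simp: formal_hitchin_connection_def)
  have "linear_op M (c \<sigma> k f)" "linear_op M (\<lambda>g. c \<sigma> k g f)" if "f \<in> smooth_functions M" for \<sigma> k f
    using assms(8)[of \<sigma>] that unfolding berezin_toeplitz_def star_product_def by blast+
  then show ?thesis
    using assms(9,10) by (intro gauge_equivalentI) (auto simp: formal_hitchin_connection_def intro: M.additive_op_linear)
qed

end
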